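(* Let $\lambda^{\dag}$ be the strict distributive law of the copresheaf 2-monad $\mathbb{P}^{\dag}$ over the presheaf 2-monad $\mathbb{P}$ given by $\lambda^{\dag}_X=\overleftarrow{((\mathsf{y}_X)_{\text{!`}})_*}=((\mathsf{y}_X)_{\text{!`}})^!\cdot\mathsf{y}_{\mathsf{P}^{\dag}\mathsf{P}X}:\mathsf{P}^{\dag}\mathsf{P}X\to\mathsf{P}\mathsf{P}^{\dag}X$. Then there is an isomorphism of 2-categories $$(\lambda^{\dag},\mathcal{Q})\text{-}\mathbf{Alg}\cong\mathbf{Mon}(\mathcal{Q}\text{-}\mathbf{Dist}).$$
   Context: Basic conventions. $\mathcal{Q}$ is a small quantaloid: a small category whose hom-sets are complete lattices (order $\preceq$) and whose composition preserves arbitrary suprema in each variable; $\mathcal{Q}_0$ is its object set. For $u:r\to s$, $v:s\to t$, $w:r\to t$ in $\mathcal{Q}$, the arrows $v\searrow w:r\to s$ and $w\swarrow u:s\to t$ are defined by $u\preceq v\searrow w\iff v\circ u\preceq w\iff v\preceq w\swarrow u$. For sets $X,Y$ equipped with type maps $|\text{-}|$ to $\mathcal{Q}_0$, a $\mathcal{Q}$-relation $\phi:X\nrightarrow Y$ assigns to each $(x,y)$ a morphism $\phi(x,y):|x|\to|y|$ of $\mathcal{Q}$; these are ordered pointwise by $\preceq$ and composed by $(\psi\circ\phi)(x,z)=\bigvee_y\psi(y,z)\circ\phi(x,y)$. A $\mathcal{Q}$-category is a set $X$ over $\mathcal{Q}_0$ with a $\mathcal{Q}$-relation $1_X^*:X\nrightarrow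 X$ (its hom) such that $1_{|x|}\preceq 1_X^*(x,x)$ and $1_X^*\circ 1_X^*\preceq 1_X^*$; it is preordered by $x\leq x'\iff |x|=|x'|$ and $1_{|x|}\preceq 1_X^*(x,x')$. A $\mathcal{Q}$-functor $f:X\to Y$ is a type-preserving map with $1_X^*(x,x')\preceq 1_Y^*(fx,fx')$; $f\leq g$ is pointwise. This gives the locally preordered 2-category $\mathcal{Q}\text{-}\mathbf{Cat}$. A 2-functor on it is a functor that is monotone on homs; a 2-monad $(T,m,e)$ is a monad whose functor $T$ is a 2-functor (multiplication $m:TT\to T$, unit $e:1\to T$). A distributor $\phi:X\nrightarrow Y$ is a $\mathcal{Q}$-relation with $1_Y^*\circ\phi\circ 1_X^*\preceq\phi$; distributors form the quantaloid $\mathcal{Q}\text{-}\mathbf{Dist}$, with identities $1_X^*$. For a $\mathcal{Q}$-functor $f:X\to Y$: $f_*:X\nrightarrow Y$, $f_*(x,y)=1_Y^*(fx,y)$, and $f^*:Y\nrightarrow X$, $f^*(y,x)=1_Y^*(y,fx)$. Let $\{s\}$ be the one-object $\mathcal{Q}$-category of type $s\in\mathcal{Q}_0$ with hom $1_s$. $\mathsf{P}X$ is the $\mathcal{Q}$-category of distributors $\sigma:X\nrightarrow\{s\}$ ($|\sigma|=s$) with $1_{\mathsf{P}X}^*(\sigma,\sigma')=\bigwedge_x\sigma'(x)\swarrow\sigma(x)$; $\mathsf{P}^{\dag}X$ is the $\mathcal{Q}$-category of distributors $\tau:\{s\}\nrightarrow X$ ($|\tau|=s$) with $1_{\mathsf{P}^{\dag}X}^*(\tau,\tau')=\bigwedge_x\tau'(x)\searrow\tau(x)$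 (so $\tau\leq\tau'$ in $\mathsf{P}^{\dag}X$ iff $\tau'\preceq\tau$). Yoneda embeddings: $\mathsf{y}_X:X\to\mathsf{P}X$, $x\mapsto 1_X^*(-,x)$; $\mathsf{y}^{\dag}_X:X\to\mathsf{P}^{\dag}X$, $x\mapsto 1_X^*(x,-)$. For $f:X\to Y$: $f_!:\mathsf{P}X\to\mathsf{P}Y$, $\sigma\mapsto\sigma\circ f^*$; $f^!:\mathsf{P}Y\to\mathsf{P}X$, $\sigma\mapsto\sigma\circ f_*$; $f_{\text{!`}}:\mathsf{P}^{\dag}X\to\mathsf{P}^{\dag}Y$, $\tau\mapsto f_*\circ\tau$; $f^{\text{!`}}:\mathsf{P}^{\dag}Y\to\mathsf{P}^{\dag}X$, $\tau\mapsto f^*\circ\tau$. For a distributor $\phi:X\nrightarrow Y$, $\overleftarrow{\phi}:Y\to\mathsf{P}X$ is $y\mapsto\phi(-,y)$. The presheaf 2-monad $\mathbb{P}=(\mathsf{P},\mathsf{s},\mathsf{y})$ sends $f$ to $f_!$, with unit $\mathsf{y}$ and multiplication $\mathsf{s}_X=\mathsf{y}_X^!:\mathsf{P}\mathsf{P}X\to\mathsf{P}X$. The copresheaf 2-monad $\mathbb{P}^{\dag}=(\mathsf{P}^{\dag},\mathsf{s}^{\dag},\mathsf{y}^{\dag})$ sends $f$ to $f_{\text{!`}}$, with unit $\mathsf{y}^{\dag}$ and multiplication $\mathsf{s}^{\dag}_X=(\mathsf{y}^{\dag}_X)^{\text{!`}}:\mathsf{P}^{\dag}\mathsf{P}^{\dag}X\to\mathsf{P}^{\dag}X$.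 Distributive laws ("distributive law" means lax distributive law). For a 2-monad $\mathbb{T}=(T,m,e)$ on $\mathcal{Q}\text{-}\mathbf{Cat}$, a distributive law $\lambda:T\mathsf{P}\to\mathsf{P}T$ of $\mathbb{T}$ over $\mathbb{P}$ is a family of $\mathcal{Q}$-functors $\lambda_X:T\mathsf{P}X\to\mathsf{P}TX$ such that for all $\mathcal{Q}$-functors $f:X\to Y$: (a) $(Tf)_!\cdot\lambda_X\leq\lambda_Y\cdot T(f_!)$; (b) $\mathsf{y}_{TX}\leq\lambda_X\cdot T\mathsf{y}_X$; (c) $\mathsf{s}_{TX}\cdot(\lambda_X)_!\cdot\lambda_{\mathsf{P}X}\leq\lambda_X\cdot T\mathsf{s}_X$; (d) $(e_X)_!\leq\lambda_X\cdot e_{\mathsf{P}X}$; (e) $(m_X)_!\cdot\lambda_{TX}\cdot T\lambda_X\leq\lambda_X\cdot m_{\mathsf{P}X}$. It is strict if all of these are equalities. Lax algebras. For a distributive law $\lambda$ of $\mathbb{T}$ over $\mathbb{P}$, a lax $\lambda$-algebra $(X,p)$ over $\mathcal{Q}$ is a $\mathcal{Q}$-category $X$ with a $\mathcal{Q}$-functor $p:TX\to\mathsf{P}X$ such that $\mathsf{y}_X\leq p\cdot e_X$ and $\mathsf{s}_X\cdot p_!\cdot\lambda_X\cdot Tp\leq p\cdot m_X$. A lax $\lambda$-homomorphism $f:(X,p)\to(Y,q)$ is a $\mathcal{Q}$-functor $f:X\to Y$ with $f_!\cdot p\leq q\cdot Tf$. With the local order of $\mathcal{Q}\text{-}\mathbf{Cat}$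 these form the 2-category $(\lambda,\mathcal{Q})\text{-}\mathbf{Alg}$. (Here $\mathbb{T}=\mathbb{P}^{\dag}$, $\lambda=\lambda^{\dag}$.) $\mathbf{Mon}(\mathcal{Q}\text{-}\mathbf{Dist})$: objects are pairs $(X,\alpha)$ with $X$ a $\mathcal{Q}$-category and $\alpha:X\nrightarrow X$ a distributor such that $1_X^*\preceq\alpha$ and $\alpha\circ\alpha\preceq\alpha$; morphisms $f:(X,\alpha)\to(Y,\beta)$ are $\mathcal{Q}$-functors $f:X\to Y$ with $f_!\cdot\overleftarrow{\alpha}\leq\overleftarrow{\beta}\cdot f$, equivalently $\alpha(x,x')\preceq\beta(fx,fx')$ for all $x,x'\in X$; the local order is inherited from $\mathcal{Q}\text{-}\mathbf{Cat}$. *)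

theory Defs
  imports "HOL-Algebra.Complete_Lattice" "HOL-Library.FuncSet"
begin

section \<open>Small quantaloids\<close>

text \<open>Objects are a set \<open>obs Q\<close>; each hom-set is an ordered set in the sense of HOL-Algebra.
  Composition is written in applicative order: \<open>qcomp Q v u\<close> is \<open>v\<close> after \<open>u\<close>.\<close>

record ('o, 'm) quantaloid_data =
  obs :: "'o set"
  homs :: "'o \<Rightarrow> 'o \<Rightarrow> 'm gorder"
  qcomp :: "'m \<Rightarrow> 'm \<Rightarrow> 'm"
  idm :: "'o \<Rightarrow> 'm"

abbreviation arrows :: "('o, 'm) quantaloid_data \<Rightarrow> 'o \<Rightarrow> 'o \<Rightarrow> 'm set" where
  "arrows Q r s \<equiv> carrier (homs Q r s)"

locale quantaloid =
  fixes Q :: "('o, 'm) quantaloid_data"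
  assumes hom_lattice: "\<lbrakk>r \<in> obs Q; s \<in> obs Q\<rbrakk> \<Longrightarrow> complete_lattice (homs Q r s)"
    and id_closed: "r \<in> obs Q \<Longrightarrow> idm Q r \<in> arrows Q r r"
    and comp_closed:
      "\<lbrakk>r \<in> obs Q; s \<in> obs Q; t \<in> obs Q; u \<in> arrows Q r s; v \<in> arrows Q s t\<rbrakk>
        \<Longrightarrow> qcomp Q v u \<in> arrows Q r t"
    and comp_assoc:
      "\<lbrakk>r \<in> obs Q; s \<in> obs Q; t \<in> obs Q; q \<in> obs Q;
        u \<in> arrows Q r s; v \<in> arrows Q s t; w \<in> arrows Q t q\<rbrakk>
        \<Longrightarrow> qcomp Q w (qcomp Q v u) = qcomp Q (qcomp Q w v) u"
    and comp_id_right: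
      "\<lbrakk>r \<in> obs Q; s \<in> obs Q; u \<in> arrows Q r s\<rbrakk> \<Longrightarrow> qcomp Q u (idm Q r) = u"
    and comp_id_left:
      "\<lbrakk>r \<in> obs Q; s \<in> obs Q; u \<in> arrows Q r s\<rbrakk> \<Longrightarrow> qcomp Q (idm Q s) u = u"
    and comp_Sup_left:
      "\<lbrakk>r \<in> obs Q; s \<in> obs Q; t \<in> obs Q; u \<in> arrows Q r s; V \<subseteq> arrows Q s t\<rbrakk>
        \<Longrightarrow> qcomp Q (\<Squnion>\<^bsub>homs Q s t\<^esub> V) u = \<Squnion>\<^bsub>homs Q r t\<^esub> ((\<lambda>v. qcomp Q v u) ` V)"
    and comp_Sup_right:
      "\<lbrakk>r \<in> obs Q; s \<in> obs Q; t \<in> obs Q; U \<subseteq> arrows Q r s; v \<in> arrows Q s t\<rbrakk>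
        \<Longrightarrow> qcomp Q v (\<Squnion>\<^bsub>homs Q r s\<^esub> U) = \<Squnion>\<^bsub>homs Q r t\<^esub> ((\<lambda>u. qcomp Q v u) ` U)"

text \<open>For \<open>v : s \<rightarrow> t\<close> and \<open>w : r \<rightarrow> t\<close>, \<open>rres Q r s t v w\<close> is \<open>v \<searrow> w : r \<rightarrow> s\<close>.
  For \<open>u : r \<rightarrow> s\<close> and \<open>w : r \<rightarrow> t\<close>, \<open>lres Q r s t w u\<close> is \<open>w \<swarrow> u : s \<rightarrow> t\<close>.\<close>

definition rres :: "('o, 'm) quantaloid_data \<Rightarrow> 'o \<Rightarrow> 'o \<Rightarrow> 'o \<Rightarrow> 'm \<Rightarrow> 'm \<Rightarrow> 'm" where
  "rres Q r s t v w = (THE x. x \<in> arrows Q r s \<and>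
     (\<forall>u\<in>arrows Q r s. u \<sqsubseteq>\<^bsub>homs Q r s\<^esub> x \<longleftrightarrow> qcomp Q v u \<sqsubseteq>\<^bsub>homs Q r t\<^esub> w))"

definition lres :: "('o, 'm) quantaloid_data \<Rightarrow> 'o \<Rightarrow> 'o \<Rightarrow> 'o \<Rightarrow> 'm \<Rightarrow> 'm \<Rightarrow> 'm" where
  "lres Q r s t w u = (THE x. x \<in> arrows Q s t \<and>
     (\<forall>v\<in>arrows Q s t. v \<sqsubseteq>\<^bsub>homs Q s t\<^esub> x \<longleftrightarrow> qcomp Q v u \<sqsubseteq>\<^bsub>homs Q r t\<^esub> w))"


section \<open>\<open>\<Q>\<close>-categories, \<open>\<Q>\<close>-functors, distributors\<close>

text \<open>Sets are subsets of a type. All maps (type maps, homs, functors, relations) are extensional,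
  i.e. fixed to be \<open>undefined\<close> off their domain, so that HOL equality is the intended equality.\<close>

record ('a, 'o, 'm) qcat = "'a partial_object" +
  tp :: "'a \<Rightarrow> 'o"
  hm :: "'a \<Rightarrow> 'a \<Rightarrow> 'm"

definition qrel :: "('o, 'm) quantaloid_data \<Rightarrow> ('a, 'o, 'm) qcat \<Rightarrow> ('b, 'o, 'm) qcat
    \<Rightarrow> ('a \<Rightarrow> 'b \<Rightarrow> 'm) set" where
  "qrel Q X Y = (\<Pi>\<^sub>E x\<in>carrier X. \<Pi>\<^sub>E y\<in>carrier Y. arrows Q (tp X x) (tp Y y))"

definition rel_le :: "('o, 'm) quantaloid_data \<Rightarrow> ('a, 'o, 'm) qcat \<Rightarrow> ('b, 'o, 'm) qcat
    \<Rightarrow> ('a \<Rightarrow> 'b \<Rightarrow> 'm) \<Rightarrow> ('a \<Rightarrow> 'b \<Rightarrow> 'm) \<Rightarrow> bool" where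
  "rel_le Q X Y \<phi> \<psi> \<longleftrightarrow>
     (\<forall>x\<in>carrier X. \<forall>y\<in>carrier Y. \<phi> x y \<sqsubseteq>\<^bsub>homs Q (tp X x) (tp Y y)\<^esub> \<psi> x y)"

text \<open>\<open>rel_comp Q X Y Z \<psi> \<phi>\<close> is \<open>\<psi> \<circ> \<phi>\<close> for \<open>\<phi> : X \<nrightarrow> Y\<close> and \<open>\<psi> : Y \<nrightarrow> Z\<close>.\<close>

definition rel_comp :: "('o, 'm) quantaloid_data \<Rightarrow> ('a, 'o, 'm) qcat \<Rightarrow> ('b, 'o, 'm) qcat
    \<Rightarrow> ('c, 'o, 'm) qcat \<Rightarrow> ('b \<Rightarrow> 'c \<Rightarrow> 'm) \<Rightarrow> ('a \<Rightarrow> 'b \<Rightarrow> 'm) \<Rightarrow> 'a \<Rightarrow> 'c \<Rightarrow> 'm" where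
  "rel_comp Q X Y Z \<psi> \<phi> = (\<lambda>x\<in>carrier X. \<lambda>z\<in>carrier Z.
     \<Squnion>\<^bsub>homs Q (tp X x) (tp Z z)\<^esub> ((\<lambda>y. qcomp Q (\<psi> y z) (\<phi> x y)) ` carrier Y))"

definition qcategory :: "('o, 'm) quantaloid_data \<Rightarrow> ('a, 'o, 'm) qcat \<Rightarrow> bool" where
  "qcategory Q X \<longleftrightarrow>
     tp X \<in> carrier X \<rightarrow>\<^sub>E obs Q \<and>
     hm X \<in> qrel Q X X \<and>
     (\<forall>x\<in>carrier X. idm Q (tp X x) \<sqsubseteq>\<^bsub>homs Q (tp X x) (tp X x)\<^esub> hm X x x) \<and>
     rel_le Q X X (rel_comp Q X X X (hm X) (hm X)) (hm X)"

definition obj_le :: "('o, 'm) quantaloid_data \<Rightarrow> ('a, 'o, 'm) qcat \<Rightarrow> 'a \<Rightarrow> 'a \<Rightarrow> bool" where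
  "obj_le Q X x x' \<longleftrightarrow>
     tp X x = tp X x' \<and> idm Q (tp X x) \<sqsubseteq>\<^bsub>homs Q (tp X x) (tp X x)\<^esub> hm X x x'"

definition qfunctor :: "('o, 'm) quantaloid_data \<Rightarrow> ('a, 'o, 'm) qcat \<Rightarrow> ('b, 'o, 'm) qcat
    \<Rightarrow> ('a \<Rightarrow> 'b) \<Rightarrow> bool" where
  "qfunctor Q X Y f \<longleftrightarrow>
     f \<in> carrier X \<rightarrow>\<^sub>E carrier Y \<and>
     (\<forall>x\<in>carrier X. tp Y (f x) = tp X x) \<and>
     (\<forall>x\<in>carrier X. \<forall>x'\<in>carrier X.
        hm X x x' \<sqsubseteq>\<^bsub>homs Q (tp X x) (tp X x')\<^esub> hm Y (f x) (f x'))"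

text \<open>Order and equality of maps \<open>X \<rightarrow> Y\<close> look only at the points of \<open>X\<close>; hence composites may
  be written with plain \<open>\<circ>\<close> under \<open>fun_le\<close> and \<open>fun_eq\<close>.\<close>

definition fun_le :: "('o, 'm) quantaloid_data \<Rightarrow> ('a, 'o, 'm) qcat \<Rightarrow> ('b, 'o, 'm) qcat
    \<Rightarrow> ('a \<Rightarrow> 'b) \<Rightarrow> ('a \<Rightarrow> 'b) \<Rightarrow> bool" where
  "fun_le Q X Y f g \<longleftrightarrow> (\<forall>x\<in>carrier X. obj_le Q Y (f x) (g x))"

definition fun_eq :: "('a, 'o, 'm) qcat \<Rightarrow> ('a \<Rightarrow> 'b) \<Rightarrow> ('a \<Rightarrow> 'b) \<Rightarrow> bool" where
  "fun_eq X f g \<longleftrightarrow> (\<forall>x\<in>carrier X. f x = g x)"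

definition distributor :: "('o, 'm) quantaloid_data \<Rightarrow> ('a, 'o, 'm) qcat \<Rightarrow> ('b, 'o, 'm) qcat
    \<Rightarrow> ('a \<Rightarrow> 'b \<Rightarrow> 'm) \<Rightarrow> bool" where
  "distributor Q X Y \<phi> \<longleftrightarrow>
     \<phi> \<in> qrel Q X Y \<and>
     rel_le Q X Y (rel_comp Q X Y Y (hm Y) (rel_comp Q X X Y \<phi> (hm X))) \<phi>"

text \<open>\<open>graph X Y f\<close> is \<open>f\<^sub>*\<close> and \<open>cograph X Y f\<close> is \<open>f\<^sup>*\<close>.\<close>

definition graph :: "('a, 'o, 'm) qcat \<Rightarrow> ('b, 'o, 'm) qcat \<Rightarrow> ('a \<Rightarrow> 'b) \<Rightarrow> 'a \<Rightarrow> 'b \<Rightarrow> 'm" where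
  "graph X Y f = (\<lambda>x\<in>carrier X. \<lambda>y\<in>carrier Y. hm Y (f x) y)"

definition cograph :: "('a, 'o, 'm) qcat \<Rightarrow> ('b, 'o, 'm) qcat \<Rightarrow> ('a \<Rightarrow> 'b) \<Rightarrow> 'b \<Rightarrow> 'a \<Rightarrow> 'm" where
  "cograph X Y f = (\<lambda>y\<in>carrier Y. \<lambda>x\<in>carrier X. hm Y y (f x))"


section \<open>Presheaves and copresheaves\<close>

definition star :: "('o, 'm) quantaloid_data \<Rightarrow> 'o \<Rightarrow> (unit, 'o, 'm) qcat" where
  "star Q s = \<lparr>carrier = {()}, tp = (\<lambda>_. s), hm = (\<lambda>_ _. idm Q s)\<rparr>"

text \<open>A (co)presheaf is paired with its type, which the bare relation does not determine.\<close>

type_synonym ('a, 'o, 'm) presheaf = "'o \<times> ('a \<Rightarrow> unit \<Rightarrow> 'm)"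
type_synonym ('a, 'o, 'm) copresheaf = "'o \<times> (unit \<Rightarrow> 'a \<Rightarrow> 'm)"

definition presheaves :: "('o, 'm) quantaloid_data \<Rightarrow> ('a, 'o, 'm) qcat
    \<Rightarrow> ('a, 'o, 'm) presheaf set" where
  "presheaves Q X = {(s, \<sigma>). s \<in> obs Q \<and> distributor Q X (star Q s) \<sigma>}"

definition copresheaves :: "('o, 'm) quantaloid_data \<Rightarrow> ('a, 'o, 'm) qcat
    \<Rightarrow> ('a, 'o, 'm) copresheaf set" where
  "copresheaves Q X = {(s, \<tau>). s \<in> obs Q \<and> distributor Q (star Q s) X \<tau>}"

definition Psh :: "('o, 'm) quantaloid_data \<Rightarrow> ('a, 'o, 'm) qcat
    \<Rightarrow> (('a, 'o, 'm) presheaf, 'o, 'm) qcat" where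
  "Psh Q X = \<lparr>carrier = presheaves Q X,
     tp = (\<lambda>\<sigma>\<in>presheaves Q X. fst \<sigma>),
     hm = (\<lambda>\<sigma>\<in>presheaves Q X. \<lambda>\<sigma>'\<in>presheaves Q X.
       \<Sqinter>\<^bsub>homs Q (fst \<sigma>) (fst \<sigma>')\<^esub>
         ((\<lambda>x. lres Q (tp X x) (fst \<sigma>) (fst \<sigma>') (snd \<sigma>' x ()) (snd \<sigma> x ())) ` carrier X))\<rparr>"

definition Cop :: "('o, 'm) quantaloid_data \<Rightarrow> ('a, 'o, 'm) qcat
    \<Rightarrow> (('a, 'o, 'm) copresheaf, 'o, 'm) qcat" where
  "Cop Q X = \<lparr>carrier = copresheaves Q X,
     tp = (\<lambda>\<tau>\<in>copresheaves Q X. fst \<tau>),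
     hm = (\<lambda>\<tau>\<in>copresheaves Q X. \<lambda>\<tau>'\<in>copresheaves Q X.
       \<Sqinter>\<^bsub>homs Q (fst \<tau>) (fst \<tau>')\<^esub>
         ((\<lambda>x. rres Q (fst \<tau>) (fst \<tau>') (tp X x) (snd \<tau>' () x) (snd \<tau> () x)) ` carrier X))\<rparr>"

definition yo :: "('o, 'm) quantaloid_data \<Rightarrow> ('a, 'o, 'm) qcat \<Rightarrow> 'a \<Rightarrow> ('a, 'o, 'm) presheaf" where
  "yo Q X = (\<lambda>x\<in>carrier X. (tp X x, \<lambda>x'\<in>carrier X. \<lambda>_\<in>{()}. hm X x' x))"

definition coyo :: "('o, 'm) quantaloid_data \<Rightarrow> ('a, 'o, 'm) qcat \<Rightarrow> 'a \<Rightarrow> ('a, 'o, 'm) copresheaf" where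
  "coyo Q X = (\<lambda>x\<in>carrier X. (tp X x, \<lambda>_\<in>{()}. \<lambda>x'\<in>carrier X. hm X x x'))"

text \<open>For \<open>f : X \<rightarrow> Y\<close>: \<open>psh_dir\<close> is \<open>f\<^sub>! : \<P>X \<rightarrow> \<P>Y\<close>, \<open>psh_inv\<close> is \<open>f\<^sup>! : \<P>Y \<rightarrow> \<P>X\<close>; \<open>cop_dir\<close> and
  \<open>cop_inv\<close> are the same maps for copresheaves (written with an inverted exclamation mark).\<close>

definition psh_dir :: "('o, 'm) quantaloid_data \<Rightarrow> ('a, 'o, 'm) qcat \<Rightarrow> ('b, 'o, 'm) qcat
    \<Rightarrow> ('a \<Rightarrow> 'b) \<Rightarrow> ('a, 'o, 'm) presheaf \<Rightarrow> ('b, 'o, 'm) presheaf" where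
  "psh_dir Q X Y f = (\<lambda>\<sigma>\<in>presheaves Q X.
     (fst \<sigma>, rel_comp Q Y X (star Q (fst \<sigma>)) (snd \<sigma>) (cograph X Y f)))"

definition psh_inv :: "('o, 'm) quantaloid_data \<Rightarrow> ('a, 'o, 'm) qcat \<Rightarrow> ('b, 'o, 'm) qcat
    \<Rightarrow> ('a \<Rightarrow> 'b) \<Rightarrow> ('b, 'o, 'm) presheaf \<Rightarrow> ('a, 'o, 'm) presheaf" where
  "psh_inv Q X Y f = (\<lambda>\<sigma>\<in>presheaves Q Y.
     (fst \<sigma>, rel_comp Q X Y (star Q (fst \<sigma>)) (snd \<sigma>) (graph X Y f)))"

definition cop_dir :: "('o, 'm) quantaloid_data \<Rightarrow> ('a, 'o, 'm) qcat \<Rightarrow> ('b, 'o, 'm) qcat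
    \<Rightarrow> ('a \<Rightarrow> 'b) \<Rightarrow> ('a, 'o, 'm) copresheaf \<Rightarrow> ('b, 'o, 'm) copresheaf" where
  "cop_dir Q X Y f = (\<lambda>\<tau>\<in>copresheaves Q X.
     (fst \<tau>, rel_comp Q (star Q (fst \<tau>)) X Y (graph X Y f) (snd \<tau>)))"

definition cop_inv :: "('o, 'm) quantaloid_data \<Rightarrow> ('a, 'o, 'm) qcat \<Rightarrow> ('b, 'o, 'm) qcat
    \<Rightarrow> ('a \<Rightarrow> 'b) \<Rightarrow> ('b, 'o, 'm) copresheaf \<Rightarrow> ('a, 'o, 'm) copresheaf" where
  "cop_inv Q X Y f = (\<lambda>\<tau>\<in>copresheaves Q Y.
     (fst \<tau>, rel_comp Q (star Q (fst \<tau>)) Y X (cograph X Y f) (snd \<tau>)))"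

text \<open>For \<open>\<phi> : X \<nrightarrow> Y\<close>, the map \<open>Y \<rightarrow> \<P>X\<close>, \<open>y \<mapsto> \<phi>(-, y)\<close>.\<close>

definition transp :: "('a, 'o, 'm) qcat \<Rightarrow> ('b, 'o, 'm) qcat \<Rightarrow> ('a \<Rightarrow> 'b \<Rightarrow> 'm)
    \<Rightarrow> 'b \<Rightarrow> ('a, 'o, 'm) presheaf" where
  "transp X Y \<phi> = (\<lambda>y\<in>carrier Y. (tp Y y, \<lambda>x\<in>carrier X. \<lambda>_\<in>{()}. \<phi> x y))"

definition psh_mult :: "('o, 'm) quantaloid_data \<Rightarrow> ('a, 'o, 'm) qcat
    \<Rightarrow> (('a, 'o, 'm) presheaf, 'o, 'm) presheaf \<Rightarrow> ('a, 'o, 'm) presheaf" where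
  "psh_mult Q X = psh_inv Q X (Psh Q X) (yo Q X)"

definition cop_mult :: "('o, 'm) quantaloid_data \<Rightarrow> ('a, 'o, 'm) qcat
    \<Rightarrow> (('a, 'o, 'm) copresheaf, 'o, 'm) copresheaf \<Rightarrow> ('a, 'o, 'm) copresheaf" where
  "cop_mult Q X = cop_inv Q X (Cop Q X) (coyo Q X)"


section \<open>The distributive law of the copresheaf monad over the presheaf monad\<close>

definition lam_dag :: "('o, 'm) quantaloid_data \<Rightarrow> ('a, 'o, 'm) qcat
    \<Rightarrow> (('a, 'o, 'm) presheaf, 'o, 'm) copresheaf \<Rightarrow> (('a, 'o, 'm) copresheaf, 'o, 'm) presheaf" where
  "lam_dag Q X = transp (Cop Q X) (Cop Q (Psh Q X))
     (graph (Cop Q X) (Cop Q (Psh Q X)) (cop_dir Q X (Psh Q X) (yo Q X)))"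

text \<open>The second description of the law, as a composite of \<open>\<Q>\<close>-functors.\<close>

definition lam_dag_composite :: "('o, 'm) quantaloid_data \<Rightarrow> ('a, 'o, 'm) qcat
    \<Rightarrow> (('a, 'o, 'm) presheaf, 'o, 'm) copresheaf \<Rightarrow> (('a, 'o, 'm) copresheaf, 'o, 'm) presheaf" where
  "lam_dag_composite Q X =
     psh_inv Q (Cop Q X) (Cop Q (Psh Q X)) (cop_dir Q X (Psh Q X) (yo Q X))
       \<circ> yo Q (Cop Q (Psh Q X))"

text \<open>The components of a law live at infinitely many types, so the axioms are stated for the
  polymorphic constant \<open>lam_dag\<close> itself; the clauses are those of a distributive law,
  with equality throughout.\<close>

definition lam_dag_strict_law :: "('o, 'm) quantaloid_data \<Rightarrow> 'a itself \<Rightarrow> bool" where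
  "lam_dag_strict_law Q _ \<longleftrightarrow>
    (\<forall>X :: ('a, 'o, 'm) qcat. qcategory Q X \<longrightarrow>
      qfunctor Q (Cop Q (Psh Q X)) (Psh Q (Cop Q X)) (lam_dag Q X) \<and>
      (\<forall>(Y :: ('a, 'o, 'm) qcat) f. qcategory Q Y \<and> qfunctor Q X Y f \<longrightarrow>
        fun_eq (Cop Q (Psh Q X))
          (psh_dir Q (Cop Q X) (Cop Q Y) (cop_dir Q X Y f) \<circ> lam_dag Q X)
          (lam_dag Q Y \<circ> cop_dir Q (Psh Q X) (Psh Q Y) (psh_dir Q X Y f))) \<and>
      fun_eq (Cop Q X)
        (yo Q (Cop Q X))
        (lam_dag Q X \<circ> cop_dir Q X (Psh Q X) (yo Q X)) \<and>
      fun_eq (Cop Q (Psh Q (Psh Q X)))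
        (psh_mult Q (Cop Q X)
          \<circ> psh_dir Q (Cop Q (Psh Q X)) (Psh Q (Cop Q X)) (lam_dag Q X)
          \<circ> lam_dag Q (Psh Q X))
        (lam_dag Q X \<circ> cop_dir Q (Psh Q (Psh Q X)) (Psh Q X) (psh_mult Q X)) \<and>
      fun_eq (Psh Q X)
        (psh_dir Q X (Cop Q X) (coyo Q X))
        (lam_dag Q X \<circ> coyo Q (Psh Q X)) \<and>
      fun_eq (Cop Q (Cop Q (Psh Q X)))
        (psh_dir Q (Cop Q (Cop Q X)) (Cop Q X) (cop_mult Q X)
          \<circ> lam_dag Q (Cop Q X)
          \<circ> cop_dir Q (Cop Q (Psh Q X)) (Psh Q (Cop Q X)) (lam_dag Q X))
        (lam_dag Q X \<circ> cop_mult Q (Psh Q X)))"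


section \<open>Locally preordered 2-categories\<close>

text \<open>\<open>cmp2 \<C> A B C g f\<close> is \<open>g\<close> after \<open>f\<close> for \<open>f : A \<rightarrow> B\<close> and \<open>g : B \<rightarrow> C\<close>; hom-sets need not be
  disjoint.\<close>

record ('c, 'f) cat2 =
  obj2 :: "'c set"
  hom2 :: "'c \<Rightarrow> 'c \<Rightarrow> 'f set"
  id2 :: "'c \<Rightarrow> 'f"
  cmp2 :: "'c \<Rightarrow> 'c \<Rightarrow> 'c \<Rightarrow> 'f \<Rightarrow> 'f \<Rightarrow> 'f"
  le2 :: "'c \<Rightarrow> 'c \<Rightarrow> 'f \<Rightarrow> 'f \<Rightarrow> bool"

definition two_category :: "('c, 'f) cat2 \<Rightarrow> bool" where
  "two_category \<C> \<longleftrightarrow>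
    (\<forall>A\<in>obj2 \<C>. id2 \<C> A \<in> hom2 \<C> A A) \<and>
    (\<forall>A\<in>obj2 \<C>. \<forall>B\<in>obj2 \<C>. \<forall>C\<in>obj2 \<C>. \<forall>f\<in>hom2 \<C> A B. \<forall>g\<in>hom2 \<C> B C.
       cmp2 \<C> A B C g f \<in> hom2 \<C> A C) \<and>
    (\<forall>A\<in>obj2 \<C>. \<forall>B\<in>obj2 \<C>. \<forall>f\<in>hom2 \<C> A B.
       cmp2 \<C> A A B f (id2 \<C> A) = f \<and> cmp2 \<C> A B B (id2 \<C> B) f = f) \<and>
    (\<forall>A\<in>obj2 \<C>. \<forall>B\<in>obj2 \<C>. \<forall>C\<in>obj2 \<C>. \<forall>D\<in>obj2 \<C>.
       \<forall>f\<in>hom2 \<C> A B. \<forall>g\<in>hom2 \<C> B C. \<forall>h\<in>hom2 \<C> C D.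
       cmp2 \<C> A C D h (cmp2 \<C> A B C g f) = cmp2 \<C> A B D (cmp2 \<C> B C D h g) f) \<and>
    (\<forall>A\<in>obj2 \<C>. \<forall>B\<in>obj2 \<C>. \<forall>f\<in>hom2 \<C> A B. le2 \<C> A B f f) \<and>
    (\<forall>A\<in>obj2 \<C>. \<forall>B\<in>obj2 \<C>. \<forall>f\<in>hom2 \<C> A B. \<forall>g\<in>hom2 \<C> A B. \<forall>h\<in>hom2 \<C> A B.
       le2 \<C> A B f g \<and> le2 \<C> A B g h \<longrightarrow> le2 \<C> A B f h) \<and>
    (\<forall>A\<in>obj2 \<C>. \<forall>B\<in>obj2 \<C>. \<forall>C\<in>obj2 \<C>.
       \<forall>f\<in>hom2 \<C> A B. \<forall>f'\<in>hom2 \<C> A B. \<forall>g\<in>hom2 \<C> B C. \<forall>g'\<in>hom2 \<C> B C.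
       le2 \<C> A B f f' \<and> le2 \<C> B C g g'
         \<longrightarrow> le2 \<C> A C (cmp2 \<C> A B C g f) (cmp2 \<C> A B C g' f'))"

definition two_functor :: "('c, 'f) cat2 \<Rightarrow> ('d, 'g) cat2 \<Rightarrow> ('c \<Rightarrow> 'd)
    \<Rightarrow> ('c \<Rightarrow> 'c \<Rightarrow> 'f \<Rightarrow> 'g) \<Rightarrow> bool" where
  "two_functor \<C> \<D> F F1 \<longleftrightarrow>
    (\<forall>A\<in>obj2 \<C>. F A \<in> obj2 \<D>) \<and>
    (\<forall>A\<in>obj2 \<C>. \<forall>B\<in>obj2 \<C>. \<forall>f\<in>hom2 \<C> A B. F1 A B f \<in> hom2 \<D> (F A) (F B)) \<and>
    (\<forall>A\<in>obj2 \<C>. F1 A A (id2 \<C> A) = id2 \<D> (F A)) \<and>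
    (\<forall>A\<in>obj2 \<C>. \<forall>B\<in>obj2 \<C>. \<forall>C\<in>obj2 \<C>. \<forall>f\<in>hom2 \<C> A B. \<forall>g\<in>hom2 \<C> B C.
       F1 A C (cmp2 \<C> A B C g f) = cmp2 \<D> (F A) (F B) (F C) (F1 B C g) (F1 A B f)) \<and>
    (\<forall>A\<in>obj2 \<C>. \<forall>B\<in>obj2 \<C>. \<forall>f\<in>hom2 \<C> A B. \<forall>g\<in>hom2 \<C> A B.
       le2 \<C> A B f g \<longrightarrow> le2 \<D> (F A) (F B) (F1 A B f) (F1 A B g))"

definition two_iso :: "('c, 'f) cat2 \<Rightarrow> ('d, 'g) cat2 \<Rightarrow> bool" where
  "two_iso \<C> \<D> \<longleftrightarrow> two_category \<C> \<and> two_category \<D> \<and>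
    (\<exists>F F1 G G1. two_functor \<C> \<D> F F1 \<and> two_functor \<D> \<C> G G1 \<and>
      (\<forall>A\<in>obj2 \<C>. G (F A) = A) \<and>
      (\<forall>B\<in>obj2 \<D>. F (G B) = B) \<and>
      (\<forall>A\<in>obj2 \<C>. \<forall>B\<in>obj2 \<C>. \<forall>f\<in>hom2 \<C> A B. G1 (F A) (F B) (F1 A B f) = f) \<and>
      (\<forall>A\<in>obj2 \<D>. \<forall>B\<in>obj2 \<D>. \<forall>g\<in>hom2 \<D> A B. F1 (G A) (G B) (G1 A B g) = g))"


section \<open>Lax algebras and monads in \<open>\<Q>\<close>-Dist\<close>

type_synonym ('a, 'o, 'm) lax_alg =
  "('a, 'o, 'm) qcat \<times> (('a, 'o, 'm) copresheaf \<Rightarrow> ('a, 'o, 'm) presheaf)"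

definition lax_algebra :: "('o, 'm) quantaloid_data \<Rightarrow> ('a, 'o, 'm) qcat
    \<Rightarrow> (('a, 'o, 'm) copresheaf \<Rightarrow> ('a, 'o, 'm) presheaf) \<Rightarrow> bool" where
  "lax_algebra Q X p \<longleftrightarrow>
     qcategory Q X \<and> qfunctor Q (Cop Q X) (Psh Q X) p \<and>
     fun_le Q X (Psh Q X) (yo Q X) (p \<circ> coyo Q X) \<and>
     fun_le Q (Cop Q (Cop Q X)) (Psh Q X)
       (psh_mult Q X \<circ> psh_dir Q (Cop Q X) (Psh Q X) p \<circ> lam_dag Q X
         \<circ> cop_dir Q (Cop Q X) (Psh Q X) p)
       (p \<circ> cop_mult Q X)"

definition lax_hom :: "('o, 'm) quantaloid_data \<Rightarrow> ('a, 'o, 'm) lax_alg \<Rightarrow> ('a, 'o, 'm) lax_alg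
    \<Rightarrow> ('a \<Rightarrow> 'a) \<Rightarrow> bool" where
  "lax_hom Q = (\<lambda>(X, p) (Y, q) f.
     qfunctor Q X Y f \<and>
     fun_le Q (Cop Q X) (Psh Q Y) (psh_dir Q X Y f \<circ> p) (q \<circ> cop_dir Q X Y f))"

definition Lax_Alg :: "('o, 'm) quantaloid_data \<Rightarrow> (('a, 'o, 'm) lax_alg, 'a \<Rightarrow> 'a) cat2" where
  "Lax_Alg Q = \<lparr>obj2 = {(X, p). lax_algebra Q X p},
     hom2 = (\<lambda>A B. {f. lax_hom Q A B f}),
     id2 = (\<lambda>A. \<lambda>x\<in>carrier (fst A). x),
     cmp2 = (\<lambda>A B C g f. compose (carrier (fst A)) g f),
     le2 = (\<lambda>A B. fun_le Q (fst A) (fst B))\<rparr>"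

type_synonym ('a, 'o, 'm) dist_mon = "('a, 'o, 'm) qcat \<times> ('a \<Rightarrow> 'a \<Rightarrow> 'm)"

definition dist_monad :: "('o, 'm) quantaloid_data \<Rightarrow> ('a, 'o, 'm) qcat \<Rightarrow> ('a \<Rightarrow> 'a \<Rightarrow> 'm) \<Rightarrow> bool" where
  "dist_monad Q X \<alpha> \<longleftrightarrow>
     qcategory Q X \<and> distributor Q X X \<alpha> \<and>
     rel_le Q X X (hm X) \<alpha> \<and> rel_le Q X X (rel_comp Q X X X \<alpha> \<alpha>) \<alpha>"

definition monad_hom :: "('o, 'm) quantaloid_data \<Rightarrow> ('a, 'o, 'm) dist_mon \<Rightarrow> ('a, 'o, 'm) dist_mon
    \<Rightarrow> ('a \<Rightarrow> 'a) \<Rightarrow> bool" where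
  "monad_hom Q = (\<lambda>(X, \<alpha>) (Y, \<beta>) f.
     qfunctor Q X Y f \<and>
     fun_le Q X (Psh Q Y) (psh_dir Q X Y f \<circ> transp X X \<alpha>) (transp Y Y \<beta> \<circ> f))"

definition Mon_Dist :: "('o, 'm) quantaloid_data \<Rightarrow> (('a, 'o, 'm) dist_mon, 'a \<Rightarrow> 'a) cat2" where
  "Mon_Dist Q = \<lparr>obj2 = {(X, \<alpha>). dist_monad Q X \<alpha>},
     hom2 = (\<lambda>A B. {f. monad_hom Q A B f}),
     id2 = (\<lambda>A. \<lambda>x\<in>carrier (fst A). x),
     cmp2 = (\<lambda>A B C g f. compose (carrier (fst A)) g f),
     le2 = (\<lambda>A B. fun_le Q (fst A) (fst B))\<rparr>"

end

theory Submission
  imports Defs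
begin

text \<open>
  Every arrow in sight is the solution of a universal problem. Write \<open>\<sigma>(x)\<close> and \<open>\<tau>(x)\<close> for the values
  of a presheaf and of a copresheaf. Then \<open>u \<preceq> hom(\<sigma>, \<sigma>')\<close> in \<open>\<P>X\<close> iff \<open>u \<circ> \<sigma>(x) \<preceq> \<sigma>'(x)\<close> for all \<open>x\<close>,
  and \<open>u \<preceq> hom(\<tau>, \<tau>')\<close> in \<open>\<P>\<^sup>\<dagger>X\<close> iff \<open>\<tau>'(x) \<circ> u \<preceq> \<tau>(x)\<close> for all \<open>x\<close> (\<open>leq_hm_Psh_iff\<close>,
  \<open>leq_hm_Cop_iff\<close>); composites of distributors are suprema. Residuals and infima are therefore never
  computed with: two arrows are compared through the arrows below them, or above them.

  \<^bold>\<open>The law.\<close> For \<open>\<sigma> \<in> \<P>X\<close> and \<open>\<tau> \<in> \<P>\<^sup>\<dagger>X\<close> let \<open>\<sigma> \<cdot> \<tau>\<close> be the supremum of the arrows \<open>\<sigma>(x) \<circ> \<tau>(x)\<close>. The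
  direct image \<open>Y\<tau>\<close> of \<open>\<tau>\<close> along the Yoneda embedding is the copresheaf \<open>\<sigma> \<mapsto> \<sigma> \<cdot> \<tau>\<close> on \<open>\<P>X\<close>, and the law
  is representable: \<open>\<lambda>(T)(\<tau>) = hom(Y\<tau>, T)\<close>. Both sides of each axiom are thus homs, once the direct
  images that occur have been evaluated. Two adjunctions do this. Inverse image is left adjoint to
  direct image of copresheaves (\<open>hm_cop_inv_adjoint\<close>), so a direct image inside \<open>\<lambda>\<close> becomes an inverse
  image of \<open>Y\<tau>\<close>. And the direct image of a presheaf along a map having a left adjoint \<open>l\<close> is evaluation
  at \<open>l\<close> (\<open>pv_psh_dir_left_adjoint\<close>); the maps concerned are direct image of copresheaves, \<open>\<lambda>\<close> itself
  (which has the partial left adjoint \<open>Y\<close>, defined on representables), and the multiplication of \<open>\<P>\<^sup>\<dagger>\<close>,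
  which is right adjoint to the co-Yoneda embedding (\<open>hm_cop_mult\<close>). What remains are identities for
  the pairing: \<open>y(x) \<cdot> \<tau> = \<tau>(x)\<close>, \<open>\<sigma> \<cdot> y\<^sup>\<dagger>(x) = \<sigma>(x)\<close>, and its invariance under moving a functor from
  one side to the other.

  \<^bold>\<open>The isomorphism.\<close> Unravelled, the multiplication axiom of a lax algebra says: if
  \<open>T(\<rho>) \<circ> u \<preceq> p(\<rho>) \<cdot> \<tau>\<close> for all \<open>\<rho>\<close>, then \<open>u \<circ> p(\<tau>)(x) \<preceq> p(mT)(x)\<close> (\<open>lax_algebra_iff\<close>). An algebra
  \<open>p\<close> and a monad \<open>\<alpha>\<close> correspond by \<open>\<alpha>(x, x') = p(y\<^sup>\<dagger>x')(x)\<close> and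
  \<open>p(\<tau>)(x) = hom(\<alpha>(x, -), \<tau>)\<close>, the greatest \<open>u\<close> with \<open>\<tau>(x') \<circ> u \<preceq> \<alpha>(x, x')\<close> for all \<open>x'\<close>. That \<open>p\<close>
  lies below the algebra rebuilt from its \<open>\<alpha>\<close> is functoriality; the converse, which makes \<open>p\<close> determined
  by its values on representables, is the multiplication axiom at the direct image of \<open>\<tau>\<close> along
  the co-Yoneda embedding, which the multiplication of \<open>\<P>\<^sup>\<dagger>\<close> maps back to \<open>\<tau>\<close>
  (\<open>algebra_of_monad_of_algebra\<close>). The transitivity of \<open>\<alpha>\<close> is the same axiom at a representable. The
  correspondence leaves the underlying \<open>\<Q>\<close>-category alone and identifies the two notions of morphism, so
  it is an isomorphism of 2-categories that is the identity on 1-cells.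
\<close>

section \<open>Arrows of a quantaloid\<close>

context quantaloid
begin

abbreviation cmp (infixr "\<bullet>" 70) where
  "v \<bullet> u \<equiv> qcomp Q v u"

text \<open>Arrows carry no type, so typing is a predicate, and the order is bundled with the typing of both
  sides: the types of all arrows in a chain of inequalities are then known from the inequalities alone.\<close>

definition arr :: "'o \<Rightarrow> 'o \<Rightarrow> 'm \<Rightarrow> bool" where
  "arr r s u \<longleftrightarrow> r \<in> obs Q \<and> s \<in> obs Q \<and> u \<in> arrows Q r s"

definition leq :: "'m \<Rightarrow> 'o \<Rightarrow> 'o \<Rightarrow> 'm \<Rightarrow> bool" ("(_ \<preceq>\<^bsub>_,_\<^esub> _)" [51, 0, 0, 51] 50) where
  "u \<preceq>\<^bsub>r,s\<^esub> v \<longleftrightarrow> arr r s u \<and> arr r s v \<and> u \<sqsubseteq>\<^bsub>homs Q r s\<^esub> v"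

lemma arr_obs: "arr r s u \<Longrightarrow> r \<in> obs Q" "arr r s u \<Longrightarrow> s \<in> obs Q"
  by (auto simp: arr_def)

lemma leq_arr: "u \<preceq>\<^bsub>r,s\<^esub> v \<Longrightarrow> arr r s u" "u \<preceq>\<^bsub>r,s\<^esub> v \<Longrightarrow> arr r s v"
  by (auto simp: leq_def)

lemma hom_order: "arr r s u \<Longrightarrow> complete_lattice (homs Q r s)"
  by (auto simp: arr_def hom_lattice)

lemma leq_refl: "arr r s u \<Longrightarrow> u \<preceq>\<^bsub>r,s\<^esub> u"
proof -
  assume u: "arr r s u"
  interpret complete_lattice "homs Q r s" by (rule hom_order[OF u])
  show ?thesis using u by (auto simp: leq_def arr_def)
qed

lemma leq_trans [trans]:
  assumes "u \<preceq>\<^bsub>r,s\<^esub> v" "v \<preceq>\<^bsub>r,s\<^esub> w" shows "u \<preceq>\<^bsub>r,s\<^esub> w"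
proof -
  interpret complete_lattice "homs Q r s" by (rule hom_order[OF leq_arr(1)[OF assms(1)]])
  show ?thesis using assms by (auto simp: leq_def arr_def intro: le_trans)
qed

lemma leq_antisym:
  assumes "u \<preceq>\<^bsub>r,s\<^esub> v" "v \<preceq>\<^bsub>r,s\<^esub> u" shows "u = v"
proof -
  interpret complete_lattice "homs Q r s" by (rule hom_order[OF leq_arr(1)[OF assms(1)]])
  show ?thesis using assms by (auto simp: leq_def arr_def intro: le_antisym)
qed

lemma eq_if_same_lower_bounds:
  assumes "arr r s v" "arr r s w" "\<And>u. u \<preceq>\<^bsub>r,s\<^esub> v \<longleftrightarrow> u \<preceq>\<^bsub>r,s\<^esub> w"
  shows "v = w"
  using assms leq_refl leq_antisym by blast

lemma eq_if_same_upper_bounds: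
  assumes "arr r s v" "arr r s w" "\<And>u. v \<preceq>\<^bsub>r,s\<^esub> u \<longleftrightarrow> w \<preceq>\<^bsub>r,s\<^esub> u"
  shows "v = w"
  using assms leq_refl leq_antisym by blast

lemma arr_comp: "arr r s u \<Longrightarrow> arr s t v \<Longrightarrow> arr r t (v \<bullet> u)"
  by (auto simp: arr_def intro: comp_closed)

lemma arr_id: "r \<in> obs Q \<Longrightarrow> arr r r (idm Q r)"
  by (auto simp: arr_def id_closed)

lemma cmp_assoc: "arr r s u \<Longrightarrow> arr s t v \<Longrightarrow> arr t q w \<Longrightarrow> (w \<bullet> v) \<bullet> u = w \<bullet> v \<bullet> u"
  by (auto simp: arr_def comp_assoc[of r s t q])

lemma comp_id: "arr r s u \<Longrightarrow> u \<bullet> idm Q r = u" "arr r s u \<Longrightarrow> idm Q s \<bullet> u = u"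
  by (auto simp: arr_def comp_id_left[of r] comp_id_right[of _ s])

context
  fixes r s :: 'o and f :: "'i \<Rightarrow> 'm" and I :: "'i set"
  assumes rs: "r \<in> obs Q" "s \<in> obs Q" and f: "\<And>i. i \<in> I \<Longrightarrow> arr r s (f i)"
begin

interpretation L: complete_lattice "homs Q r s"
  by (rule hom_lattice[OF rs])

lemma image_arrows: "f ` I \<subseteq> arrows Q r s"
  using f by (auto simp: arr_def)

lemma arr_Sup: "arr r s (\<Squnion>\<^bsub>homs Q r s\<^esub> (f ` I))"
  using rs image_arrows by (auto simp: arr_def)

lemma arr_Inf: "arr r s (\<Sqinter>\<^bsub>homs Q r s\<^esub> (f ` I))"
  using rs image_arrows by (auto simp: arr_def)

lemma Sup_upper: "i \<in> I \<Longrightarrow> f i \<preceq>\<^bsub>r,s\<^esub> \<Squnion>\<^bsub>homs Q r s\<^esub> (f ` I)"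
  using arr_Sup f image_arrows by (auto simp: leq_def intro!: L.sup_upper)

lemma Inf_lower: "i \<in> I \<Longrightarrow> \<Sqinter>\<^bsub>homs Q r s\<^esub> (f ` I) \<preceq>\<^bsub>r,s\<^esub> f i"
  using arr_Inf f image_arrows by (auto simp: leq_def intro!: L.inf_lower)

lemma Sup_leq_iff:
  "\<Squnion>\<^bsub>homs Q r s\<^esub> (f ` I) \<preceq>\<^bsub>r,s\<^esub> w \<longleftrightarrow> arr r s w \<and> (\<forall>i\<in>I. f i \<preceq>\<^bsub>r,s\<^esub> w)" (is "?l = ?r")
proof
  assume ?l then show ?r using Sup_upper leq_trans leq_arr by blast
next
  assume ?r then show ?l using arr_Sup image_arrows
    by (auto simp: leq_def arr_def intro!: L.sup_least)
qed

lemma leq_Inf_iff: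
  "w \<preceq>\<^bsub>r,s\<^esub> \<Sqinter>\<^bsub>homs Q r s\<^esub> (f ` I) \<longleftrightarrow> arr r s w \<and> (\<forall>i\<in>I. w \<preceq>\<^bsub>r,s\<^esub> f i)" (is "?l = ?r")
proof
  assume ?l then show ?r using Inf_lower leq_trans leq_arr by blast
next
  assume ?r then show ?l using arr_Inf image_arrows
    by (auto simp: leq_def arr_def intro!: L.inf_greatest)
qed

end

lemma comp_Sup_leq_iff:
  assumes r: "r \<in> obs Q" and f: "\<And>i. i \<in> I \<Longrightarrow> arr r s (f i)" and v: "arr s t v"
  shows "v \<bullet> \<Squnion>\<^bsub>homs Q r s\<^esub> (f ` I) \<preceq>\<^bsub>r,t\<^esub> w \<longleftrightarrow> arr r t w \<and> (\<forall>i\<in>I. v \<bullet> f i \<preceq>\<^bsub>r,t\<^esub> w)"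
proof -
  have "f ` I \<subseteq> arrows Q r s" using f by (auto simp: arr_def)
  then have "v \<bullet> \<Squnion>\<^bsub>homs Q r s\<^esub> (f ` I) = \<Squnion>\<^bsub>homs Q r t\<^esub> ((\<lambda>i. v \<bullet> f i) ` I)"
    using comp_Sup_right[of r s t "f ` I" v] r v by (auto simp: arr_def image_image)
  then show ?thesis
    using Sup_leq_iff[of r t I "\<lambda>i. v \<bullet> f i" w] arr_comp[OF f v] r arr_obs[OF v] by simp
qed

lemma Sup_comp_leq_iff:
  assumes s: "s \<in> obs Q" and f: "\<And>i. i \<in> I \<Longrightarrow> arr r s (f i)" and v: "arr t r v"
  shows "\<Squnion>\<^bsub>homs Q r s\<^esub> (f ` I) \<bullet> v \<preceq>\<^bsub>t,s\<^esub> w \<longleftrightarrow> arr t s w \<and> (\<forall>i\<in>I. f i \<bullet> v \<preceq>\<^bsub>t,s\<^esub> w)"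
proof -
  have "f ` I \<subseteq> arrows Q r s" using f by (auto simp: arr_def)
  then have "\<Squnion>\<^bsub>homs Q r s\<^esub> (f ` I) \<bullet> v = \<Squnion>\<^bsub>homs Q t s\<^esub> ((\<lambda>i. f i \<bullet> v) ` I)"
    using comp_Sup_left[of t r s v "f ` I"] s v by (auto simp: arr_def image_image)
  then show ?thesis
    using Sup_leq_iff[of t s I "\<lambda>i. f i \<bullet> v" w] arr_comp[OF v f] s arr_obs[OF v] by simp
qed

text \<open>Monotonicity is preservation of the supremum of the two-element set of comparable arrows.\<close>

lemma comp_mono_right:
  assumes u: "u \<preceq>\<^bsub>r,s\<^esub> u'" and v: "arr s t v"
  shows "v \<bullet> u \<preceq>\<^bsub>r,t\<^esub> v \<bullet> u'"
proof -
  let ?I = "{u, u'}"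
  let ?S = "\<Squnion>\<^bsub>homs Q r s\<^esub> ((\<lambda>x. x) ` ?I)"
  have f: "\<And>i. i \<in> ?I \<Longrightarrow> arr r s i" and r: "r \<in> obs Q" and s: "s \<in> obs Q"
    using u by (auto simp: leq_def arr_obs)
  have arrS: "arr r s ?S" by (rule arr_Sup[OF r s f])
  have "?S = u'"
    by (rule leq_antisym[OF _ Sup_upper[OF r s f]])
       (use u Sup_leq_iff[OF r s f, where f = "\<lambda>x. x" and I = ?I] in \<open>auto simp: leq_refl leq_arr\<close>)
  then show ?thesis
    using comp_Sup_leq_iff[OF r f v, where f = "\<lambda>x. x" and I = ?I and w = "v \<bullet> ?S"] leq_refl[OF arr_comp[OF arrS v]] by simp
qed

lemma comp_mono_left:
  assumes u: "u \<preceq>\<^bsub>s,t\<^esub> u'" and v: "arr r s v"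
  shows "u \<bullet> v \<preceq>\<^bsub>r,t\<^esub> u' \<bullet> v"
proof -
  let ?I = "{u, u'}"
  let ?S = "\<Squnion>\<^bsub>homs Q s t\<^esub> ((\<lambda>x. x) ` ?I)"
  have f: "\<And>i. i \<in> ?I \<Longrightarrow> arr s t i" and s: "s \<in> obs Q" and t: "t \<in> obs Q"
    using u by (auto simp: leq_def arr_obs)
  have arrS: "arr s t ?S" by (rule arr_Sup[OF s t f])
  have "?S = u'"
    by (rule leq_antisym[OF _ Sup_upper[OF s t f]])
       (use u Sup_leq_iff[OF s t f, where f = "\<lambda>x. x" and I = ?I] in \<open>auto simp: leq_refl leq_arr\<close>)
  then show ?thesis
    using Sup_comp_leq_iff[OF t f v, where f = "\<lambda>x. x" and I = ?I and w = "?S \<bullet> v"] leq_refl[OF arr_comp[OF v arrS]] by simp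
qed

lemma comp_mono:
  "u \<preceq>\<^bsub>r,s\<^esub> u' \<Longrightarrow> v \<preceq>\<^bsub>s,t\<^esub> v' \<Longrightarrow> v \<bullet> u \<preceq>\<^bsub>r,t\<^esub> v' \<bullet> u'"
  by (meson comp_mono_left comp_mono_right leq_arr leq_trans)

text \<open>The residual is the supremum of the arrows that it has to dominate: this supremum belongs to the
  set because composition preserves it.\<close>

lemma rres_arr:
  assumes v: "arr s t v" and w: "arr r t w"
  shows "arr r s (rres Q r s t v w)"
    and leq_rres_iff: "u \<preceq>\<^bsub>r,s\<^esub> rres Q r s t v w \<longleftrightarrow> arr r s u \<and> v \<bullet> u \<preceq>\<^bsub>r,t\<^esub> w"
proof -
  let ?I = "{u. arr r s u \<and> v \<bullet> u \<preceq>\<^bsub>r,t\<^esub> w}"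
  let ?x = "\<Squnion>\<^bsub>homs Q r s\<^esub> ((\<lambda>u. u) ` ?I)"
  have r: "r \<in> obs Q" and s: "s \<in> obs Q" and t: "t \<in> obs Q" using v w by (auto simp: arr_obs)
  have f: "\<And>i. i \<in> ?I \<Longrightarrow> arr r s i" by auto
  have x: "arr r s ?x" by (rule arr_Sup[OF r s f])
  have vx: "v \<bullet> ?x \<preceq>\<^bsub>r,t\<^esub> w" using comp_Sup_leq_iff[OF r f v, where f = "\<lambda>x. x" and I = ?I and w = w] w by auto
  have iff: "u \<preceq>\<^bsub>r,s\<^esub> ?x \<longleftrightarrow> arr r s u \<and> v \<bullet> u \<preceq>\<^bsub>r,t\<^esub> w" for u
    using Sup_upper[OF r s f, where f = "\<lambda>x. x" and I = ?I and i = u] vx comp_mono_right[OF _ v] leq_trans leq_arr by blast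
  \<comment> \<open>the defining property of the residual, in terms of the typed order\<close>
  have P: "(y \<in> arrows Q r s \<and> (\<forall>u\<in>arrows Q r s. u \<sqsubseteq>\<^bsub>homs Q r s\<^esub> y \<longleftrightarrow> v \<bullet> u \<sqsubseteq>\<^bsub>homs Q r t\<^esub> w))
     \<longleftrightarrow> (arr r s y \<and> (\<forall>u. u \<preceq>\<^bsub>r,s\<^esub> y \<longleftrightarrow> arr r s u \<and> v \<bullet> u \<preceq>\<^bsub>r,t\<^esub> w))" for y
    using r s v w arr_comp[OF _ v, of r] unfolding leq_def by (auto simp: arr_def)
  have "rres Q r s t v w = ?x"
    unfolding rres_def P
    by (rule the_equality) (use x iff in \<open>auto intro!: eq_if_same_lower_bounds\<close>)
  then show "arr r s (rres Q r s t v w)"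
    and "u \<preceq>\<^bsub>r,s\<^esub> rres Q r s t v w \<longleftrightarrow> arr r s u \<and> v \<bullet> u \<preceq>\<^bsub>r,t\<^esub> w"
    using x iff by auto
qed

lemma lres_arr:
  assumes u: "arr r s u" and w: "arr r t w"
  shows "arr s t (lres Q r s t w u)"
    and leq_lres_iff: "v \<preceq>\<^bsub>s,t\<^esub> lres Q r s t w u \<longleftrightarrow> arr s t v \<and> v \<bullet> u \<preceq>\<^bsub>r,t\<^esub> w"
proof -
  let ?I = "{v. arr s t v \<and> v \<bullet> u \<preceq>\<^bsub>r,t\<^esub> w}"
  let ?x = "\<Squnion>\<^bsub>homs Q s t\<^esub> ((\<lambda>u. u) ` ?I)"
  have r: "r \<in> obs Q" and s: "s \<in> obs Q" and t: "t \<in> obs Q" using u w by (auto simp: arr_obs)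
  have f: "\<And>i. i \<in> ?I \<Longrightarrow> arr s t i" by auto
  have x: "arr s t ?x" by (rule arr_Sup[OF s t f])
  have xu: "?x \<bullet> u \<preceq>\<^bsub>r,t\<^esub> w" using Sup_comp_leq_iff[OF t f u, where f = "\<lambda>x. x" and I = ?I and w = w] w by auto
  have iff: "v \<preceq>\<^bsub>s,t\<^esub> ?x \<longleftrightarrow> arr s t v \<and> v \<bullet> u \<preceq>\<^bsub>r,t\<^esub> w" for v
    using Sup_upper[OF s t f, where f = "\<lambda>x. x" and I = ?I and i = v] xu comp_mono_left[OF _ u] leq_trans leq_arr by blast
  \<comment> \<open>the defining property of the residual, in terms of the typed order\<close>
  have P: "(y \<in> arrows Q s t \<and> (\<forall>v\<in>arrows Q s t. v \<sqsubseteq>\<^bsub>homs Q s t\<^esub> y \<longleftrightarrow> v \<bullet> u \<sqsubseteq>\<^bsub>homs Q r t\<^esub> w))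
     \<longleftrightarrow> (arr s t y \<and> (\<forall>v. v \<preceq>\<^bsub>s,t\<^esub> y \<longleftrightarrow> arr s t v \<and> v \<bullet> u \<preceq>\<^bsub>r,t\<^esub> w))" for y
    using s t u w arr_comp[OF u, of t] unfolding leq_def by (auto simp: arr_def)
  have "lres Q r s t w u = ?x"
    unfolding lres_def P
    by (rule the_equality) (use x iff in \<open>auto intro!: eq_if_same_lower_bounds\<close>)
  then show "arr s t (lres Q r s t w u)"
    and "v \<preceq>\<^bsub>s,t\<^esub> lres Q r s t w u \<longleftrightarrow> arr s t v \<and> v \<bullet> u \<preceq>\<^bsub>r,t\<^esub> w"
    using x iff by auto
qed

end

section \<open>\<open>\<Q>\<close>-categories, distributors and presheaves\<close>

abbreviation pv :: "'o \<times> ('a \<Rightarrow> unit \<Rightarrow> 'm) \<Rightarrow> 'a \<Rightarrow> 'm" where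
  "pv \<sigma> x \<equiv> snd \<sigma> x ()"

abbreviation cv :: "'o \<times> (unit \<Rightarrow> 'a \<Rightarrow> 'm) \<Rightarrow> 'a \<Rightarrow> 'm" where
  "cv \<tau> x \<equiv> snd \<tau> () x"

text \<open>The dual of \<open>transp\<close>: a distributor \<open>\<phi> : X \<nrightarrow> Y\<close> as the map \<open>X \<rightarrow> \<P>\<^sup>\<dagger>Y\<close>, \<open>x \<mapsto> \<phi>(x, -)\<close>.\<close>

definition cotransp :: "('a, 'o, 'm) qcat \<Rightarrow> ('b, 'o, 'm) qcat \<Rightarrow> ('a \<Rightarrow> 'b \<Rightarrow> 'm)
    \<Rightarrow> 'a \<Rightarrow> ('b, 'o, 'm) copresheaf" where
  "cotransp X Y \<phi> = (\<lambda>x\<in>carrier X. (tp X x, \<lambda>_\<in>{()}. \<lambda>y\<in>carrier Y. \<phi> x y))"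

lemma star_simps [simp]:
  "carrier (star Q s) = {()}" "tp (star Q s) a = s" "hm (star Q s) a b = idm Q s"
  by (auto simp: star_def)

lemma Psh_simps [simp]:
  "carrier (Psh Q X) = presheaves Q X"
  "\<sigma> \<in> presheaves Q X \<Longrightarrow> tp (Psh Q X) \<sigma> = fst \<sigma>"
  by (auto simp: Psh_def)

lemma Cop_simps [simp]:
  "carrier (Cop Q X) = copresheaves Q X"
  "\<tau> \<in> copresheaves Q X \<Longrightarrow> tp (Cop Q X) \<tau> = fst \<tau>"
  by (auto simp: Cop_def)

lemma transp_simps [simp]:
  "y \<in> carrier Y \<Longrightarrow> fst (transp X Y \<phi> y) = tp Y y"
  "y \<in> carrier Y \<Longrightarrow> x \<in> carrier X \<Longrightarrow> pv (transp X Y \<phi> y) x = \<phi> x y"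
  by (auto simp: transp_def)

lemma cotransp_simps [simp]:
  "x \<in> carrier X \<Longrightarrow> fst (cotransp X Y \<phi> x) = tp X x"
  "x \<in> carrier X \<Longrightarrow> y \<in> carrier Y \<Longrightarrow> cv (cotransp X Y \<phi> x) y = \<phi> x y"
  by (auto simp: cotransp_def)

lemma graph_simps [simp]:
  "x \<in> carrier X \<Longrightarrow> y \<in> carrier Y \<Longrightarrow> graph X Y f x y = hm Y (f x) y"
  "x \<in> carrier X \<Longrightarrow> y \<in> carrier Y \<Longrightarrow> cograph X Y f y x = hm Y y (f x)"
  by (auto simp: graph_def cograph_def)

lemma yo_eq_transp: "yo Q X = transp X X (hm X)"
  by (simp add: yo_def transp_def)

lemma coyo_eq_cotransp: "coyo Q X = cotransp X X (hm X)"
  by (simp add: coyo_def cotransp_def)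

lemma yo_simps [simp]:
  "x \<in> carrier X \<Longrightarrow> fst (yo Q X x) = tp X x"
  "x \<in> carrier X \<Longrightarrow> x' \<in> carrier X \<Longrightarrow> pv (yo Q X x) x' = hm X x' x"
  by (auto simp: yo_eq_transp)

lemma coyo_simps [simp]:
  "x \<in> carrier X \<Longrightarrow> fst (coyo Q X x) = tp X x"
  "x \<in> carrier X \<Longrightarrow> x' \<in> carrier X \<Longrightarrow> cv (coyo Q X x) x' = hm X x x'"
  by (auto simp: coyo_eq_cotransp)

lemma fst_dir_inv [simp]:
  "\<sigma> \<in> presheaves Q X \<Longrightarrow> fst (psh_dir Q X Y f \<sigma>) = fst \<sigma>"
  "\<sigma>' \<in> presheaves Q Y \<Longrightarrow> fst (psh_inv Q X Y f \<sigma>') = fst \<sigma>'"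
  "\<tau> \<in> copresheaves Q X \<Longrightarrow> fst (cop_dir Q X Y f \<tau>) = fst \<tau>"
  "\<tau>' \<in> copresheaves Q Y \<Longrightarrow> fst (cop_inv Q X Y f \<tau>') = fst \<tau>'"
  by (auto simp: psh_dir_def psh_inv_def cop_dir_def cop_inv_def)

lemma extensional_unit [simp]: "f \<in> extensional {()}"
  by (auto simp: extensional_def)

context quantaloid
begin

text \<open>The value of a composite of relations at one pair of points. Only the values entering this one
  supremum are assumed to be well typed, so that the factors may be (co)presheaves, whose values are
  typed by their first component.\<close>

lemma rel_comp_at:
  assumes "x \<in> carrier X" "z \<in> carrier Z" "tp X x \<in> obs Q" "tp Z z \<in> obs Q"
    and "\<And>y. y \<in> carrier Y \<Longrightarrow> arr (tp X x) (tp Y y) (\<phi> x y)"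
    and "\<And>y. y \<in> carrier Y \<Longrightarrow> arr (tp Y y) (tp Z z) (\<psi> y z)"
  shows "arr (tp X x) (tp Z z) (rel_comp Q X Y Z \<psi> \<phi> x z)"
    and rel_comp_leq_iff: "rel_comp Q X Y Z \<psi> \<phi> x z \<preceq>\<^bsub>tp X x,tp Z z\<^esub> w
      \<longleftrightarrow> arr (tp X x) (tp Z z) w \<and> (\<forall>y\<in>carrier Y. \<psi> y z \<bullet> \<phi> x y \<preceq>\<^bsub>tp X x,tp Z z\<^esub> w)"
    and rel_comp_upper: "\<And>y. y \<in> carrier Y \<Longrightarrow>
      \<psi> y z \<bullet> \<phi> x y \<preceq>\<^bsub>tp X x,tp Z z\<^esub> rel_comp Q X Y Z \<psi> \<phi> x z"
    and comp_rel_comp_leq_iff: "\<And>v t w. arr (tp Z z) t v \<Longrightarrow>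
      v \<bullet> rel_comp Q X Y Z \<psi> \<phi> x z \<preceq>\<^bsub>tp X x,t\<^esub> w
      \<longleftrightarrow> arr (tp X x) t w \<and> (\<forall>y\<in>carrier Y. v \<bullet> \<psi> y z \<bullet> \<phi> x y \<preceq>\<^bsub>tp X x,t\<^esub> w)"
    and rel_comp_comp_leq_iff: "\<And>v t w. arr t (tp X x) v \<Longrightarrow>
      rel_comp Q X Y Z \<psi> \<phi> x z \<bullet> v \<preceq>\<^bsub>t,tp Z z\<^esub> w
      \<longleftrightarrow> arr t (tp Z z) w \<and> (\<forall>y\<in>carrier Y. \<psi> y z \<bullet> \<phi> x y \<bullet> v \<preceq>\<^bsub>t,tp Z z\<^esub> w)"
proof -
  have eq: "rel_comp Q X Y Z \<psi> \<phi> x z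
      = \<Squnion>\<^bsub>homs Q (tp X x) (tp Z z)\<^esub> ((\<lambda>y. \<psi> y z \<bullet> \<phi> x y) ` carrier Y)"
    using assms(1,2) by (simp add: rel_comp_def)
  have f: "\<And>y. y \<in> carrier Y \<Longrightarrow> arr (tp X x) (tp Z z) (\<psi> y z \<bullet> \<phi> x y)"
    using assms(5,6) by (auto intro: arr_comp)
  note os = assms(3,4)
  show "arr (tp X x) (tp Z z) (rel_comp Q X Y Z \<psi> \<phi> x z)"
    unfolding eq by (rule arr_Sup[OF os f])
  show "rel_comp Q X Y Z \<psi> \<phi> x z \<preceq>\<^bsub>tp X x,tp Z z\<^esub> w
      \<longleftrightarrow> arr (tp X x) (tp Z z) w \<and> (\<forall>y\<in>carrier Y. \<psi> y z \<bullet> \<phi> x y \<preceq>\<^bsub>tp X x,tp Z z\<^esub> w)"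
    unfolding eq by (rule Sup_leq_iff[OF os f])
  show "\<psi> y z \<bullet> \<phi> x y \<preceq>\<^bsub>tp X x,tp Z z\<^esub> rel_comp Q X Y Z \<psi> \<phi> x z" if "y \<in> carrier Y" for y
    unfolding eq using Sup_upper[OF os f that] .
  show "v \<bullet> rel_comp Q X Y Z \<psi> \<phi> x z \<preceq>\<^bsub>tp X x,t\<^esub> w
      \<longleftrightarrow> arr (tp X x) t w \<and> (\<forall>y\<in>carrier Y. v \<bullet> \<psi> y z \<bullet> \<phi> x y \<preceq>\<^bsub>tp X x,t\<^esub> w)"
    if "arr (tp Z z) t v" for v t w
    unfolding eq by (rule comp_Sup_leq_iff[OF os(1) f that])
  show "rel_comp Q X Y Z \<psi> \<phi> x z \<bullet> v \<preceq>\<^bsub>t,tp Z z\<^esub> w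
      \<longleftrightarrow> arr t (tp Z z) w \<and> (\<forall>y\<in>carrier Y. \<psi> y z \<bullet> \<phi> x y \<bullet> v \<preceq>\<^bsub>t,tp Z z\<^esub> w)"
    if v: "arr t (tp X x) v" for v t w
  proof -
    have "(\<psi> y z \<bullet> \<phi> x y) \<bullet> v = \<psi> y z \<bullet> \<phi> x y \<bullet> v" if "y \<in> carrier Y" for y
      using cmp_assoc[OF v assms(5)[OF that] assms(6)[OF that]] .
    then show ?thesis
      unfolding eq by (subst Sup_comp_leq_iff[OF os(2) _ v]) (auto intro: f)
  qed
qed

lemma qrel_iff:
  assumes "\<forall>x\<in>carrier X. tp X x \<in> obs Q" "\<forall>y\<in>carrier Y. tp Y y \<in> obs Q"
  shows "\<phi> \<in> qrel Q X Y \<longleftrightarrow> \<phi> \<in> extensional (carrier X)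
    \<and> (\<forall>x\<in>carrier X. \<phi> x \<in> extensional (carrier Y) \<and> (\<forall>y\<in>carrier Y. arr (tp X x) (tp Y y) (\<phi> x y)))"
  using assms by (auto simp: qrel_def PiE_iff arr_def)

lemma rel_comp_in_qrel:
  assumes "\<forall>x\<in>carrier X. tp X x \<in> obs Q" "\<forall>y\<in>carrier Y. tp Y y \<in> obs Q"
    "\<forall>z\<in>carrier Z. tp Z z \<in> obs Q" "\<phi> \<in> qrel Q X Y" "\<psi> \<in> qrel Q Y Z"
  shows "rel_comp Q X Y Z \<psi> \<phi> \<in> qrel Q X Z"
proof -
  have "arr (tp X x) (tp Z z) (rel_comp Q X Y Z \<psi> \<phi> x z)" if "x \<in> carrier X" "z \<in> carrier Z" for x z
    using that assms by (intro rel_comp_at) (auto simp: qrel_iff)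
  then show ?thesis using assms by (auto simp: qrel_iff) (auto simp: rel_comp_def)
qed

lemma rel_le_rel_comp_iff:
  assumes "\<forall>x\<in>carrier X. tp X x \<in> obs Q" "\<forall>y\<in>carrier Y. tp Y y \<in> obs Q"
    "\<forall>z\<in>carrier Z. tp Z z \<in> obs Q" "\<phi> \<in> qrel Q X Y" "\<psi> \<in> qrel Q Y Z" "\<chi> \<in> qrel Q X Z"
  shows "rel_le Q X Z (rel_comp Q X Y Z \<psi> \<phi>) \<chi> \<longleftrightarrow>
    (\<forall>x\<in>carrier X. \<forall>y\<in>carrier Y. \<forall>z\<in>carrier Z. \<psi> y z \<bullet> \<phi> x y \<preceq>\<^bsub>tp X x,tp Z z\<^esub> \<chi> x z)"
proof -
  have "rel_comp Q X Y Z \<psi> \<phi> x z \<sqsubseteq>\<^bsub>homs Q (tp X x) (tp Z z)\<^esub> \<chi> x z \<longleftrightarrow>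
     (\<forall>y\<in>carrier Y. \<psi> y z \<bullet> \<phi> x y \<preceq>\<^bsub>tp X x,tp Z z\<^esub> \<chi> x z)" if xz: "x \<in> carrier X" "z \<in> carrier Z" for x z
  proof -
    have a: "arr (tp X x) (tp Z z) (\<chi> x z)"
      "arr (tp X x) (tp Z z) (rel_comp Q X Y Z \<psi> \<phi> x z)"
      using assms xz rel_comp_in_qrel[OF assms(1-5)] by (auto simp: qrel_iff)
    have "rel_comp Q X Y Z \<psi> \<phi> x z \<preceq>\<^bsub>tp X x,tp Z z\<^esub> \<chi> x z
      \<longleftrightarrow> arr (tp X x) (tp Z z) (\<chi> x z) \<and> (\<forall>y\<in>carrier Y. \<psi> y z \<bullet> \<phi> x y \<preceq>\<^bsub>tp X x,tp Z z\<^esub> \<chi> x z)"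
      by (rule rel_comp_leq_iff) (use assms xz in \<open>auto simp: qrel_iff\<close>)
    with a show ?thesis by (simp add: leq_def)
  qed
  then show ?thesis by (auto simp: rel_le_def)
qed

lemma qcategory_iff:
  "qcategory Q X \<longleftrightarrow> tp X \<in> carrier X \<rightarrow>\<^sub>E obs Q \<and> hm X \<in> extensional (carrier X) \<and>
    (\<forall>x\<in>carrier X. hm X x \<in> extensional (carrier X)) \<and>
    (\<forall>x\<in>carrier X. \<forall>y\<in>carrier X. arr (tp X x) (tp X y) (hm X x y)) \<and>
    (\<forall>x\<in>carrier X. idm Q (tp X x) \<preceq>\<^bsub>tp X x,tp X x\<^esub> hm X x x) \<and>
    (\<forall>x\<in>carrier X. \<forall>y\<in>carrier X. \<forall>z\<in>carrier X.
       hm X y z \<bullet> hm X x y \<preceq>\<^bsub>tp X x,tp X z\<^esub> hm X x z)"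
proof (cases "tp X \<in> carrier X \<rightarrow>\<^sub>E obs Q \<and> hm X \<in> qrel Q X X")
  case True
  then have o: "\<forall>x\<in>carrier X. tp X x \<in> obs Q" and h: "hm X \<in> qrel Q X X" by auto
  show ?thesis
    using True o h unfolding qcategory_def rel_le_rel_comp_iff[OF o o o h h h]
    by (auto simp: qrel_iff leq_def arr_id)
next
  case False
  then show ?thesis
    unfolding qcategory_def using qrel_iff[of X X "hm X"] by (auto simp: PiE_iff)
qed

lemma tp_obs: "qcategory Q X \<Longrightarrow> x \<in> carrier X \<Longrightarrow> tp X x \<in> obs Q"
  by (auto simp: qcategory_iff)

lemma hm_arr: "qcategory Q X \<Longrightarrow> x \<in> carrier X \<Longrightarrow> y \<in> carrier X \<Longrightarrow> arr (tp X x) (tp X y) (hm X x y)"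
  by (auto simp: qcategory_iff)

lemma hm_refl: "qcategory Q X \<Longrightarrow> x \<in> carrier X \<Longrightarrow> idm Q (tp X x) \<preceq>\<^bsub>tp X x,tp X x\<^esub> hm X x x"
  by (auto simp: qcategory_iff)

lemma hm_trans: "qcategory Q X \<Longrightarrow> x \<in> carrier X \<Longrightarrow> y \<in> carrier X \<Longrightarrow> z \<in> carrier X
   \<Longrightarrow> hm X y z \<bullet> hm X x y \<preceq>\<^bsub>tp X x,tp X z\<^esub> hm X x z"
  by (auto simp: qcategory_iff)

text \<open>Composing with \<open>hom(x, x)\<close> increases, as \<open>1 \<preceq> hom(x, x)\<close>. This inserts the factor needed to bound
  an arrow by a supremum over \<open>X\<close>.\<close>

lemma leq_comp_hm_refl:
  assumes "qcategory Q X" "x \<in> carrier X" 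
  shows "arr (tp X x) t v \<Longrightarrow> v \<preceq>\<^bsub>tp X x,t\<^esub> v \<bullet> hm X x x"
    and "arr t (tp X x) w \<Longrightarrow> w \<preceq>\<^bsub>t,tp X x\<^esub> hm X x x \<bullet> w"
  using comp_mono_right[OF hm_refl[OF assms], of t v] comp_mono_left[OF hm_refl[OF assms], of t w]
  by (auto simp: comp_id)

lemma qcategory_star: "s \<in> obs Q \<Longrightarrow> qcategory Q (star Q s)"
  by (auto simp: qcategory_iff arr_id leq_refl comp_id[OF arr_id] PiE_iff)

lemma qfunctor_iff:
  assumes "qcategory Q X" "qcategory Q Y"
  shows "qfunctor Q X Y f \<longleftrightarrow> f \<in> carrier X \<rightarrow>\<^sub>E carrier Y \<and> (\<forall>x\<in>carrier X. tp Y (f x) = tp X x) \<and>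
    (\<forall>x\<in>carrier X. \<forall>x'\<in>carrier X. hm X x x' \<preceq>\<^bsub>tp X x,tp X x'\<^esub> hm Y (f x) (f x'))"
proof -
  have "hm X x x' \<sqsubseteq>\<^bsub>homs Q (tp X x) (tp X x')\<^esub> hm Y (f x) (f x')
      \<longleftrightarrow> hm X x x' \<preceq>\<^bsub>tp X x,tp X x'\<^esub> hm Y (f x) (f x')"
    if "f \<in> carrier X \<rightarrow>\<^sub>E carrier Y" "\<forall>x\<in>carrier X. tp Y (f x) = tp X x"
      "x \<in> carrier X" "x' \<in> carrier X" for x x'
    using that hm_arr[OF assms(1)] hm_arr[OF assms(2), of "f x" "f x'"] by (auto simp: leq_def)
  then show ?thesis unfolding qfunctor_def by auto
qed

lemma qfunctor_closed: "qfunctor Q X Y f \<Longrightarrow> x \<in> carrier X \<Longrightarrow> f x \<in> carrier Y"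
  by (auto simp: qfunctor_def)

lemma qfunctor_tp: "qfunctor Q X Y f \<Longrightarrow> x \<in> carrier X \<Longrightarrow> tp Y (f x) = tp X x"
  by (auto simp: qfunctor_def)

lemma qfunctor_hm: "qcategory Q X \<Longrightarrow> qcategory Q Y \<Longrightarrow> qfunctor Q X Y f \<Longrightarrow> x \<in> carrier X
    \<Longrightarrow> x' \<in> carrier X \<Longrightarrow> hm X x x' \<preceq>\<^bsub>tp X x,tp X x'\<^esub> hm Y (f x) (f x')"
  by (auto simp: qfunctor_iff)

text \<open>A two-sided action is the conjunction of the two one-sided ones: insert an identity at the other
  side.\<close>

lemma distributor_iff:
  assumes X: "qcategory Q X" and Y: "qcategory Q Y"
  shows "distributor Q X Y \<phi> \<longleftrightarrow> \<phi> \<in> qrel Q X Y \<and>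
    (\<forall>x\<in>carrier X. \<forall>x'\<in>carrier X. \<forall>y\<in>carrier Y. \<phi> x' y \<bullet> hm X x x' \<preceq>\<^bsub>tp X x,tp Y y\<^esub> \<phi> x y) \<and>
    (\<forall>x\<in>carrier X. \<forall>y\<in>carrier Y. \<forall>y'\<in>carrier Y. hm Y y y' \<bullet> \<phi> x y \<preceq>\<^bsub>tp X x,tp Y y'\<^esub> \<phi> x y')"
proof (cases "\<phi> \<in> qrel Q X Y")
  case True
  have ox: "\<forall>x\<in>carrier X. tp X x \<in> obs Q" and oy: "\<forall>y\<in>carrier Y. tp Y y \<in> obs Q"
    using X Y by (auto simp: tp_obs)
  have hX: "hm X \<in> qrel Q X X" and hY: "hm Y \<in> qrel Q Y Y"
    using X Y by (auto simp: qcategory_def)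
  have ph: "arr (tp X x) (tp Y y) (\<phi> x y)" if "x \<in> carrier X" "y \<in> carrier Y" for x y
    using that True by (auto simp: qrel_iff[OF ox oy])
  let ?c = "rel_comp Q X X Y \<phi> (hm X)"
  have c: "?c \<in> qrel Q X Y" by (rule rel_comp_in_qrel[OF ox ox oy hX True])
  have "distributor Q X Y \<phi> \<longleftrightarrow> (\<forall>x\<in>carrier X. \<forall>y\<in>carrier Y. \<forall>y'\<in>carrier Y.
      hm Y y y' \<bullet> ?c x y \<preceq>\<^bsub>tp X x,tp Y y'\<^esub> \<phi> x y')"
    unfolding distributor_def rel_le_rel_comp_iff[OF ox oy oy c hY True] using True by simp
  also have "\<dots> \<longleftrightarrow> (\<forall>x\<in>carrier X. \<forall>x'\<in>carrier X. \<forall>y\<in>carrier Y. \<forall>y'\<in>carrier Y.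
      hm Y y y' \<bullet> \<phi> x' y \<bullet> hm X x x' \<preceq>\<^bsub>tp X x,tp Y y'\<^esub> \<phi> x y')"
  proof -
    have "hm Y y y' \<bullet> ?c x y \<preceq>\<^bsub>tp X x,tp Y y'\<^esub> \<phi> x y' \<longleftrightarrow> arr (tp X x) (tp Y y') (\<phi> x y') \<and>
      (\<forall>x'\<in>carrier X. hm Y y y' \<bullet> \<phi> x' y \<bullet> hm X x x' \<preceq>\<^bsub>tp X x,tp Y y'\<^esub> \<phi> x y')"
      if "x \<in> carrier X" "y \<in> carrier Y" "y' \<in> carrier Y" for x y y'
      by (rule comp_rel_comp_leq_iff) (use that X Y ph in \<open>auto simp: tp_obs hm_arr\<close>)
    then show ?thesis using ph by auto
  qed
  also have "\<dots> \<longleftrightarrow> (\<forall>x\<in>carrier X. \<forall>x'\<in>carrier X. \<forall>y\<in>carrier Y. \<phi> x' y \<bullet> hm X x x' \<preceq>\<^bsub>tp X x,tp Y y\<^esub> \<phi> x y) \<and>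
    (\<forall>x\<in>carrier X. \<forall>y\<in>carrier Y. \<forall>y'\<in>carrier Y. hm Y y y' \<bullet> \<phi> x y \<preceq>\<^bsub>tp X x,tp Y y'\<^esub> \<phi> x y')"
    (is "?A \<longleftrightarrow> ?B \<and> ?C")
  proof safe
    fix x x' y assume A: ?A and x: "x \<in> carrier X" "x' \<in> carrier X" "y \<in> carrier Y"
    have "\<phi> x' y \<bullet> hm X x x' \<preceq>\<^bsub>tp X x,tp Y y\<^esub> hm Y y y \<bullet> \<phi> x' y \<bullet> hm X x x'"
      using x by (intro leq_comp_hm_refl(2)[OF Y] arr_comp[OF hm_arr[OF X] ph]) auto
    also have "\<dots> \<preceq>\<^bsub>tp X x,tp Y y\<^esub> \<phi> x y" using A x by blast
    finally show "\<phi> x' y \<bullet> hm X x x' \<preceq>\<^bsub>tp X x,tp Y y\<^esub> \<phi> x y" .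
  next
    fix x y y' assume A: ?A and x: "x \<in> carrier X" "y \<in> carrier Y" "y' \<in> carrier Y"
    have "hm Y y y' \<bullet> \<phi> x y \<preceq>\<^bsub>tp X x,tp Y y'\<^esub> hm Y y y' \<bullet> \<phi> x y \<bullet> hm X x x"
      using x by (intro comp_mono_right[OF leq_comp_hm_refl(1)[OF X] hm_arr[OF Y]] ph) auto
    also have "\<dots> \<preceq>\<^bsub>tp X x,tp Y y'\<^esub> \<phi> x y'" using A x by blast
    finally show "hm Y y y' \<bullet> \<phi> x y \<preceq>\<^bsub>tp X x,tp Y y'\<^esub> \<phi> x y'" .
  next
    fix x x' y y' assume B: ?B and C: ?C
      and x: "x \<in> carrier X" "x' \<in> carrier X" "y \<in> carrier Y" "y' \<in> carrier Y"
    have "hm Y y y' \<bullet> \<phi> x' y \<bullet> hm X x x' \<preceq>\<^bsub>tp X x,tp Y y'\<^esub> hm Y y y' \<bullet> \<phi> x y"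
      using B x by (intro comp_mono_right[OF _ hm_arr[OF Y]]) auto
    also have "\<dots> \<preceq>\<^bsub>tp X x,tp Y y'\<^esub> \<phi> x y'" using C x by blast
    finally show "hm Y y y' \<bullet> \<phi> x' y \<bullet> hm X x x' \<preceq>\<^bsub>tp X x,tp Y y'\<^esub> \<phi> x y'" .
  qed
  finally show ?thesis using True by simp
qed (auto simp: distributor_def)

lemma distributor_arr:
  "qcategory Q X \<Longrightarrow> qcategory Q Y \<Longrightarrow> distributor Q X Y \<phi> \<Longrightarrow> x \<in> carrier X \<Longrightarrow> y \<in> carrier Y
    \<Longrightarrow> arr (tp X x) (tp Y y) (\<phi> x y)"
  using qrel_iff[of X Y \<phi>] by (auto simp: distributor_def tp_obs)

lemma presheaves_iff:
  assumes X: "qcategory Q X"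
  shows "\<sigma> \<in> presheaves Q X \<longleftrightarrow> fst \<sigma> \<in> obs Q \<and> snd \<sigma> \<in> extensional (carrier X) \<and>
    (\<forall>x\<in>carrier X. arr (tp X x) (fst \<sigma>) (pv \<sigma> x)) \<and>
    (\<forall>x\<in>carrier X. \<forall>x'\<in>carrier X. pv \<sigma> x' \<bullet> hm X x x' \<preceq>\<^bsub>tp X x,fst \<sigma>\<^esub> pv \<sigma> x)"
proof (cases "fst \<sigma> \<in> obs Q")
  case True
  note S = qcategory_star[OF True]
  have "\<sigma> \<in> presheaves Q X \<longleftrightarrow> distributor Q X (star Q (fst \<sigma>)) (snd \<sigma>)"
    using True by (auto simp: presheaves_def split: prod.splits)
  also have "\<dots> \<longleftrightarrow> snd \<sigma> \<in> extensional (carrier X) \<and>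
    (\<forall>x\<in>carrier X. arr (tp X x) (fst \<sigma>) (pv \<sigma> x)) \<and>
    (\<forall>x\<in>carrier X. \<forall>x'\<in>carrier X. pv \<sigma> x' \<bullet> hm X x x' \<preceq>\<^bsub>tp X x,fst \<sigma>\<^esub> pv \<sigma> x)"
    using True X qrel_iff[of X "star Q (fst \<sigma>)" "snd \<sigma>"]
    by (auto simp: distributor_iff[OF X S] tp_obs) (metis comp_id leq_refl)
  finally show ?thesis using True by simp
qed (auto simp: presheaves_def)

lemma copresheaves_iff:
  assumes X: "qcategory Q X"
  shows "\<tau> \<in> copresheaves Q X \<longleftrightarrow> fst \<tau> \<in> obs Q \<and> snd \<tau> () \<in> extensional (carrier X) \<and>
    (\<forall>x\<in>carrier X. arr (fst \<tau>) (tp X x) (cv \<tau> x)) \<and>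
    (\<forall>x\<in>carrier X. \<forall>x'\<in>carrier X. hm X x x' \<bullet> cv \<tau> x \<preceq>\<^bsub>fst \<tau>,tp X x'\<^esub> cv \<tau> x')"
proof (cases "fst \<tau> \<in> obs Q")
  case True
  note S = qcategory_star[OF True]
  have "\<tau> \<in> copresheaves Q X \<longleftrightarrow> distributor Q (star Q (fst \<tau>)) X (snd \<tau>)"
    using True by (auto simp: copresheaves_def split: prod.splits)
  also have "\<dots> \<longleftrightarrow> snd \<tau> () \<in> extensional (carrier X) \<and>
    (\<forall>x\<in>carrier X. arr (fst \<tau>) (tp X x) (cv \<tau> x)) \<and>
    (\<forall>x\<in>carrier X. \<forall>x'\<in>carrier X. hm X x x' \<bullet> cv \<tau> x \<preceq>\<^bsub>fst \<tau>,tp X x'\<^esub> cv \<tau> x')"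
    using True X qrel_iff[of "star Q (fst \<tau>)" X "snd \<tau>"]
    by (auto simp: distributor_iff[OF S X] tp_obs) (metis comp_id leq_refl)
  finally show ?thesis using True by simp
qed (auto simp: copresheaves_def)

lemma presheaf_obs: "\<sigma> \<in> presheaves Q X \<Longrightarrow> fst \<sigma> \<in> obs Q"
  by (auto simp: presheaves_def)

lemma copresheaf_obs: "\<tau> \<in> copresheaves Q X \<Longrightarrow> fst \<tau> \<in> obs Q"
  by (auto simp: copresheaves_def)

lemma presheaf_arr: "qcategory Q X \<Longrightarrow> \<sigma> \<in> presheaves Q X \<Longrightarrow> x \<in> carrier X \<Longrightarrow> arr (tp X x) (fst \<sigma>) (pv \<sigma> x)"
  by (auto simp: presheaves_iff)

lemma copresheaf_arr: "qcategory Q X \<Longrightarrow> \<tau> \<in> copresheaves Q X \<Longrightarrow> x \<in> carrier X \<Longrightarrow> arr (fst \<tau>) (tp X x) (cv \<tau> x)"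
  by (auto simp: copresheaves_iff)

lemma presheaf_hm: "qcategory Q X \<Longrightarrow> \<sigma> \<in> presheaves Q X \<Longrightarrow> x \<in> carrier X \<Longrightarrow> x' \<in> carrier X
    \<Longrightarrow> pv \<sigma> x' \<bullet> hm X x x' \<preceq>\<^bsub>tp X x,fst \<sigma>\<^esub> pv \<sigma> x"
  by (auto simp: presheaves_iff)

lemma copresheaf_hm: "qcategory Q X \<Longrightarrow> \<tau> \<in> copresheaves Q X \<Longrightarrow> x \<in> carrier X \<Longrightarrow> x' \<in> carrier X
    \<Longrightarrow> hm X x x' \<bullet> cv \<tau> x \<preceq>\<^bsub>fst \<tau>,tp X x'\<^esub> cv \<tau> x'"
  by (auto simp: copresheaves_iff)

lemma presheaf_eqI:
  assumes "qcategory Q X" "\<sigma> \<in> presheaves Q X" "\<sigma>' \<in> presheaves Q X" "fst \<sigma> = fst \<sigma>'"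
    and "\<And>x. x \<in> carrier X \<Longrightarrow> pv \<sigma> x = pv \<sigma>' x"
  shows "\<sigma> = \<sigma>'"
proof (rule prod_eqI[OF assms(4)])
  show "snd \<sigma> = snd \<sigma>'"
    by (rule extensionalityI[of _ "carrier X"]) (use assms in \<open>auto simp: presheaves_iff\<close>)
qed

lemma copresheaf_eqI:
  assumes "qcategory Q X" "\<tau> \<in> copresheaves Q X" "\<tau>' \<in> copresheaves Q X" "fst \<tau> = fst \<tau>'"
    and "\<And>x. x \<in> carrier X \<Longrightarrow> cv \<tau> x = cv \<tau>' x"
  shows "\<tau> = \<tau>'"
proof (rule prod_eqI[OF assms(4)])
  have "snd \<tau> () = snd \<tau>' ()"
    by (rule extensionalityI[of _ "carrier X"]) (use assms in \<open>auto simp: copresheaves_iff\<close>)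
  then show "snd \<tau> = snd \<tau>'" by auto
qed

lemma presheafI:
  assumes X: "qcategory Q X" and "s \<in> obs Q"
    and "\<And>x. x \<in> carrier X \<Longrightarrow> arr (tp X x) s (\<phi> x)"
    and "\<And>x x'. x \<in> carrier X \<Longrightarrow> x' \<in> carrier X \<Longrightarrow> \<phi> x' \<bullet> hm X x x' \<preceq>\<^bsub>tp X x,s\<^esub> \<phi> x"
    and "snd \<sigma> \<in> extensional (carrier X)" "fst \<sigma> = s" "\<And>x. x \<in> carrier X \<Longrightarrow> pv \<sigma> x = \<phi> x"
  shows "\<sigma> \<in> presheaves Q X"
  using assms by (auto simp: presheaves_iff)

lemma copresheafI:
  assumes X: "qcategory Q X" and "s \<in> obs Q"
    and "\<And>x. x \<in> carrier X \<Longrightarrow> arr s (tp X x) (\<phi> x)"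
    and "\<And>x x'. x \<in> carrier X \<Longrightarrow> x' \<in> carrier X \<Longrightarrow> hm X x x' \<bullet> \<phi> x \<preceq>\<^bsub>s,tp X x'\<^esub> \<phi> x'"
    and "snd \<tau> () \<in> extensional (carrier X)" "fst \<tau> = s" "\<And>x. x \<in> carrier X \<Longrightarrow> cv \<tau> x = \<phi> x"
  shows "\<tau> \<in> copresheaves Q X"
  using assms by (auto simp: copresheaves_iff)

text \<open>The universal property of the homs of \<open>\<P>X\<close>. The typing of \<open>u\<close> is a separate condition because \<open>X\<close>
  may be empty.\<close>

lemma
  assumes X: "qcategory Q X" and s: "\<sigma> \<in> presheaves Q X" and s': "\<sigma>' \<in> presheaves Q X"
  shows leq_hm_Psh_iff: "u \<preceq>\<^bsub>fst \<sigma>,fst \<sigma>'\<^esub> hm (Psh Q X) \<sigma> \<sigma>' \<longleftrightarrow> arr (fst \<sigma>) (fst \<sigma>') u \<and>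
      (\<forall>x\<in>carrier X. u \<bullet> pv \<sigma> x \<preceq>\<^bsub>tp X x,fst \<sigma>'\<^esub> pv \<sigma>' x)"
    and hm_Psh_arr: "arr (fst \<sigma>) (fst \<sigma>') (hm (Psh Q X) \<sigma> \<sigma>')"
proof -
  let ?f = "\<lambda>x. lres Q (tp X x) (fst \<sigma>) (fst \<sigma>') (pv \<sigma>' x) (pv \<sigma> x)"
  have eq: "hm (Psh Q X) \<sigma> \<sigma>' = \<Sqinter>\<^bsub>homs Q (fst \<sigma>) (fst \<sigma>')\<^esub> (?f ` carrier X)"
    using s s' by (simp add: Psh_def)
  have f: "\<And>x. x \<in> carrier X \<Longrightarrow> arr (fst \<sigma>) (fst \<sigma>') (?f x)"
    by (rule lres_arr) (use X s s' in \<open>auto simp: presheaf_arr\<close>)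
  note o = presheaf_obs[OF s] presheaf_obs[OF s']
  show "arr (fst \<sigma>) (fst \<sigma>') (hm (Psh Q X) \<sigma> \<sigma>')"
    unfolding eq by (rule arr_Inf[OF o f])
  have "u \<preceq>\<^bsub>fst \<sigma>,fst \<sigma>'\<^esub> hm (Psh Q X) \<sigma> \<sigma>' \<longleftrightarrow> arr (fst \<sigma>) (fst \<sigma>') u \<and>
      (\<forall>x\<in>carrier X. u \<preceq>\<^bsub>fst \<sigma>,fst \<sigma>'\<^esub> ?f x)"
    unfolding eq by (rule leq_Inf_iff[OF o f])
  also have "\<dots> \<longleftrightarrow> arr (fst \<sigma>) (fst \<sigma>') u \<and>
      (\<forall>x\<in>carrier X. u \<bullet> pv \<sigma> x \<preceq>\<^bsub>tp X x,fst \<sigma>'\<^esub> pv \<sigma>' x)"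
    using X s s' by (auto simp: leq_lres_iff presheaf_arr)
  finally show "u \<preceq>\<^bsub>fst \<sigma>,fst \<sigma>'\<^esub> hm (Psh Q X) \<sigma> \<sigma>' \<longleftrightarrow> arr (fst \<sigma>) (fst \<sigma>') u \<and>
      (\<forall>x\<in>carrier X. u \<bullet> pv \<sigma> x \<preceq>\<^bsub>tp X x,fst \<sigma>'\<^esub> pv \<sigma>' x)" .
qed

lemma
  assumes X: "qcategory Q X" and t: "\<tau> \<in> copresheaves Q X" and t': "\<tau>' \<in> copresheaves Q X"
  shows leq_hm_Cop_iff: "u \<preceq>\<^bsub>fst \<tau>,fst \<tau>'\<^esub> hm (Cop Q X) \<tau> \<tau>' \<longleftrightarrow> arr (fst \<tau>) (fst \<tau>') u \<and>
      (\<forall>x\<in>carrier X. cv \<tau>' x \<bullet> u \<preceq>\<^bsub>fst \<tau>,tp X x\<^esub> cv \<tau> x)"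
    and hm_Cop_arr: "arr (fst \<tau>) (fst \<tau>') (hm (Cop Q X) \<tau> \<tau>')"
proof -
  let ?f = "\<lambda>x. rres Q (fst \<tau>) (fst \<tau>') (tp X x) (cv \<tau>' x) (cv \<tau> x)"
  have eq: "hm (Cop Q X) \<tau> \<tau>' = \<Sqinter>\<^bsub>homs Q (fst \<tau>) (fst \<tau>')\<^esub> (?f ` carrier X)"
    using t t' by (simp add: Cop_def)
  have f: "\<And>x. x \<in> carrier X \<Longrightarrow> arr (fst \<tau>) (fst \<tau>') (?f x)"
    by (rule rres_arr) (use X t t' in \<open>auto simp: copresheaf_arr\<close>)
  note o = copresheaf_obs[OF t] copresheaf_obs[OF t']
  show "arr (fst \<tau>) (fst \<tau>') (hm (Cop Q X) \<tau> \<tau>')"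
    unfolding eq by (rule arr_Inf[OF o f])
  have "u \<preceq>\<^bsub>fst \<tau>,fst \<tau>'\<^esub> hm (Cop Q X) \<tau> \<tau>' \<longleftrightarrow> arr (fst \<tau>) (fst \<tau>') u \<and>
      (\<forall>x\<in>carrier X. u \<preceq>\<^bsub>fst \<tau>,fst \<tau>'\<^esub> ?f x)"
    unfolding eq by (rule leq_Inf_iff[OF o f])
  also have "\<dots> \<longleftrightarrow> arr (fst \<tau>) (fst \<tau>') u \<and>
      (\<forall>x\<in>carrier X. cv \<tau>' x \<bullet> u \<preceq>\<^bsub>fst \<tau>,tp X x\<^esub> cv \<tau> x)"
    using X t t' by (auto simp: leq_rres_iff copresheaf_arr)
  finally show "u \<preceq>\<^bsub>fst \<tau>,fst \<tau>'\<^esub> hm (Cop Q X) \<tau> \<tau>' \<longleftrightarrow> arr (fst \<tau>) (fst \<tau>') u \<and>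
      (\<forall>x\<in>carrier X. cv \<tau>' x \<bullet> u \<preceq>\<^bsub>fst \<tau>,tp X x\<^esub> cv \<tau> x)" .
qed

lemma hm_Psh_comp:
  assumes "qcategory Q X" "\<sigma> \<in> presheaves Q X" "\<sigma>' \<in> presheaves Q X" "x \<in> carrier X"
  shows "hm (Psh Q X) \<sigma> \<sigma>' \<bullet> pv \<sigma> x \<preceq>\<^bsub>tp X x,fst \<sigma>'\<^esub> pv \<sigma>' x"
  using assms leq_hm_Psh_iff leq_refl[OF hm_Psh_arr] by blast

lemma hm_Cop_comp:
  assumes "qcategory Q X" "\<tau> \<in> copresheaves Q X" "\<tau>' \<in> copresheaves Q X" "x \<in> carrier X"
  shows "cv \<tau>' x \<bullet> hm (Cop Q X) \<tau> \<tau>' \<preceq>\<^bsub>fst \<tau>,tp X x\<^esub> cv \<tau> x"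
  using assms leq_hm_Cop_iff leq_refl[OF hm_Cop_arr] by blast

lemma qcategory_Psh:
  assumes X: "qcategory Q X" shows "qcategory Q (Psh Q X)"
  unfolding qcategory_iff
proof (intro conjI ballI)
  show "tp (Psh Q X) \<in> carrier (Psh Q X) \<rightarrow>\<^sub>E obs Q" "hm (Psh Q X) \<in> extensional (carrier (Psh Q X))"
    by (auto simp: Psh_def presheaf_obs)
  fix \<sigma> assume s: "\<sigma> \<in> carrier (Psh Q X)"
  show "hm (Psh Q X) \<sigma> \<in> extensional (carrier (Psh Q X))" using s by (auto simp: Psh_def)
  show "idm Q (tp (Psh Q X) \<sigma>) \<preceq>\<^bsub>tp (Psh Q X) \<sigma>,tp (Psh Q X) \<sigma>\<^esub> hm (Psh Q X) \<sigma> \<sigma>"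
    using s X by (auto simp: leq_hm_Psh_iff arr_id presheaf_obs comp_id[OF presheaf_arr] leq_refl[OF presheaf_arr])
  fix \<sigma>' assume s': "\<sigma>' \<in> carrier (Psh Q X)"
  show "arr (tp (Psh Q X) \<sigma>) (tp (Psh Q X) \<sigma>') (hm (Psh Q X) \<sigma> \<sigma>')"
    using s s' X by (simp add: hm_Psh_arr)
  fix \<sigma>'' assume s'': "\<sigma>'' \<in> carrier (Psh Q X)"
  let ?h = "hm (Psh Q X)"
  have "(?h \<sigma>' \<sigma>'' \<bullet> ?h \<sigma> \<sigma>') \<bullet> pv \<sigma> x \<preceq>\<^bsub>tp X x,fst \<sigma>''\<^esub> pv \<sigma>'' x" if x: "x \<in> carrier X" for x
  proof -
    have "(?h \<sigma>' \<sigma>'' \<bullet> ?h \<sigma> \<sigma>') \<bullet> pv \<sigma> x = ?h \<sigma>' \<sigma>'' \<bullet> ?h \<sigma> \<sigma>' \<bullet> pv \<sigma> x"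
      using X s s' s'' x by (intro cmp_assoc[OF presheaf_arr hm_Psh_arr hm_Psh_arr]) auto
    also have "?h \<sigma>' \<sigma>'' \<bullet> ?h \<sigma> \<sigma>' \<bullet> pv \<sigma> x \<preceq>\<^bsub>tp X x,fst \<sigma>''\<^esub> ?h \<sigma>' \<sigma>'' \<bullet> pv \<sigma>' x"
      using X s s' s'' x by (intro comp_mono_right[OF hm_Psh_comp hm_Psh_arr]) auto
    also have "\<dots> \<preceq>\<^bsub>tp X x,fst \<sigma>''\<^esub> pv \<sigma>'' x"
      using X s s' s'' x by (intro hm_Psh_comp) auto
    finally show ?thesis .
  qed
  moreover have "arr (fst \<sigma>) (fst \<sigma>'') (?h \<sigma>' \<sigma>'' \<bullet> ?h \<sigma> \<sigma>')"
    using X s s' s'' by (intro arr_comp[OF hm_Psh_arr hm_Psh_arr]) auto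
  ultimately show "?h \<sigma>' \<sigma>'' \<bullet> ?h \<sigma> \<sigma>' \<preceq>\<^bsub>tp (Psh Q X) \<sigma>,tp (Psh Q X) \<sigma>''\<^esub> ?h \<sigma> \<sigma>''"
    using X s s' s'' by (simp add: leq_hm_Psh_iff)
qed

lemma qcategory_Cop:
  assumes X: "qcategory Q X" shows "qcategory Q (Cop Q X)"
  unfolding qcategory_iff
proof (intro conjI ballI)
  show "tp (Cop Q X) \<in> carrier (Cop Q X) \<rightarrow>\<^sub>E obs Q" "hm (Cop Q X) \<in> extensional (carrier (Cop Q X))"
    by (auto simp: Cop_def copresheaf_obs)
  fix \<tau> assume s: "\<tau> \<in> carrier (Cop Q X)"
  show "hm (Cop Q X) \<tau> \<in> extensional (carrier (Cop Q X))" using s by (auto simp: Cop_def)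
  show "idm Q (tp (Cop Q X) \<tau>) \<preceq>\<^bsub>tp (Cop Q X) \<tau>,tp (Cop Q X) \<tau>\<^esub> hm (Cop Q X) \<tau> \<tau>"
    using s X by (auto simp: leq_hm_Cop_iff arr_id copresheaf_obs comp_id[OF copresheaf_arr] leq_refl[OF copresheaf_arr])
  fix \<tau>' assume s': "\<tau>' \<in> carrier (Cop Q X)"
  show "arr (tp (Cop Q X) \<tau>) (tp (Cop Q X) \<tau>') (hm (Cop Q X) \<tau> \<tau>')"
    using s s' X by (simp add: hm_Cop_arr)
  fix \<tau>'' assume s'': "\<tau>'' \<in> carrier (Cop Q X)"
  let ?h = "hm (Cop Q X)"
  have "cv \<tau>'' x \<bullet> ?h \<tau>' \<tau>'' \<bullet> ?h \<tau> \<tau>' \<preceq>\<^bsub>fst \<tau>,tp X x\<^esub> cv \<tau> x" if x: "x \<in> carrier X" for x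
  proof -
    have "cv \<tau>'' x \<bullet> ?h \<tau>' \<tau>'' \<bullet> ?h \<tau> \<tau>' = (cv \<tau>'' x \<bullet> ?h \<tau>' \<tau>'') \<bullet> ?h \<tau> \<tau>'"
      using X s s' s'' x by (intro cmp_assoc[OF hm_Cop_arr hm_Cop_arr copresheaf_arr, symmetric]) auto
    also have "(cv \<tau>'' x \<bullet> ?h \<tau>' \<tau>'') \<bullet> ?h \<tau> \<tau>' \<preceq>\<^bsub>fst \<tau>,tp X x\<^esub> cv \<tau>' x \<bullet> ?h \<tau> \<tau>'"
      using X s s' s'' x by (intro comp_mono_left[OF hm_Cop_comp hm_Cop_arr]) auto
    also have "\<dots> \<preceq>\<^bsub>fst \<tau>,tp X x\<^esub> cv \<tau> x"
      using X s s' s'' x by (intro hm_Cop_comp) auto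
    finally show ?thesis .
  qed
  moreover have "arr (fst \<tau>) (fst \<tau>'') (?h \<tau>' \<tau>'' \<bullet> ?h \<tau> \<tau>')"
    using X s s' s'' by (intro arr_comp[OF hm_Cop_arr hm_Cop_arr]) auto
  ultimately show "?h \<tau>' \<tau>'' \<bullet> ?h \<tau> \<tau>' \<preceq>\<^bsub>tp (Cop Q X) \<tau>,tp (Cop Q X) \<tau>''\<^esub> ?h \<tau> \<tau>''"
    using X s s' s'' by (simp add: leq_hm_Cop_iff)
qed

section \<open>Representables and the Yoneda lemmas\<close>

lemma transp_in_presheaves:
  assumes X: "qcategory Q X" and Y: "qcategory Q Y" and d: "distributor Q X Y \<phi>" and y: "y \<in> carrier Y"
  shows "transp X Y \<phi> y \<in> presheaves Q X"
  by (rule presheafI[OF X, where s = "tp Y y" and \<phi> = "\<lambda>x. \<phi> x y"])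
     (use X Y d y distributor_arr[OF X Y d] in \<open>auto simp: tp_obs distributor_iff[OF X Y] transp_def\<close>)

lemma cotransp_in_copresheaves:
  assumes X: "qcategory Q X" and Y: "qcategory Q Y" and d: "distributor Q X Y \<phi>" and x: "x \<in> carrier X"
  shows "cotransp X Y \<phi> x \<in> copresheaves Q Y"
  by (rule copresheafI[OF Y, where s = "tp X x" and \<phi> = "\<phi> x"])
     (use X Y d x distributor_arr[OF X Y d] in \<open>auto simp: tp_obs distributor_iff[OF X Y] cotransp_def\<close>)

lemma qfunctor_transp:
  assumes X: "qcategory Q X" and Y: "qcategory Q Y" and d: "distributor Q X Y \<phi>"
  shows "qfunctor Q Y (Psh Q X) (transp X Y \<phi>)"
  unfolding qfunctor_iff[OF Y qcategory_Psh[OF X]]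
proof (intro conjI ballI)
  note t = transp_in_presheaves[OF X Y d]
  show "transp X Y \<phi> \<in> carrier Y \<rightarrow>\<^sub>E carrier (Psh Q X)"
    using t by (auto simp: transp_def)
  fix y assume y: "y \<in> carrier Y"
  show "tp (Psh Q X) (transp X Y \<phi> y) = tp Y y" using t[OF y] y by simp
  fix y' assume y': "y' \<in> carrier Y"
  show "hm Y y y' \<preceq>\<^bsub>tp Y y,tp Y y'\<^esub> hm (Psh Q X) (transp X Y \<phi> y) (transp X Y \<phi> y')"
    using leq_hm_Psh_iff[OF X t[OF y] t[OF y'], of "hm Y y y'"] y y' d
    by (auto simp: hm_arr[OF Y] distributor_iff[OF X Y])
qed

lemma qfunctor_cotransp:
  assumes X: "qcategory Q X" and Y: "qcategory Q Y" and d: "distributor Q X Y \<phi>"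
  shows "qfunctor Q X (Cop Q Y) (cotransp X Y \<phi>)"
  unfolding qfunctor_iff[OF X qcategory_Cop[OF Y]]
proof (intro conjI ballI)
  note t = cotransp_in_copresheaves[OF X Y d]
  show "cotransp X Y \<phi> \<in> carrier X \<rightarrow>\<^sub>E carrier (Cop Q Y)"
    using t by (auto simp: cotransp_def)
  fix y assume y: "y \<in> carrier X"
  show "tp (Cop Q Y) (cotransp X Y \<phi> y) = tp X y" using t[OF y] y by simp
  fix y' assume y': "y' \<in> carrier X"
  show "hm X y y' \<preceq>\<^bsub>tp X y,tp X y'\<^esub> hm (Cop Q Y) (cotransp X Y \<phi> y) (cotransp X Y \<phi> y')"
    using leq_hm_Cop_iff[OF Y t[OF y] t[OF y'], of "hm X y y'"] y y' d
    by (auto simp: hm_arr[OF X] distributor_iff[OF X Y])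
qed

lemma distributor_hm:
  assumes X: "qcategory Q X" shows "distributor Q X X (hm X)"
  using X by (auto simp: distributor_iff[OF X X] hm_trans qcategory_def)

lemma yo_in_presheaves: "qcategory Q X \<Longrightarrow> x \<in> carrier X \<Longrightarrow> yo Q X x \<in> presheaves Q X"
  by (simp add: yo_eq_transp transp_in_presheaves distributor_hm)

lemma coyo_in_copresheaves: "qcategory Q X \<Longrightarrow> x \<in> carrier X \<Longrightarrow> coyo Q X x \<in> copresheaves Q X"
  by (simp add: coyo_eq_cotransp cotransp_in_copresheaves distributor_hm)

lemma qfunctor_yo: "qcategory Q X \<Longrightarrow> qfunctor Q X (Psh Q X) (yo Q X)"
  by (simp add: yo_eq_transp qfunctor_transp distributor_hm)

lemma qfunctor_coyo: "qcategory Q X \<Longrightarrow> qfunctor Q X (Cop Q X) (coyo Q X)"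
  by (simp add: coyo_eq_cotransp qfunctor_cotransp distributor_hm)

text \<open>The Yoneda lemma without residuals: \<open>u\<close> generates the presheaf \<open>u \<circ> hom(-, x)\<close>, and a presheaf dominates
  the generated one as soon as it dominates the generator.\<close>

lemma comp_hm_leq_presheaf_iff:
  assumes X: "qcategory Q X" and s: "\<sigma> \<in> presheaves Q X" and x: "x \<in> carrier X"
  shows "arr (tp X x) (fst \<sigma>) u \<and> (\<forall>x'\<in>carrier X. u \<bullet> hm X x' x \<preceq>\<^bsub>tp X x',fst \<sigma>\<^esub> pv \<sigma> x')
    \<longleftrightarrow> u \<preceq>\<^bsub>tp X x,fst \<sigma>\<^esub> pv \<sigma> x"
proof safe
  assume u: "arr (tp X x) (fst \<sigma>) u"
    and a: "\<forall>x'\<in>carrier X. u \<bullet> hm X x' x \<preceq>\<^bsub>tp X x',fst \<sigma>\<^esub> pv \<sigma> x'"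
  show "u \<preceq>\<^bsub>tp X x,fst \<sigma>\<^esub> pv \<sigma> x"
    using leq_trans[OF leq_comp_hm_refl(1)[OF X x u]] a x by blast
next
  assume u: "u \<preceq>\<^bsub>tp X x,fst \<sigma>\<^esub> pv \<sigma> x"
  then show "arr (tp X x) (fst \<sigma>) u" by (rule leq_arr)
  fix x' assume x': "x' \<in> carrier X"
  show "u \<bullet> hm X x' x \<preceq>\<^bsub>tp X x',fst \<sigma>\<^esub> pv \<sigma> x'"
    using leq_trans[OF comp_mono_left[OF u hm_arr[OF X x' x]] presheaf_hm[OF X s x' x]] .
qed

lemma hm_comp_leq_copresheaf_iff:
  assumes X: "qcategory Q X" and t: "\<tau> \<in> copresheaves Q X" and x: "x \<in> carrier X"
  shows "arr (fst \<tau>) (tp X x) u \<and> (\<forall>x'\<in>carrier X. hm X x x' \<bullet> u \<preceq>\<^bsub>fst \<tau>,tp X x'\<^esub> cv \<tau> x')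
    \<longleftrightarrow> u \<preceq>\<^bsub>fst \<tau>,tp X x\<^esub> cv \<tau> x"
proof safe
  assume u: "arr (fst \<tau>) (tp X x) u"
    and a: "\<forall>x'\<in>carrier X. hm X x x' \<bullet> u \<preceq>\<^bsub>fst \<tau>,tp X x'\<^esub> cv \<tau> x'"
  show "u \<preceq>\<^bsub>fst \<tau>,tp X x\<^esub> cv \<tau> x"
    using leq_trans[OF leq_comp_hm_refl(2)[OF X x u]] a x by blast
next
  assume u: "u \<preceq>\<^bsub>fst \<tau>,tp X x\<^esub> cv \<tau> x"
  then show "arr (fst \<tau>) (tp X x) u" by (rule leq_arr)
  fix x' assume x': "x' \<in> carrier X"
  show "hm X x x' \<bullet> u \<preceq>\<^bsub>fst \<tau>,tp X x'\<^esub> cv \<tau> x'"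
    using leq_trans[OF comp_mono_right[OF u hm_arr[OF X x x']] copresheaf_hm[OF X t x x']] .
qed

lemma yoneda:
  assumes X: "qcategory Q X" and s: "\<sigma> \<in> presheaves Q X" and x: "x \<in> carrier X"
  shows "hm (Psh Q X) (yo Q X x) \<sigma> = pv \<sigma> x"
proof (rule eq_if_same_lower_bounds)
  note y = yo_in_presheaves[OF X x]
  show "arr (tp X x) (fst \<sigma>) (hm (Psh Q X) (yo Q X x) \<sigma>)" using hm_Psh_arr[OF X y s] x by simp
  show "arr (tp X x) (fst \<sigma>) (pv \<sigma> x)" by (rule presheaf_arr[OF X s x])
  show "u \<preceq>\<^bsub>tp X x,fst \<sigma>\<^esub> hm (Psh Q X) (yo Q X x) \<sigma> \<longleftrightarrow> u \<preceq>\<^bsub>tp X x,fst \<sigma>\<^esub> pv \<sigma> x" for u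
    using leq_hm_Psh_iff[OF X y s, of u] comp_hm_leq_presheaf_iff[OF X s x, of u] x by simp
qed

lemma coyoneda:
  assumes X: "qcategory Q X" and t: "\<tau> \<in> copresheaves Q X" and x: "x \<in> carrier X"
  shows "hm (Cop Q X) \<tau> (coyo Q X x) = cv \<tau> x"
proof (rule eq_if_same_lower_bounds)
  note y = coyo_in_copresheaves[OF X x]
  show "arr (fst \<tau>) (tp X x) (hm (Cop Q X) \<tau> (coyo Q X x))" using hm_Cop_arr[OF X t y] x by simp
  show "arr (fst \<tau>) (tp X x) (cv \<tau> x)" by (rule copresheaf_arr[OF X t x])
  show "u \<preceq>\<^bsub>fst \<tau>,tp X x\<^esub> hm (Cop Q X) \<tau> (coyo Q X x) \<longleftrightarrow> u \<preceq>\<^bsub>fst \<tau>,tp X x\<^esub> cv \<tau> x" for u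
    using leq_hm_Cop_iff[OF X t y, of u] hm_comp_leq_copresheaf_iff[OF X t x, of u] x by simp
qed

section \<open>Direct and inverse images\<close>

context
  fixes X :: "('a, 'o, 'm) qcat" and Y :: "('b, 'o, 'm) qcat" and f :: "'a \<Rightarrow> 'b"
  assumes X: "qcategory Q X" and Y: "qcategory Q Y" and f: "qfunctor Q X Y f"
begin

lemma hm_f_arr:
  "x \<in> carrier X \<Longrightarrow> y \<in> carrier Y \<Longrightarrow> arr (tp X x) (tp Y y) (hm Y (f x) y)"
  "x \<in> carrier X \<Longrightarrow> y \<in> carrier Y \<Longrightarrow> arr (tp Y y) (tp X x) (hm Y y (f x))"
  using hm_arr[OF Y, of "f x" y] hm_arr[OF Y, of y "f x"] qfunctor_closed[OF f] qfunctor_tp[OF f] by auto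

lemma hm_f_trans:
  assumes "x \<in> carrier X" "y \<in> carrier Y" "y' \<in> carrier Y"
  shows "hm Y y y' \<bullet> hm Y (f x) y \<preceq>\<^bsub>tp X x,tp Y y'\<^esub> hm Y (f x) y'"
    and "hm Y y' (f x) \<bullet> hm Y y y' \<preceq>\<^bsub>tp Y y,tp X x\<^esub> hm Y y (f x)"
  using hm_trans[OF Y, of "f x" y y'] hm_trans[OF Y, of y y' "f x"] assms qfunctor_closed[OF f] qfunctor_tp[OF f] by auto

lemma leq_comp_hm_f_refl:
  assumes x: "x \<in> carrier X"
  shows "arr (tp X x) t v \<Longrightarrow> v \<preceq>\<^bsub>tp X x,t\<^esub> v \<bullet> hm Y (f x) (f x)"
    and "arr t (tp X x) w \<Longrightarrow> w \<preceq>\<^bsub>t,tp X x\<^esub> hm Y (f x) (f x) \<bullet> w"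
  using leq_comp_hm_refl[OF Y qfunctor_closed[OF f x]] qfunctor_tp[OF f x] by auto

lemma distributor_graph: "distributor Q X Y (graph X Y f)"
proof -
  have "hm Y (f x') y \<bullet> hm X x x' \<preceq>\<^bsub>tp X x,tp Y y\<^esub> hm Y (f x) y"
    if "x \<in> carrier X" "x' \<in> carrier X" "y \<in> carrier Y" for x x' y
    using leq_trans[OF comp_mono_right[OF qfunctor_hm[OF X Y f that(1,2)] hm_f_arr(1)[OF that(2,3)]]]
      hm_trans[OF Y, of "f x" "f x'" y] that qfunctor_closed[OF f] qfunctor_tp[OF f] by auto
  moreover have "graph X Y f \<in> qrel Q X Y"
    using X Y hm_f_arr by (subst qrel_iff) (auto simp: tp_obs, auto simp: graph_def)
  ultimately show ?thesis
    using hm_f_trans by (auto simp: distributor_iff[OF X Y])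
qed

context
  fixes \<sigma> :: "('a, 'o, 'm) presheaf"
  assumes s: "\<sigma> \<in> presheaves Q X"
begin

text \<open>\<open>f\<^sub>!\<sigma>\<close> at \<open>y\<close> is the supremum over \<open>x\<close> of \<open>\<sigma>(x) \<circ> hom(y, fx)\<close>, which stays a supremum under
  composition from either side.\<close>

lemma pv_psh_dir_arr: "y \<in> carrier Y \<Longrightarrow> arr (tp Y y) (fst \<sigma>) (pv (psh_dir Q X Y f \<sigma>) y)"
  and pv_psh_dir_leq_iff: "y \<in> carrier Y \<Longrightarrow> pv (psh_dir Q X Y f \<sigma>) y \<preceq>\<^bsub>tp Y y,fst \<sigma>\<^esub> w
    \<longleftrightarrow> arr (tp Y y) (fst \<sigma>) w \<and> (\<forall>x\<in>carrier X. pv \<sigma> x \<bullet> hm Y y (f x) \<preceq>\<^bsub>tp Y y,fst \<sigma>\<^esub> w)"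
  and pv_psh_dir_upper: "y \<in> carrier Y \<Longrightarrow> x \<in> carrier X
    \<Longrightarrow> pv \<sigma> x \<bullet> hm Y y (f x) \<preceq>\<^bsub>tp Y y,fst \<sigma>\<^esub> pv (psh_dir Q X Y f \<sigma>) y"
  and comp_pv_psh_dir_leq_iff: "y \<in> carrier Y \<Longrightarrow> arr (fst \<sigma>) t v \<Longrightarrow>
    v \<bullet> pv (psh_dir Q X Y f \<sigma>) y \<preceq>\<^bsub>tp Y y,t\<^esub> w \<longleftrightarrow> arr (tp Y y) t w \<and>
      (\<forall>x\<in>carrier X. v \<bullet> pv \<sigma> x \<bullet> hm Y y (f x) \<preceq>\<^bsub>tp Y y,t\<^esub> w)"
  and pv_psh_dir_comp_leq_iff: "y \<in> carrier Y \<Longrightarrow> arr t (tp Y y) v \<Longrightarrow>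
    pv (psh_dir Q X Y f \<sigma>) y \<bullet> v \<preceq>\<^bsub>t,fst \<sigma>\<^esub> w \<longleftrightarrow> arr t (fst \<sigma>) w \<and>
      (\<forall>x\<in>carrier X. pv \<sigma> x \<bullet> hm Y y (f x) \<bullet> v \<preceq>\<^bsub>t,fst \<sigma>\<^esub> w)"
proof -
  assume y: "y \<in> carrier Y"
  have o: "tp Y y \<in> obs Q" "fst \<sigma> \<in> obs Q" using y Y s by (auto simp: tp_obs presheaf_obs)
  have eq: "snd (psh_dir Q X Y f \<sigma>) = rel_comp Q Y X (star Q (fst \<sigma>)) (snd \<sigma>) (cograph X Y f)"
    using s by (simp add: psh_dir_def)
  have a: "\<And>x. x \<in> carrier X \<Longrightarrow> arr (tp Y y) (tp X x) (cograph X Y f y x)"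
    "\<And>x. x \<in> carrier X \<Longrightarrow> arr (tp X x) (tp (star Q (fst \<sigma>)) ()) (pv \<sigma> x)"
    using y hm_f_arr presheaf_arr[OF X s] by auto
  note R = rel_comp_at[where X = Y and Y = X and Z = "star Q (fst \<sigma>)" and \<phi> = "cograph X Y f"
      and \<psi> = "snd \<sigma>" and x = y and z = "()", OF y _ o(1) _ a]
  show "arr (tp Y y) (fst \<sigma>) (pv (psh_dir Q X Y f \<sigma>) y)"
    unfolding eq using R(1) o by simp
  show "pv (psh_dir Q X Y f \<sigma>) y \<preceq>\<^bsub>tp Y y,fst \<sigma>\<^esub> w
    \<longleftrightarrow> arr (tp Y y) (fst \<sigma>) w \<and> (\<forall>x\<in>carrier X. pv \<sigma> x \<bullet> hm Y y (f x) \<preceq>\<^bsub>tp Y y,fst \<sigma>\<^esub> w)"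
    unfolding eq using R(2) o y by simp
  show "pv \<sigma> x \<bullet> hm Y y (f x) \<preceq>\<^bsub>tp Y y,fst \<sigma>\<^esub> pv (psh_dir Q X Y f \<sigma>) y" if "x \<in> carrier X"
    unfolding eq using R(3) o y that by simp
  show "v \<bullet> pv (psh_dir Q X Y f \<sigma>) y \<preceq>\<^bsub>tp Y y,t\<^esub> w \<longleftrightarrow> arr (tp Y y) t w \<and>
      (\<forall>x\<in>carrier X. v \<bullet> pv \<sigma> x \<bullet> hm Y y (f x) \<preceq>\<^bsub>tp Y y,t\<^esub> w)" if "arr (fst \<sigma>) t v"
    unfolding eq using R(4) o y that by simp
  show "pv (psh_dir Q X Y f \<sigma>) y \<bullet> v \<preceq>\<^bsub>t,fst \<sigma>\<^esub> w \<longleftrightarrow> arr t (fst \<sigma>) w \<and>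
      (\<forall>x\<in>carrier X. pv \<sigma> x \<bullet> hm Y y (f x) \<bullet> v \<preceq>\<^bsub>t,fst \<sigma>\<^esub> w)" if "arr t (tp Y y) v"
    unfolding eq using R(5) o y that by simp
qed

lemma psh_dir_in_presheaves: "psh_dir Q X Y f \<sigma> \<in> presheaves Q Y"
proof (rule presheafI[OF Y, where s = "fst \<sigma>" and \<phi> = "pv (psh_dir Q X Y f \<sigma>)"])
  show "snd (psh_dir Q X Y f \<sigma>) \<in> extensional (carrier Y)"
    using s by (simp add: psh_dir_def rel_comp_def)
  fix y y' assume y: "y \<in> carrier Y" "y' \<in> carrier Y"
  have "pv \<sigma> x \<bullet> hm Y y' (f x) \<bullet> hm Y y y' \<preceq>\<^bsub>tp Y y,fst \<sigma>\<^esub> pv (psh_dir Q X Y f \<sigma>) y"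
    if x: "x \<in> carrier X" for x
    using leq_trans[OF comp_mono_right[OF hm_f_trans(2)[OF x y] presheaf_arr[OF X s x]] pv_psh_dir_upper[OF y(1) x]] .
  then show "pv (psh_dir Q X Y f \<sigma>) y' \<bullet> hm Y y y' \<preceq>\<^bsub>tp Y y,fst \<sigma>\<^esub> pv (psh_dir Q X Y f \<sigma>) y"
    using pv_psh_dir_comp_leq_iff[OF y(2) hm_arr[OF Y y]] pv_psh_dir_arr[OF y(1)] by blast
qed (use s pv_psh_dir_arr in \<open>auto simp: presheaf_obs\<close>)

text \<open>If \<open>f\<close> has a left adjoint with value \<open>a\<close> at \<open>y\<close>, the supremum defining \<open>f\<^sub>!\<sigma>\<close> at \<open>y\<close> runs over
  \<open>\<sigma>(x) \<circ> hom(a, x)\<close> and is attained at \<open>x = a\<close>. The adjoint need only exist at the point \<open>y\<close>.\<close>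

lemma pv_psh_dir_left_adjoint:
  assumes y: "y \<in> carrier Y" and a: "a \<in> carrier X" and ta: "tp X a = tp Y y"
    and adj: "\<And>x. x \<in> carrier X \<Longrightarrow> hm Y y (f x) = hm X a x"
  shows "pv (psh_dir Q X Y f \<sigma>) y = pv \<sigma> a"
proof (rule leq_antisym)
  have "arr (tp Y y) (fst \<sigma>) (pv \<sigma> a)" using presheaf_arr[OF X s a] ta by simp
  then show "pv (psh_dir Q X Y f \<sigma>) y \<preceq>\<^bsub>tp Y y,fst \<sigma>\<^esub> pv \<sigma> a"
    using y a adj ta presheaf_hm[OF X s a] by (auto simp: pv_psh_dir_leq_iff)
  show "pv \<sigma> a \<preceq>\<^bsub>tp Y y,fst \<sigma>\<^esub> pv (psh_dir Q X Y f \<sigma>) y"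
    using leq_trans[OF leq_comp_hm_refl(1)[OF X a presheaf_arr[OF X s a]]] pv_psh_dir_upper[OF y a] ta adj[OF a] by simp
qed

text \<open>The adjunction of direct and inverse image of presheaves, for the underlying order only.\<close>

lemma psh_dir_leq_iff:
  assumes r: "\<rho> \<in> presheaves Q Y" and st: "fst \<rho> = fst \<sigma>"
  shows "(\<forall>y\<in>carrier Y. pv (psh_dir Q X Y f \<sigma>) y \<preceq>\<^bsub>tp Y y,fst \<sigma>\<^esub> pv \<rho> y)
    \<longleftrightarrow> (\<forall>x\<in>carrier X. pv \<sigma> x \<preceq>\<^bsub>tp X x,fst \<sigma>\<^esub> pv \<rho> (f x))" (is "?l \<longleftrightarrow> ?r")
proof -
  have "?l \<longleftrightarrow> (\<forall>y\<in>carrier Y. \<forall>x\<in>carrier X. pv \<sigma> x \<bullet> hm Y y (f x) \<preceq>\<^bsub>tp Y y,fst \<sigma>\<^esub> pv \<rho> y)"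
    using pv_psh_dir_leq_iff presheaf_arr[OF Y r] st by auto
  also have "\<dots> \<longleftrightarrow> ?r"
  proof -
    have "pv \<sigma> x \<preceq>\<^bsub>tp X x,fst \<sigma>\<^esub> pv \<rho> (f x) \<longleftrightarrow> 
      (\<forall>y\<in>carrier Y. pv \<sigma> x \<bullet> hm Y y (f x) \<preceq>\<^bsub>tp Y y,fst \<sigma>\<^esub> pv \<rho> y)" if x: "x \<in> carrier X" for x
      using comp_hm_leq_presheaf_iff[OF Y r qfunctor_closed[OF f x], of "pv \<sigma> x"] presheaf_arr[OF X s x]
        qfunctor_tp[OF f x] st by simp
    then show ?thesis by blast
  qed
  finally show ?thesis .
qed

end

lemma qfunctor_psh_dir: "qfunctor Q (Psh Q X) (Psh Q Y) (psh_dir Q X Y f)"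
  unfolding qfunctor_iff[OF qcategory_Psh[OF X] qcategory_Psh[OF Y]]
proof (intro conjI ballI; (unfold Psh_simps(1))?)
  show "psh_dir Q X Y f \<in> presheaves Q X \<rightarrow>\<^sub>E presheaves Q Y"
    using psh_dir_in_presheaves by (auto simp: psh_dir_def)
  fix \<sigma> assume s: "\<sigma> \<in> presheaves Q X"
  show "tp (Psh Q Y) (psh_dir Q X Y f \<sigma>) = tp (Psh Q X) \<sigma>"
    using s psh_dir_in_presheaves[OF s] by simp
  fix \<sigma>' assume s': "\<sigma>' \<in> presheaves Q X"
  let ?h = "hm (Psh Q X) \<sigma> \<sigma>'"
  note h = hm_Psh_arr[OF X s s']
  have "?h \<bullet> pv \<sigma> x \<bullet> hm Y y (f x) \<preceq>\<^bsub>tp Y y,fst \<sigma>'\<^esub> pv (psh_dir Q X Y f \<sigma>') y"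
    if x: "x \<in> carrier X" and y: "y \<in> carrier Y" for x y
  proof -
    have "?h \<bullet> pv \<sigma> x \<bullet> hm Y y (f x) = (?h \<bullet> pv \<sigma> x) \<bullet> hm Y y (f x)"
      by (rule cmp_assoc[OF hm_f_arr(2)[OF x y] presheaf_arr[OF X s x] h, symmetric])
    also have "(?h \<bullet> pv \<sigma> x) \<bullet> hm Y y (f x) \<preceq>\<^bsub>tp Y y,fst \<sigma>'\<^esub> pv \<sigma>' x \<bullet> hm Y y (f x)"
      by (rule comp_mono_left[OF hm_Psh_comp[OF X s s' x] hm_f_arr(2)[OF x y]])
    also have "\<dots> \<preceq>\<^bsub>tp Y y,fst \<sigma>'\<^esub> pv (psh_dir Q X Y f \<sigma>') y"
      by (rule pv_psh_dir_upper[OF s' y x])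
    finally show ?thesis .
  qed
  then show "?h \<preceq>\<^bsub>tp (Psh Q X) \<sigma>,tp (Psh Q X) \<sigma>'\<^esub> hm (Psh Q Y) (psh_dir Q X Y f \<sigma>) (psh_dir Q X Y f \<sigma>')"
    using leq_hm_Psh_iff[OF Y psh_dir_in_presheaves[OF s] psh_dir_in_presheaves[OF s'], of ?h] s s' h
      comp_pv_psh_dir_leq_iff[OF s _ h] pv_psh_dir_arr[OF s'] by simp
qed

context
  fixes \<tau> :: "('a, 'o, 'm) copresheaf"
  assumes t: "\<tau> \<in> copresheaves Q X"
begin

text \<open>Dually, the direct image of \<open>\<tau>\<close> at \<open>y\<close> is the supremum over \<open>x\<close> of \<open>hom(fx, y) \<circ> \<tau>(x)\<close>.\<close>

lemma cv_cop_dir_arr: "y \<in> carrier Y \<Longrightarrow> arr (fst \<tau>) (tp Y y) (cv (cop_dir Q X Y f \<tau>) y)"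
  and cv_cop_dir_leq_iff: "y \<in> carrier Y \<Longrightarrow> cv (cop_dir Q X Y f \<tau>) y \<preceq>\<^bsub>fst \<tau>,tp Y y\<^esub> w
    \<longleftrightarrow> arr (fst \<tau>) (tp Y y) w \<and> (\<forall>x\<in>carrier X. hm Y (f x) y \<bullet> cv \<tau> x \<preceq>\<^bsub>fst \<tau>,tp Y y\<^esub> w)"
  and cv_cop_dir_upper: "y \<in> carrier Y \<Longrightarrow> x \<in> carrier X
    \<Longrightarrow> hm Y (f x) y \<bullet> cv \<tau> x \<preceq>\<^bsub>fst \<tau>,tp Y y\<^esub> cv (cop_dir Q X Y f \<tau>) y"
  and comp_cv_cop_dir_leq_iff: "y \<in> carrier Y \<Longrightarrow> arr (tp Y y) t v \<Longrightarrow>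
    v \<bullet> cv (cop_dir Q X Y f \<tau>) y \<preceq>\<^bsub>fst \<tau>,t\<^esub> w \<longleftrightarrow> arr (fst \<tau>) t w \<and>
      (\<forall>x\<in>carrier X. v \<bullet> hm Y (f x) y \<bullet> cv \<tau> x \<preceq>\<^bsub>fst \<tau>,t\<^esub> w)"
  and cv_cop_dir_comp_leq_iff: "y \<in> carrier Y \<Longrightarrow> arr t (fst \<tau>) v \<Longrightarrow>
    cv (cop_dir Q X Y f \<tau>) y \<bullet> v \<preceq>\<^bsub>t,tp Y y\<^esub> w \<longleftrightarrow> arr t (tp Y y) w \<and>
      (\<forall>x\<in>carrier X. hm Y (f x) y \<bullet> cv \<tau> x \<bullet> v \<preceq>\<^bsub>t,tp Y y\<^esub> w)"
proof -
  assume y: "y \<in> carrier Y"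
  have o: "tp Y y \<in> obs Q" "fst \<tau> \<in> obs Q" using y Y t by (auto simp: tp_obs copresheaf_obs)
  have eq: "snd (cop_dir Q X Y f \<tau>) = rel_comp Q (star Q (fst \<tau>)) X Y (graph X Y f) (snd \<tau>)"
    using t by (simp add: cop_dir_def)
  have a: "\<And>x. x \<in> carrier X \<Longrightarrow> arr (tp (star Q (fst \<tau>)) ()) (tp X x) (cv \<tau> x)"
    "\<And>x. x \<in> carrier X \<Longrightarrow> arr (tp X x) (tp Y y) (graph X Y f x y)"
    using y hm_f_arr copresheaf_arr[OF X t] by auto
  note R = rel_comp_at[where Z = Y and Y = X and X = "star Q (fst \<tau>)" and \<psi> = "graph X Y f"
      and \<phi> = "snd \<tau>" and z = y and x = "()", OF _ y _ o(1) a]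
  show "arr (fst \<tau>) (tp Y y) (cv (cop_dir Q X Y f \<tau>) y)"
    unfolding eq using R(1) o by simp
  show "cv (cop_dir Q X Y f \<tau>) y \<preceq>\<^bsub>fst \<tau>,tp Y y\<^esub> w
    \<longleftrightarrow> arr (fst \<tau>) (tp Y y) w \<and> (\<forall>x\<in>carrier X. hm Y (f x) y \<bullet> cv \<tau> x \<preceq>\<^bsub>fst \<tau>,tp Y y\<^esub> w)"
    unfolding eq using R(2) o y by simp
  show "hm Y (f x) y \<bullet> cv \<tau> x \<preceq>\<^bsub>fst \<tau>,tp Y y\<^esub> cv (cop_dir Q X Y f \<tau>) y" if "x \<in> carrier X"
    unfolding eq using R(3) o y that by simp
  show "v \<bullet> cv (cop_dir Q X Y f \<tau>) y \<preceq>\<^bsub>fst \<tau>,t\<^esub> w \<longleftrightarrow> arr (fst \<tau>) t w \<and>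
      (\<forall>x\<in>carrier X. v \<bullet> hm Y (f x) y \<bullet> cv \<tau> x \<preceq>\<^bsub>fst \<tau>,t\<^esub> w)" if "arr (tp Y y) t v"
    unfolding eq using R(4) o y that by simp
  show "cv (cop_dir Q X Y f \<tau>) y \<bullet> v \<preceq>\<^bsub>t,tp Y y\<^esub> w \<longleftrightarrow> arr t (tp Y y) w \<and>
      (\<forall>x\<in>carrier X. hm Y (f x) y \<bullet> cv \<tau> x \<bullet> v \<preceq>\<^bsub>t,tp Y y\<^esub> w)" if "arr t (fst \<tau>) v"
    unfolding eq using R(5) o y that by simp
qed

lemma cop_dir_in_copresheaves: "cop_dir Q X Y f \<tau> \<in> copresheaves Q Y"
proof (rule copresheafI[OF Y, where s = "fst \<tau>" and \<phi> = "cv (cop_dir Q X Y f \<tau>)"])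
  show "cv (cop_dir Q X Y f \<tau>) \<in> extensional (carrier Y)"
    using t by (auto simp: cop_dir_def rel_comp_def extensional_def)
  fix y y' assume y: "y \<in> carrier Y" "y' \<in> carrier Y"
  have "hm Y y y' \<bullet> hm Y (f x) y \<bullet> cv \<tau> x \<preceq>\<^bsub>fst \<tau>,tp Y y'\<^esub> cv (cop_dir Q X Y f \<tau>) y'"
    if x: "x \<in> carrier X" for x
    using leq_trans[OF comp_mono_left[OF hm_f_trans(1)[OF x y] copresheaf_arr[OF X t x]] cv_cop_dir_upper[OF y(2) x]]
     cmp_assoc[OF copresheaf_arr[OF X t x] hm_f_arr(1)[OF x y(1)] hm_arr[OF Y y]] by simp
  then show "hm Y y y' \<bullet> cv (cop_dir Q X Y f \<tau>) y \<preceq>\<^bsub>fst \<tau>,tp Y y'\<^esub> cv (cop_dir Q X Y f \<tau>) y'"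
    using comp_cv_cop_dir_leq_iff[OF y(1) hm_arr[OF Y y]] cv_cop_dir_arr[OF y(2)] by blast
qed (use t cv_cop_dir_arr in \<open>auto simp: copresheaf_obs\<close>)

text \<open>A condition on all points of \<open>Y\<close> reduces to the points \<open>f x\<close>, since \<open>\<rho>\<close> is a copresheaf. The order
  of \<open>\<P>\<^sup>\<dagger>\<close> is reversed, hence direct image is the right adjoint here.\<close>

lemma leq_hm_cop_dir_iff:
  assumes r: "\<rho> \<in> copresheaves Q Y"
  shows "u \<preceq>\<^bsub>fst \<rho>,fst \<tau>\<^esub> hm (Cop Q Y) \<rho> (cop_dir Q X Y f \<tau>) \<longleftrightarrow> arr (fst \<rho>) (fst \<tau>) u \<and>
    (\<forall>x\<in>carrier X. cv \<tau> x \<bullet> u \<preceq>\<^bsub>fst \<rho>,tp X x\<^esub> cv \<rho> (f x))"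
proof (cases "arr (fst \<rho>) (fst \<tau>) u")
  case True
  have "u \<preceq>\<^bsub>fst \<rho>,fst \<tau>\<^esub> hm (Cop Q Y) \<rho> (cop_dir Q X Y f \<tau>) \<longleftrightarrow>
    (\<forall>y\<in>carrier Y. cv (cop_dir Q X Y f \<tau>) y \<bullet> u \<preceq>\<^bsub>fst \<rho>,tp Y y\<^esub> cv \<rho> y)"
    using leq_hm_Cop_iff[OF Y r cop_dir_in_copresheaves, of u] t True by simp
  also have "\<dots> \<longleftrightarrow> (\<forall>y\<in>carrier Y. \<forall>x\<in>carrier X. hm Y (f x) y \<bullet> cv \<tau> x \<bullet> u \<preceq>\<^bsub>fst \<rho>,tp Y y\<^esub> cv \<rho> y)"
    using cv_cop_dir_comp_leq_iff[OF _ True] copresheaf_arr[OF Y r] by simp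
  also have "\<dots> \<longleftrightarrow> (\<forall>x\<in>carrier X. cv \<tau> x \<bullet> u \<preceq>\<^bsub>fst \<rho>,tp X x\<^esub> cv \<rho> (f x))"
  proof -
    have "cv \<tau> x \<bullet> u \<preceq>\<^bsub>fst \<rho>,tp X x\<^esub> cv \<rho> (f x) \<longleftrightarrow>
      (\<forall>y\<in>carrier Y. hm Y (f x) y \<bullet> cv \<tau> x \<bullet> u \<preceq>\<^bsub>fst \<rho>,tp Y y\<^esub> cv \<rho> y)" if x: "x \<in> carrier X" for x
      using hm_comp_leq_copresheaf_iff[OF Y r qfunctor_closed[OF f x], of "cv \<tau> x \<bullet> u"]
        qfunctor_tp[OF f x] arr_comp[OF True copresheaf_arr[OF X t x]] by simp
    then show ?thesis by blast
  qed
  finally show ?thesis using True by simp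
qed (auto dest: leq_arr)

end

lemma qfunctor_cop_dir: "qfunctor Q (Cop Q X) (Cop Q Y) (cop_dir Q X Y f)"
  unfolding qfunctor_iff[OF qcategory_Cop[OF X] qcategory_Cop[OF Y]]
proof (intro conjI ballI; (unfold Cop_simps(1))?)
  show "cop_dir Q X Y f \<in> copresheaves Q X \<rightarrow>\<^sub>E copresheaves Q Y"
    using cop_dir_in_copresheaves by (auto simp: cop_dir_def)
  fix \<tau> assume t: "\<tau> \<in> copresheaves Q X"
  show "tp (Cop Q Y) (cop_dir Q X Y f \<tau>) = tp (Cop Q X) \<tau>"
    using t cop_dir_in_copresheaves[OF t] by simp
  fix \<tau>' assume t': "\<tau>' \<in> copresheaves Q X"
  let ?h = "hm (Cop Q X) \<tau> \<tau>'"
  have "cv \<tau>' x \<bullet> ?h \<preceq>\<^bsub>fst \<tau>,tp X x\<^esub> cv (cop_dir Q X Y f \<tau>) (f x)" if x: "x \<in> carrier X" for x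
  proof -
    note fx = qfunctor_closed[OF f x] and tx = copresheaf_arr[OF X t x]
    have "cv \<tau>' x \<bullet> ?h \<preceq>\<^bsub>fst \<tau>,tp X x\<^esub> cv \<tau> x" by (rule hm_Cop_comp[OF X t t' x])
    also have "\<dots> \<preceq>\<^bsub>fst \<tau>,tp X x\<^esub> hm Y (f x) (f x) \<bullet> cv \<tau> x" by (rule leq_comp_hm_f_refl(2)[OF x tx])
    also have "\<dots> \<preceq>\<^bsub>fst \<tau>,tp X x\<^esub> cv (cop_dir Q X Y f \<tau>) (f x)"
      using cv_cop_dir_upper[OF t fx x] qfunctor_tp[OF f x] by simp
    finally show ?thesis .
  qed
  then show "?h \<preceq>\<^bsub>tp (Cop Q X) \<tau>,tp (Cop Q X) \<tau>'\<^esub> hm (Cop Q Y) (cop_dir Q X Y f \<tau>) (cop_dir Q X Y f \<tau>')"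
    using leq_hm_cop_dir_iff[OF t' cop_dir_in_copresheaves[OF t], of ?h] hm_Cop_arr[OF X t t'] t t' by simp
qed

text \<open>Inverse image along \<open>f\<close> is precomposition with \<open>f\<close>; the supremum over \<open>Y\<close> in its definition is
  attained at \<open>f x\<close>.\<close>

lemma pv_psh_inv:
  assumes s: "\<sigma> \<in> presheaves Q Y" and x: "x \<in> carrier X"
  shows "pv (psh_inv Q X Y f \<sigma>) x = pv \<sigma> (f x)"
proof -
  note fx = qfunctor_closed[OF f x] qfunctor_tp[OF f x]
  have o: "tp X x \<in> obs Q" "fst \<sigma> \<in> obs Q" using x X s by (auto simp: tp_obs presheaf_obs)
  have eq: "snd (psh_inv Q X Y f \<sigma>) = rel_comp Q X Y (star Q (fst \<sigma>)) (snd \<sigma>) (graph X Y f)"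
    using s by (simp add: psh_inv_def)
  have a: "\<And>y. y \<in> carrier Y \<Longrightarrow> arr (tp X x) (tp Y y) (graph X Y f x y)"
    "\<And>y. y \<in> carrier Y \<Longrightarrow> arr (tp Y y) (tp (star Q (fst \<sigma>)) ()) (pv \<sigma> y)"
    using x hm_f_arr presheaf_arr[OF Y s] by auto
  note R = rel_comp_at[where X = X and Y = Y and Z = "star Q (fst \<sigma>)" and \<phi> = "graph X Y f"
      and \<psi> = "snd \<sigma>" and x = x and z = "()", OF x _ o(1) _ a]
  have arrs: "arr (tp X x) (fst \<sigma>) (pv \<sigma> (f x))" using presheaf_arr[OF Y s fx(1)] fx(2) by simp
  show ?thesis
  proof (rule leq_antisym[of _ "tp X x" "fst \<sigma>"])
    show "pv (psh_inv Q X Y f \<sigma>) x \<preceq>\<^bsub>tp X x,fst \<sigma>\<^esub> pv \<sigma> (f x)"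
      unfolding eq using R(2) o x arrs presheaf_hm[OF Y s fx(1)] fx(2) by simp
    have "pv \<sigma> (f x) \<preceq>\<^bsub>tp X x,fst \<sigma>\<^esub> pv \<sigma> (f x) \<bullet> hm Y (f x) (f x)"
      by (rule leq_comp_hm_f_refl(1)[OF x arrs])
    also have "\<dots> \<preceq>\<^bsub>tp X x,fst \<sigma>\<^esub> pv (psh_inv Q X Y f \<sigma>) x"
      unfolding eq using R(3)[of "f x"] o x fx by simp
    finally show "pv \<sigma> (f x) \<preceq>\<^bsub>tp X x,fst \<sigma>\<^esub> pv (psh_inv Q X Y f \<sigma>) x" .
  qed
qed

lemma cv_cop_inv:
  assumes t: "\<tau> \<in> copresheaves Q Y" and x: "x \<in> carrier X"
  shows "cv (cop_inv Q X Y f \<tau>) x = cv \<tau> (f x)"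
proof -
  note fx = qfunctor_closed[OF f x] qfunctor_tp[OF f x]
  have o: "tp X x \<in> obs Q" "fst \<tau> \<in> obs Q" using x X t by (auto simp: tp_obs copresheaf_obs)
  have eq: "snd (cop_inv Q X Y f \<tau>) = rel_comp Q (star Q (fst \<tau>)) Y X (cograph X Y f) (snd \<tau>)"
    using t by (simp add: cop_inv_def)
  have a: "\<And>y. y \<in> carrier Y \<Longrightarrow> arr (tp (star Q (fst \<tau>)) ()) (tp Y y) (cv \<tau> y)"
    "\<And>y. y \<in> carrier Y \<Longrightarrow> arr (tp Y y) (tp X x) (cograph X Y f y x)"
    using x hm_f_arr copresheaf_arr[OF Y t] by auto
  note R = rel_comp_at[where Z = X and Y = Y and X = "star Q (fst \<tau>)" and \<psi> = "cograph X Y f"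
      and \<phi> = "snd \<tau>" and z = x and x = "()", OF _ x _ o(1) a]
  have arrs: "arr (fst \<tau>) (tp X x) (cv \<tau> (f x))" using copresheaf_arr[OF Y t fx(1)] fx(2) by simp
  show ?thesis
  proof (rule leq_antisym[of _ "fst \<tau>" "tp X x"])
    show "cv (cop_inv Q X Y f \<tau>) x \<preceq>\<^bsub>fst \<tau>,tp X x\<^esub> cv \<tau> (f x)"
      unfolding eq using R(2) o x arrs copresheaf_hm[OF Y t _ fx(1)] fx(2) by simp
    have "cv \<tau> (f x) \<preceq>\<^bsub>fst \<tau>,tp X x\<^esub> hm Y (f x) (f x) \<bullet> cv \<tau> (f x)"
      by (rule leq_comp_hm_f_refl(2)[OF x arrs])
    also have "\<dots> \<preceq>\<^bsub>fst \<tau>,tp X x\<^esub> cv (cop_inv Q X Y f \<tau>) x"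
      unfolding eq using R(3)[of "f x"] o x fx by simp
    finally show "cv \<tau> (f x) \<preceq>\<^bsub>fst \<tau>,tp X x\<^esub> cv (cop_inv Q X Y f \<tau>) x" .
  qed
qed

lemma psh_inv_in_presheaves:
  assumes s: "\<sigma> \<in> presheaves Q Y"
  shows "psh_inv Q X Y f \<sigma> \<in> presheaves Q X"
proof (rule presheafI[OF X, where s = "fst \<sigma>" and \<phi> = "\<lambda>x. pv \<sigma> (f x)"])
  show "snd (psh_inv Q X Y f \<sigma>) \<in> extensional (carrier X)"
    using s by (simp add: psh_inv_def rel_comp_def)
  fix x x' assume x: "x \<in> carrier X" "x' \<in> carrier X"
  note fx = qfunctor_closed[OF f x(1)] qfunctor_tp[OF f x(1)] and fx' = qfunctor_closed[OF f x(2)] qfunctor_tp[OF f x(2)]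
  show "pv \<sigma> (f x') \<bullet> hm X x x' \<preceq>\<^bsub>tp X x,fst \<sigma>\<^esub> pv \<sigma> (f x)"
    using leq_trans[OF comp_mono_right[OF qfunctor_hm[OF X Y f x]]] presheaf_arr[OF Y s fx'(1)]
      presheaf_hm[OF Y s fx(1) fx'(1)] fx fx' by simp
next
  fix x assume x: "x \<in> carrier X"
  show "arr (tp X x) (fst \<sigma>) (pv \<sigma> (f x))"
    using presheaf_arr[OF Y s qfunctor_closed[OF f x]] qfunctor_tp[OF f x] by simp
qed (use s in \<open>auto simp: presheaf_obs pv_psh_inv\<close>)

lemma cop_inv_in_copresheaves:
  assumes t: "\<tau> \<in> copresheaves Q Y"
  shows "cop_inv Q X Y f \<tau> \<in> copresheaves Q X"
proof (rule copresheafI[OF X, where s = "fst \<tau>" and \<phi> = "\<lambda>x. cv \<tau> (f x)"])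
  show "cv (cop_inv Q X Y f \<tau>) \<in> extensional (carrier X)"
    using t by (auto simp: cop_inv_def rel_comp_def extensional_def)
  fix x x' assume x: "x \<in> carrier X" "x' \<in> carrier X"
  note fx = qfunctor_closed[OF f x(1)] qfunctor_tp[OF f x(1)] and fx' = qfunctor_closed[OF f x(2)] qfunctor_tp[OF f x(2)]
  show "hm X x x' \<bullet> cv \<tau> (f x) \<preceq>\<^bsub>fst \<tau>,tp X x'\<^esub> cv \<tau> (f x')"
    using leq_trans[OF comp_mono_left[OF qfunctor_hm[OF X Y f x]]] copresheaf_arr[OF Y t fx(1)]
      copresheaf_hm[OF Y t fx(1) fx'(1)] fx fx' by simp
next
  fix x assume x: "x \<in> carrier X"
  show "arr (fst \<tau>) (tp X x) (cv \<tau> (f x))"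
    using copresheaf_arr[OF Y t qfunctor_closed[OF f x]] qfunctor_tp[OF f x] by simp
qed (use t in \<open>auto simp: copresheaf_obs cv_cop_inv\<close>)

lemma qfunctor_psh_inv: "qfunctor Q (Psh Q Y) (Psh Q X) (psh_inv Q X Y f)"
  unfolding qfunctor_iff[OF qcategory_Psh[OF Y] qcategory_Psh[OF X]]
proof (intro conjI ballI; (unfold Psh_simps(1))?)
  show "psh_inv Q X Y f \<in> presheaves Q Y \<rightarrow>\<^sub>E presheaves Q X"
    using psh_inv_in_presheaves by (auto simp: psh_inv_def)
  fix \<sigma> assume s: "\<sigma> \<in> presheaves Q Y"
  show "tp (Psh Q X) (psh_inv Q X Y f \<sigma>) = tp (Psh Q Y) \<sigma>"
    using s psh_inv_in_presheaves[OF s] by simp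
  fix \<sigma>' assume s': "\<sigma>' \<in> presheaves Q Y"
  have "hm (Psh Q Y) \<sigma> \<sigma>' \<bullet> pv \<sigma> (f x) \<preceq>\<^bsub>tp X x,fst \<sigma>'\<^esub> pv \<sigma>' (f x)" if "x \<in> carrier X" for x
    using hm_Psh_comp[OF Y s s' qfunctor_closed[OF f that]] qfunctor_tp[OF f that] by simp
  then show "hm (Psh Q Y) \<sigma> \<sigma>' \<preceq>\<^bsub>tp (Psh Q Y) \<sigma>,tp (Psh Q Y) \<sigma>'\<^esub>
      hm (Psh Q X) (psh_inv Q X Y f \<sigma>) (psh_inv Q X Y f \<sigma>')"
    using leq_hm_Psh_iff[OF X psh_inv_in_presheaves[OF s] psh_inv_in_presheaves[OF s'], of "hm (Psh Q Y) \<sigma> \<sigma>'"]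
      hm_Psh_arr[OF Y s s'] s s' by (simp add: pv_psh_inv)
qed

lemma qfunctor_cop_inv: "qfunctor Q (Cop Q Y) (Cop Q X) (cop_inv Q X Y f)"
  unfolding qfunctor_iff[OF qcategory_Cop[OF Y] qcategory_Cop[OF X]]
proof (intro conjI ballI; (unfold Cop_simps(1))?)
  show "cop_inv Q X Y f \<in> copresheaves Q Y \<rightarrow>\<^sub>E copresheaves Q X"
    using cop_inv_in_copresheaves by (auto simp: cop_inv_def)
  fix \<tau> assume t: "\<tau> \<in> copresheaves Q Y"
  show "tp (Cop Q X) (cop_inv Q X Y f \<tau>) = tp (Cop Q Y) \<tau>"
    using t cop_inv_in_copresheaves[OF t] by simp
  fix \<tau>' assume t': "\<tau>' \<in> copresheaves Q Y"
  have "cv \<tau>' (f x) \<bullet> hm (Cop Q Y) \<tau> \<tau>' \<preceq>\<^bsub>fst \<tau>,tp X x\<^esub> cv \<tau> (f x)" if "x \<in> carrier X" for x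
    using hm_Cop_comp[OF Y t t' qfunctor_closed[OF f that]] qfunctor_tp[OF f that] by simp
  then show "hm (Cop Q Y) \<tau> \<tau>' \<preceq>\<^bsub>tp (Cop Q Y) \<tau>,tp (Cop Q Y) \<tau>'\<^esub>
      hm (Cop Q X) (cop_inv Q X Y f \<tau>) (cop_inv Q X Y f \<tau>')"
    using leq_hm_Cop_iff[OF X cop_inv_in_copresheaves[OF t] cop_inv_in_copresheaves[OF t'], of "hm (Cop Q Y) \<tau> \<tau>'"]
      hm_Cop_arr[OF Y t t'] t t' by (simp add: cv_cop_inv)
qed

lemma hm_cop_inv_adjoint:
  assumes t: "\<tau> \<in> copresheaves Q X" and r: "\<rho> \<in> copresheaves Q Y"
  shows "hm (Cop Q X) (cop_inv Q X Y f \<rho>) \<tau> = hm (Cop Q Y) \<rho> (cop_dir Q X Y f \<tau>)"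
proof (rule eq_if_same_lower_bounds)
  note i = cop_inv_in_copresheaves[OF r] and d = cop_dir_in_copresheaves[OF t]
  show "arr (fst \<rho>) (fst \<tau>) (hm (Cop Q X) (cop_inv Q X Y f \<rho>) \<tau>)"
    using hm_Cop_arr[OF X i t] r by simp
  show "arr (fst \<rho>) (fst \<tau>) (hm (Cop Q Y) \<rho> (cop_dir Q X Y f \<tau>))"
    using hm_Cop_arr[OF Y r d] t by simp
  show "u \<preceq>\<^bsub>fst \<rho>,fst \<tau>\<^esub> hm (Cop Q X) (cop_inv Q X Y f \<rho>) \<tau> \<longleftrightarrow>
      u \<preceq>\<^bsub>fst \<rho>,fst \<tau>\<^esub> hm (Cop Q Y) \<rho> (cop_dir Q X Y f \<tau>)" for u
    using leq_hm_Cop_iff[OF X i t, of u] leq_hm_cop_dir_iff[OF t r, of u] r by (simp add: cv_cop_inv)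
qed

end

section \<open>The pairing of presheaves with copresheaves\<close>

text \<open>As \<open>hom(y(x), \<sigma>) = \<sigma>(x)\<close>, the direct image of \<open>\<tau>\<close> along the Yoneda embedding takes at \<open>\<sigma>\<close> the
  supremum of the arrows \<open>\<sigma>(x) \<circ> \<tau>(x)\<close> as its value. It is read as a copresheaf in \<open>\<sigma>\<close>, and as a pairing
  of \<open>\<sigma>\<close> with \<open>\<tau>\<close>.\<close>

abbreviation ycop :: "('a, 'o, 'm) qcat \<Rightarrow> ('a, 'o, 'm) copresheaf \<Rightarrow> (('a, 'o, 'm) presheaf, 'o, 'm) copresheaf" where
  "ycop X \<equiv> cop_dir Q X (Psh Q X) (yo Q X)"

abbreviation pairing :: "('a, 'o, 'm) qcat \<Rightarrow> ('a, 'o, 'm) presheaf \<Rightarrow> ('a, 'o, 'm) copresheaf \<Rightarrow> 'm" where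
  "pairing X \<sigma> \<tau> \<equiv> cv (ycop X \<tau>) \<sigma>"

context
  fixes X :: "('a, 'o, 'm) qcat" and \<sigma> :: "('a, 'o, 'm) presheaf" and \<tau> :: "('a, 'o, 'm) copresheaf"
  assumes X: "qcategory Q X" and s: "\<sigma> \<in> presheaves Q X" and t: "\<tau> \<in> copresheaves Q X"
begin

lemma pairing_arr: "arr (fst \<tau>) (fst \<sigma>) (pairing X \<sigma> \<tau>)"
  using cv_cop_dir_arr[OF X qcategory_Psh[OF X] qfunctor_yo[OF X] t, of \<sigma>] s by simp

lemma pairing_leq_iff: "pairing X \<sigma> \<tau> \<preceq>\<^bsub>fst \<tau>,fst \<sigma>\<^esub> w \<longleftrightarrow> arr (fst \<tau>) (fst \<sigma>) w \<and>
    (\<forall>x\<in>carrier X. pv \<sigma> x \<bullet> cv \<tau> x \<preceq>\<^bsub>fst \<tau>,fst \<sigma>\<^esub> w)"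
  using cv_cop_dir_leq_iff[OF X qcategory_Psh[OF X] qfunctor_yo[OF X] t, of \<sigma>] s
  by (simp add: yoneda[OF X s])

lemma pairing_upper: "x \<in> carrier X \<Longrightarrow> pv \<sigma> x \<bullet> cv \<tau> x \<preceq>\<^bsub>fst \<tau>,fst \<sigma>\<^esub> pairing X \<sigma> \<tau>"
  using cv_cop_dir_upper[OF X qcategory_Psh[OF X] qfunctor_yo[OF X] t, of \<sigma>] s
  by (simp add: yoneda[OF X s])

lemma pairing_comp_leq_iff: "arr t (fst \<tau>) v \<Longrightarrow>
    pairing X \<sigma> \<tau> \<bullet> v \<preceq>\<^bsub>t,fst \<sigma>\<^esub> w \<longleftrightarrow> arr t (fst \<sigma>) w \<and>
      (\<forall>x\<in>carrier X. pv \<sigma> x \<bullet> cv \<tau> x \<bullet> v \<preceq>\<^bsub>t,fst \<sigma>\<^esub> w)"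
  using cv_cop_dir_comp_leq_iff[OF X qcategory_Psh[OF X] qfunctor_yo[OF X] t, of \<sigma>] s
  by (simp add: yoneda[OF X s])

end

lemma pairing_yo:
  assumes X: "qcategory Q X" and t: "\<tau> \<in> copresheaves Q X" and x: "x \<in> carrier X"
  shows "pairing X (yo Q X x) \<tau> = cv \<tau> x"
proof (rule leq_antisym)
  note y = yo_in_presheaves[OF X x]
  note T = copresheaf_arr[OF X t x]
  show "pairing X (yo Q X x) \<tau> \<preceq>\<^bsub>fst \<tau>,tp X x\<^esub> cv \<tau> x"
    using pairing_leq_iff[OF X y t, of "cv \<tau> x"] x T copresheaf_hm[OF X t] by simp
  show "cv \<tau> x \<preceq>\<^bsub>fst \<tau>,tp X x\<^esub> pairing X (yo Q X x) \<tau>"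
    using leq_trans[OF leq_comp_hm_refl(2)[OF X x T]] pairing_upper[OF X y t x] x by simp
qed

lemma pairing_coyo:
  assumes X: "qcategory Q X" and s: "\<sigma> \<in> presheaves Q X" and x: "x \<in> carrier X"
  shows "pairing X \<sigma> (coyo Q X x) = pv \<sigma> x"
proof (rule leq_antisym)
  note y = coyo_in_copresheaves[OF X x]
  note S = presheaf_arr[OF X s x]
  show "pairing X \<sigma> (coyo Q X x) \<preceq>\<^bsub>tp X x,fst \<sigma>\<^esub> pv \<sigma> x"
    using pairing_leq_iff[OF X s y, of "pv \<sigma> x"] x S presheaf_hm[OF X s x] by simp
  show "pv \<sigma> x \<preceq>\<^bsub>tp X x,fst \<sigma>\<^esub> pairing X \<sigma> (coyo Q X x)"
    using leq_trans[OF leq_comp_hm_refl(1)[OF X x S]] pairing_upper[OF X s y x] x by simp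
qed

text \<open>Both sides are the supremum over \<open>x\<close> and \<open>y\<close> of \<open>\<sigma>(x) \<circ> hom(y, fx) \<circ> \<tau>(y)\<close>; the supremum over \<open>y\<close>
  is attained at \<open>f x\<close>.\<close>

lemma pairing_psh_dir:
  assumes X: "qcategory Q X" and Y: "qcategory Q Y" and f: "qfunctor Q X Y f"
    and s: "\<sigma> \<in> presheaves Q X" and t: "\<tau> \<in> copresheaves Q Y"
  shows "pairing Y (psh_dir Q X Y f \<sigma>) \<tau> = pairing X \<sigma> (cop_inv Q X Y f \<tau>)"
proof (rule leq_antisym)
  note d = psh_dir_in_presheaves[OF X Y f s] and i = cop_inv_in_copresheaves[OF X Y f t]
  have P: "arr (fst \<tau>) (fst \<sigma>) (pairing X \<sigma> (cop_inv Q X Y f \<tau>))"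
    using pairing_arr[OF X s i] t by simp
  have "pv \<sigma> x \<bullet> hm Y y (f x) \<bullet> cv \<tau> y \<preceq>\<^bsub>fst \<tau>,fst \<sigma>\<^esub> pairing X \<sigma> (cop_inv Q X Y f \<tau>)"
    if x: "x \<in> carrier X" and y: "y \<in> carrier Y" for x y
  proof -
    have "hm Y y (f x) \<bullet> cv \<tau> y \<preceq>\<^bsub>fst \<tau>,tp X x\<^esub> cv \<tau> (f x)"
      using copresheaf_hm[OF Y t y qfunctor_closed[OF f x]] qfunctor_tp[OF f x] by simp
    from comp_mono_right[OF this presheaf_arr[OF X s x]]
    show ?thesis
      using leq_trans pairing_upper[OF X s i x] t by (simp add: cv_cop_inv[OF X Y f t x])
  qed
  then have "pv (psh_dir Q X Y f \<sigma>) y \<bullet> cv \<tau> y \<preceq>\<^bsub>fst \<tau>,fst \<sigma>\<^esub> pairing X \<sigma> (cop_inv Q X Y f \<tau>)"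
    if y: "y \<in> carrier Y" for y
    using pv_psh_dir_comp_leq_iff[OF X Y f s y copresheaf_arr[OF Y t y]] y P by blast
  then show "pairing Y (psh_dir Q X Y f \<sigma>) \<tau> \<preceq>\<^bsub>fst \<tau>,fst \<sigma>\<^esub> pairing X \<sigma> (cop_inv Q X Y f \<tau>)"
    using pairing_leq_iff[OF Y d t] s P by simp
  have "pv \<sigma> x \<bullet> cv \<tau> (f x) \<preceq>\<^bsub>fst \<tau>,fst \<sigma>\<^esub> pairing Y (psh_dir Q X Y f \<sigma>) \<tau>"
    if x: "x \<in> carrier X" for x
  proof -
    note fx = qfunctor_closed[OF f x] qfunctor_tp[OF f x]
    have c: "arr (fst \<tau>) (tp X x) (cv \<tau> (f x))" using copresheaf_arr[OF Y t fx(1)] fx(2) by simp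
    have "pv \<sigma> x \<preceq>\<^bsub>tp X x,fst \<sigma>\<^esub> pv \<sigma> x \<bullet> hm Y (f x) (f x)"
      by (rule leq_comp_hm_f_refl(1)[OF X Y f x presheaf_arr[OF X s x]])
    also have "\<dots> \<preceq>\<^bsub>tp X x,fst \<sigma>\<^esub> pv (psh_dir Q X Y f \<sigma>) (f x)"
      using pv_psh_dir_upper[OF X Y f s fx(1) x] fx(2) by simp
    finally have "pv \<sigma> x \<bullet> cv \<tau> (f x) \<preceq>\<^bsub>fst \<tau>,fst \<sigma>\<^esub> pv (psh_dir Q X Y f \<sigma>) (f x) \<bullet> cv \<tau> (f x)"
      by (rule comp_mono_left[OF _ c])
    also have "\<dots> \<preceq>\<^bsub>fst \<tau>,fst \<sigma>\<^esub> pairing Y (psh_dir Q X Y f \<sigma>) \<tau>"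
      using pairing_upper[OF Y d t fx(1)] s by simp
    finally show ?thesis .
  qed
  then show "pairing X \<sigma> (cop_inv Q X Y f \<tau>) \<preceq>\<^bsub>fst \<tau>,fst \<sigma>\<^esub> pairing Y (psh_dir Q X Y f \<sigma>) \<tau>"
    using pairing_leq_iff[OF X s i] t s pairing_arr[OF Y d t] by (simp add: cv_cop_inv[OF X Y f t])
qed

text \<open>Likewise, both sides are the supremum over \<open>x\<close> and \<open>y\<close> of \<open>\<sigma>(y) \<circ> hom(fx, y) \<circ> \<tau>(x)\<close>.\<close>

lemma pairing_cop_dir:
  assumes X: "qcategory Q X" and Y: "qcategory Q Y" and f: "qfunctor Q X Y f"
    and s: "\<sigma> \<in> presheaves Q Y" and t: "\<tau> \<in> copresheaves Q X"
  shows "pairing Y \<sigma> (cop_dir Q X Y f \<tau>) = pairing X (psh_inv Q X Y f \<sigma>) \<tau>"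
proof (rule leq_antisym)
  note d = cop_dir_in_copresheaves[OF X Y f t] and i = psh_inv_in_presheaves[OF X Y f s]
  have P: "arr (fst \<tau>) (fst \<sigma>) (pairing X (psh_inv Q X Y f \<sigma>) \<tau>)"
    using pairing_arr[OF X i t] s by simp
  have "pv \<sigma> y \<bullet> hm Y (f x) y \<bullet> cv \<tau> x \<preceq>\<^bsub>fst \<tau>,fst \<sigma>\<^esub> pairing X (psh_inv Q X Y f \<sigma>) \<tau>"
    if x: "x \<in> carrier X" and y: "y \<in> carrier Y" for x y
  proof -
    have "pv \<sigma> y \<bullet> hm Y (f x) y \<preceq>\<^bsub>tp X x,fst \<sigma>\<^esub> pv \<sigma> (f x)"
      using presheaf_hm[OF Y s qfunctor_closed[OF f x] y] qfunctor_tp[OF f x] by simp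
    from comp_mono_left[OF this copresheaf_arr[OF X t x]]
    have "pv \<sigma> y \<bullet> hm Y (f x) y \<bullet> cv \<tau> x \<preceq>\<^bsub>fst \<tau>,fst \<sigma>\<^esub> pv \<sigma> (f x) \<bullet> cv \<tau> x"
      using cmp_assoc[OF copresheaf_arr[OF X t x] hm_f_arr(1)[OF X Y f x y] presheaf_arr[OF Y s y]] by simp
    then show ?thesis
      using leq_trans pairing_upper[OF X i t x] s by (simp add: pv_psh_inv[OF X Y f s x])
  qed
  then have "pv \<sigma> y \<bullet> cv (cop_dir Q X Y f \<tau>) y \<preceq>\<^bsub>fst \<tau>,fst \<sigma>\<^esub> pairing X (psh_inv Q X Y f \<sigma>) \<tau>"
    if y: "y \<in> carrier Y" for y
    using comp_cv_cop_dir_leq_iff[OF X Y f t y presheaf_arr[OF Y s y]] y P by blast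
  then show "pairing Y \<sigma> (cop_dir Q X Y f \<tau>) \<preceq>\<^bsub>fst \<tau>,fst \<sigma>\<^esub> pairing X (psh_inv Q X Y f \<sigma>) \<tau>"
    using pairing_leq_iff[OF Y s d] t P by simp
  have "pv \<sigma> (f x) \<bullet> cv \<tau> x \<preceq>\<^bsub>fst \<tau>,fst \<sigma>\<^esub> pairing Y \<sigma> (cop_dir Q X Y f \<tau>)"
    if x: "x \<in> carrier X" for x
  proof -
    note fx = qfunctor_closed[OF f x] qfunctor_tp[OF f x]
    have c: "arr (tp X x) (fst \<sigma>) (pv \<sigma> (f x))" using presheaf_arr[OF Y s fx(1)] fx(2) by simp
    have "cv \<tau> x \<preceq>\<^bsub>fst \<tau>,tp X x\<^esub> hm Y (f x) (f x) \<bullet> cv \<tau> x"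
      by (rule leq_comp_hm_f_refl(2)[OF X Y f x copresheaf_arr[OF X t x]])
    also have "\<dots> \<preceq>\<^bsub>fst \<tau>,tp X x\<^esub> cv (cop_dir Q X Y f \<tau>) (f x)"
      using cv_cop_dir_upper[OF X Y f t fx(1) x] fx(2) by simp
    finally have "pv \<sigma> (f x) \<bullet> cv \<tau> x \<preceq>\<^bsub>fst \<tau>,fst \<sigma>\<^esub> pv \<sigma> (f x) \<bullet> cv (cop_dir Q X Y f \<tau>) (f x)"
      by (rule comp_mono_right[OF _ c])
    also have "\<dots> \<preceq>\<^bsub>fst \<tau>,fst \<sigma>\<^esub> pairing Y \<sigma> (cop_dir Q X Y f \<tau>)"
      using pairing_upper[OF Y s d fx(1)] t by simp
    finally show ?thesis .
  qed
  then show "pairing X (psh_inv Q X Y f \<sigma>) \<tau> \<preceq>\<^bsub>fst \<tau>,fst \<sigma>\<^esub> pairing Y \<sigma> (cop_dir Q X Y f \<tau>)"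
    using pairing_leq_iff[OF X i t] t s pairing_arr[OF Y s d] by (simp add: pv_psh_inv[OF X Y f s])
qed

lemma ycop_in_copresheaves:
  "qcategory Q X \<Longrightarrow> \<tau> \<in> copresheaves Q X \<Longrightarrow> ycop X \<tau> \<in> copresheaves Q (Psh Q X)"
  by (rule cop_dir_in_copresheaves[OF _ qcategory_Psh qfunctor_yo])

section \<open>The distributive law\<close>

lemma qfunctor_lam_dag:
  assumes X: "qcategory Q X"
  shows "qfunctor Q (Cop Q (Psh Q X)) (Psh Q (Cop Q X)) (lam_dag Q X)"
proof -
  note PX = qcategory_Psh[OF X]
  note CX = qcategory_Cop[OF X] and CPX = qcategory_Cop[OF PX]
  show ?thesis unfolding lam_dag_def
    by (rule qfunctor_transp[OF CX CPX distributor_graph[OF CX CPX qfunctor_cop_dir[OF X PX qfunctor_yo[OF X]]]])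
qed

context
  fixes X :: "('a, 'o, 'm) qcat" assumes X: "qcategory Q X"
begin

lemma lam_dag_in_presheaves:
  "T \<in> copresheaves Q (Psh Q X) \<Longrightarrow> lam_dag Q X T \<in> presheaves Q (Cop Q X)"
  using qfunctor_closed[OF qfunctor_lam_dag[OF X], of T] by simp

lemma fst_lam_dag: "T \<in> copresheaves Q (Psh Q X) \<Longrightarrow> fst (lam_dag Q X T) = fst T"
  by (simp add: lam_dag_def)

lemma pv_lam_dag:
  "T \<in> copresheaves Q (Psh Q X) \<Longrightarrow> \<tau> \<in> copresheaves Q X \<Longrightarrow>
    pv (lam_dag Q X T) \<tau> = hm (Cop Q (Psh Q X)) (ycop X \<tau>) T"
  by (simp add: lam_dag_def)

text \<open>The adjunction moves the functor \<open>g\<close> away from \<open>T\<close>: at \<open>a\<close>, the first argument of the hom on the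
  right is the pairing of \<open>g a\<close> with \<open>\<tau>\<close>.\<close>

lemma pv_lam_dag_cop_dir:
  assumes A: "qcategory Q A" and g: "qfunctor Q A (Psh Q X) g" and T: "T \<in> copresheaves Q A"
    and t: "\<tau> \<in> copresheaves Q X"
  shows "pv (lam_dag Q X (cop_dir Q A (Psh Q X) g T)) \<tau>
    = hm (Cop Q A) (cop_inv Q A (Psh Q X) g (ycop X \<tau>)) T"
  using pv_lam_dag[OF cop_dir_in_copresheaves[OF A qcategory_Psh[OF X] g T] t]
    hm_cop_inv_adjoint[OF A qcategory_Psh[OF X] g T ycop_in_copresheaves[OF X t]] by simp

text \<open>The multiplication of \<open>\<P>\<^sup>\<dagger>\<close> is right adjoint to the co-Yoneda embedding of \<open>\<P>\<^sup>\<dagger>X\<close>: this monad is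
  lax-idempotent. A bound at the representables extends to all \<open>\<tau>'\<close> because
  \<open>\<tau>'(x) \<circ> \<theta>(\<tau>') \<preceq> \<theta>(y\<^sup>\<dagger>x)\<close>.\<close>

lemma hm_cop_mult:
  assumes t: "\<tau> \<in> copresheaves Q X" and th: "\<theta> \<in> copresheaves Q (Cop Q X)"
  shows "hm (Cop Q X) \<tau> (cop_mult Q X \<theta>) = hm (Cop Q (Cop Q X)) (coyo Q (Cop Q X) \<tau>) \<theta>"
proof -
  note CX = qcategory_Cop[OF X] and cy = qfunctor_coyo[OF X]
  have t': "\<tau> \<in> carrier (Cop Q X)" using t by simp
  note y = coyo_in_copresheaves[OF CX t']
  have m: "cop_mult Q X \<theta> \<in> copresheaves Q X"
    unfolding cop_mult_def by (rule cop_inv_in_copresheaves[OF X CX cy th])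
  have cm: "cv (cop_mult Q X \<theta>) x = cv \<theta> (coyo Q X x)" if "x \<in> carrier X" for x
    unfolding cop_mult_def by (rule cv_cop_inv[OF X CX cy th that])
  have fm: "fst (cop_mult Q X \<theta>) = fst \<theta>" using th by (simp add: cop_mult_def)
  show ?thesis
  proof (rule leq_antisym)
    let ?u = "hm (Cop Q X) \<tau> (cop_mult Q X \<theta>)"
    have u: "arr (fst \<tau>) (fst \<theta>) ?u" using hm_Cop_arr[OF X t m] fm by simp
    have "cv \<theta> \<tau>' \<bullet> ?u \<preceq>\<^bsub>fst \<tau>,fst \<tau>'\<^esub> hm (Cop Q X) \<tau> \<tau>'" if t'': "\<tau>' \<in> copresheaves Q X" for \<tau>'
    proof -
      have a: "arr (fst \<theta>) (fst \<tau>') (cv \<theta> \<tau>')" using copresheaf_arr[OF CX th, of \<tau>'] t'' by simp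
      have "cv \<tau>' x \<bullet> cv \<theta> \<tau>' \<bullet> ?u \<preceq>\<^bsub>fst \<tau>,tp X x\<^esub> cv \<tau> x" if x: "x \<in> carrier X" for x
      proof -
        note yx = coyo_in_copresheaves[OF X x]
        have "cv \<tau>' x \<bullet> cv \<theta> \<tau>' \<preceq>\<^bsub>fst \<theta>,tp X x\<^esub> cv \<theta> (coyo Q X x)"
          using copresheaf_hm[OF CX th, of \<tau>' "coyo Q X x"] t'' yx x by (simp add: coyoneda[OF X t'' x])
        from comp_mono_left[OF this u]
        have "cv \<tau>' x \<bullet> cv \<theta> \<tau>' \<bullet> ?u \<preceq>\<^bsub>fst \<tau>,tp X x\<^esub> cv \<theta> (coyo Q X x) \<bullet> ?u"
          using cmp_assoc[OF u a copresheaf_arr[OF X t'' x]] by simp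
        also have "\<dots> \<preceq>\<^bsub>fst \<tau>,tp X x\<^esub> cv \<tau> x"
          using hm_Cop_comp[OF X t m x] cm[OF x] by simp
        finally show ?thesis .
      qed
      then show ?thesis using leq_hm_Cop_iff[OF X t t''] arr_comp[OF u a] by blast
    qed
    then show "?u \<preceq>\<^bsub>fst \<tau>,fst \<theta>\<^esub> hm (Cop Q (Cop Q X)) (coyo Q (Cop Q X) \<tau>) \<theta>"
      using leq_hm_Cop_iff[OF CX y th, of ?u] u t by simp
    let ?v = "hm (Cop Q (Cop Q X)) (coyo Q (Cop Q X) \<tau>) \<theta>"
    have v: "arr (fst \<tau>) (fst \<theta>) ?v" using hm_Cop_arr[OF CX y th] t by simp
    have "cv (cop_mult Q X \<theta>) x \<bullet> ?v \<preceq>\<^bsub>fst \<tau>,tp X x\<^esub> cv \<tau> x" if x: "x \<in> carrier X" for x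
    proof -
      note yx = coyo_in_copresheaves[OF X x]
      show ?thesis
        using hm_Cop_comp[OF CX y th, of "coyo Q X x"] yx t x by (simp add: cm coyoneda[OF X t x])
    qed
    then show "?v \<preceq>\<^bsub>fst \<tau>,fst \<theta>\<^esub> ?u"
      using leq_hm_Cop_iff[OF X t m, of ?v] v fm by simp
  qed
qed

lemma lam_dag_composite_eq:
  assumes T: "T \<in> copresheaves Q (Psh Q X)"
  shows "lam_dag Q X T = lam_dag_composite Q X T"
proof -
  note PX = qcategory_Psh[OF X]
  note CX = qcategory_Cop[OF X] and CPX = qcategory_Cop[OF PX]
  note yf = qfunctor_cop_dir[OF X PX qfunctor_yo[OF X]]
  have T': "T \<in> carrier (Cop Q (Psh Q X))" using T by simp
  note y = yo_in_presheaves[OF CPX T']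
  show ?thesis
  proof (rule presheaf_eqI[OF CX lam_dag_in_presheaves[OF T]])
    show "lam_dag_composite Q X T \<in> presheaves Q (Cop Q X)"
      using psh_inv_in_presheaves[OF CX CPX yf y] by (simp add: lam_dag_composite_def)
    show "fst (lam_dag Q X T) = fst (lam_dag_composite Q X T)"
      using T y by (simp add: lam_dag_composite_def fst_lam_dag)
    fix \<tau> assume t: "\<tau> \<in> carrier (Cop Q X)"
    show "pv (lam_dag Q X T) \<tau> = pv (lam_dag_composite Q X T) \<tau>"
      using T t pv_psh_inv[OF CX CPX yf y t] ycop_in_copresheaves[OF X, of \<tau>]
      by (simp add: lam_dag_composite_def pv_lam_dag)
  qed
qed

text \<open>Both sides at \<open>\<tau>\<close> are homs into \<open>T\<close>, from the copresheaf \<open>\<sigma> \<mapsto> \<sigma> \<cdot> (\<tau> f)\<close> on the left and from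
  \<open>\<sigma> \<mapsto> f\<^sub>!\<sigma> \<cdot> \<tau>\<close> on the right.\<close>

lemma lam_dag_natural:
  assumes Y: "qcategory Q Y" and f: "qfunctor Q X Y f" and T: "T \<in> copresheaves Q (Psh Q X)"
  shows "psh_dir Q (Cop Q X) (Cop Q Y) (cop_dir Q X Y f) (lam_dag Q X T)
    = lam_dag Q Y (cop_dir Q (Psh Q X) (Psh Q Y) (psh_dir Q X Y f) T)"
proof -
  note PX = qcategory_Psh[OF X] and PY = qcategory_Psh[OF Y]
  note CX = qcategory_Cop[OF X] and CY = qcategory_Cop[OF Y]
  note pf = qfunctor_psh_dir[OF X Y f] and cf = qfunctor_cop_dir[OF X Y f]
  note lT = lam_dag_in_presheaves[OF T] and dT = cop_dir_in_copresheaves[OF PX PY pf T]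
  show ?thesis
  proof (rule presheaf_eqI[OF CY psh_dir_in_presheaves[OF CX CY cf lT]])
    show "lam_dag Q Y (cop_dir Q (Psh Q X) (Psh Q Y) (psh_dir Q X Y f) T) \<in> presheaves Q (Cop Q Y)"
      using qfunctor_closed[OF qfunctor_lam_dag[OF Y]] dT by simp
    show "fst (psh_dir Q (Cop Q X) (Cop Q Y) (cop_dir Q X Y f) (lam_dag Q X T))
      = fst (lam_dag Q Y (cop_dir Q (Psh Q X) (Psh Q Y) (psh_dir Q X Y f) T))"
      using lT dT T by (simp add: fst_lam_dag lam_dag_def)
    fix \<tau> assume "\<tau> \<in> carrier (Cop Q Y)"
    then have t: "\<tau> \<in> copresheaves Q Y" by simp
    note i = cop_inv_in_copresheaves[OF X Y f t] and yt = ycop_in_copresheaves[OF Y t]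
    have "pv (psh_dir Q (Cop Q X) (Cop Q Y) (cop_dir Q X Y f) (lam_dag Q X T)) \<tau>
      = pv (lam_dag Q X T) (cop_inv Q X Y f \<tau>)"
      by (rule pv_psh_dir_left_adjoint[OF CX CY cf lT])
         (use t i hm_cop_inv_adjoint[OF X Y f _ t] in auto)
    also have "\<dots> = hm (Cop Q (Psh Q X)) (ycop X (cop_inv Q X Y f \<tau>)) T"
      by (rule pv_lam_dag[OF T i])
    also have "ycop X (cop_inv Q X Y f \<tau>) = cop_inv Q (Psh Q X) (Psh Q Y) (psh_dir Q X Y f) (ycop Y \<tau>)"
      by (rule copresheaf_eqI[OF PX ycop_in_copresheaves[OF X i] cop_inv_in_copresheaves[OF PX PY pf yt]])
         (use t i yt cv_cop_inv[OF PX PY pf yt] pairing_psh_dir[OF X Y f _ t] in auto)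
    also have "hm (Cop Q (Psh Q X)) \<dots> T = hm (Cop Q (Psh Q Y)) (ycop Y \<tau>) (cop_dir Q (Psh Q X) (Psh Q Y) (psh_dir Q X Y f) T)"
      by (rule hm_cop_inv_adjoint[OF PX PY pf T yt])
    also have "\<dots> = pv (lam_dag Q Y (cop_dir Q (Psh Q X) (Psh Q Y) (psh_dir Q X Y f) T)) \<tau>"
      using dT t by (simp add: lam_dag_def)
    finally show "pv (psh_dir Q (Cop Q X) (Cop Q Y) (cop_dir Q X Y f) (lam_dag Q X T)) \<tau>
      = pv (lam_dag Q Y (cop_dir Q (Psh Q X) (Psh Q Y) (psh_dir Q X Y f) T)) \<tau>" .
  qed
qed

text \<open>At \<open>\<rho>\<close>, the right side is the hom from \<open>x \<mapsto> y(x) \<cdot> \<rho> = \<rho>(x)\<close> to \<open>\<tau>\<close>.\<close>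

lemma lam_dag_psh_unit:
  assumes t: "\<tau> \<in> copresheaves Q X"
  shows "yo Q (Cop Q X) \<tau> = lam_dag Q X (ycop X \<tau>)"
proof -
  note PX = qcategory_Psh[OF X] and CX = qcategory_Cop[OF X] and y = qfunctor_yo[OF X]
  have t': "\<tau> \<in> carrier (Cop Q X)" using t by simp
  note yt = ycop_in_copresheaves[OF X t]
  show ?thesis
  proof (rule presheaf_eqI[OF CX yo_in_presheaves[OF CX t'] lam_dag_in_presheaves[OF yt]])
    show "fst (yo Q (Cop Q X) \<tau>) = fst (lam_dag Q X (ycop X \<tau>))"
      using t yt by (simp add: fst_lam_dag)
    fix \<rho> assume "\<rho> \<in> carrier (Cop Q X)"
    then have r: "\<rho> \<in> copresheaves Q X" by simp
    note yr = ycop_in_copresheaves[OF X r]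
    \<comment> \<open>the values of the left side are the pairings of \<open>\<rho>\<close> with representables\<close>
    have "cop_inv Q X (Psh Q X) (yo Q X) (ycop X \<rho>) = \<rho>"
      by (rule copresheaf_eqI[OF X cop_inv_in_copresheaves[OF X PX y yr] r])
         (use r yr in \<open>auto simp: cv_cop_inv[OF X PX y yr] pairing_yo[OF X r]\<close>)
    then show "pv (yo Q (Cop Q X) \<tau>) \<rho> = pv (lam_dag Q X (ycop X \<tau>)) \<rho>"
      using pv_lam_dag_cop_dir[OF X y t r] t r by simp
  qed
qed

lemma pv_psh_mult:
  assumes "\<Sigma> \<in> presheaves Q (Psh Q X)" "x \<in> carrier X"
  shows "pv (psh_mult Q X \<Sigma>) x = pv \<Sigma> (yo Q X x)"
  unfolding psh_mult_def by (rule pv_psh_inv[OF X qcategory_Psh[OF X] qfunctor_yo[OF X] assms])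

lemma psh_mult_in_presheaves:
  "\<Sigma> \<in> presheaves Q (Psh Q X) \<Longrightarrow> psh_mult Q X \<Sigma> \<in> presheaves Q X"
  unfolding psh_mult_def by (rule psh_inv_in_presheaves[OF X qcategory_Psh[OF X] qfunctor_yo[OF X]])

lemma fst_psh_mult: "\<Sigma> \<in> presheaves Q (Psh Q X) \<Longrightarrow> fst (psh_mult Q X \<Sigma>) = fst \<Sigma>"
  by (simp add: psh_mult_def)

lemma qfunctor_psh_mult: "qfunctor Q (Psh Q (Psh Q X)) (Psh Q X) (psh_mult Q X)"
  unfolding psh_mult_def by (rule qfunctor_psh_inv[OF X qcategory_Psh[OF X] qfunctor_yo[OF X]])

lemma cv_cop_mult:
  assumes "\<theta> \<in> copresheaves Q (Cop Q X)" "x \<in> carrier X"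
  shows "cv (cop_mult Q X \<theta>) x = cv \<theta> (coyo Q X x)"
  unfolding cop_mult_def by (rule cv_cop_inv[OF X qcategory_Cop[OF X] qfunctor_coyo[OF X] assms])

lemma cop_mult_in_copresheaves:
  "\<theta> \<in> copresheaves Q (Cop Q X) \<Longrightarrow> cop_mult Q X \<theta> \<in> copresheaves Q X"
  unfolding cop_mult_def by (rule cop_inv_in_copresheaves[OF X qcategory_Cop[OF X] qfunctor_coyo[OF X]])

lemma fst_cop_mult: "\<theta> \<in> copresheaves Q (Cop Q X) \<Longrightarrow> fst (cop_mult Q X \<theta>) = fst \<theta>"
  by (simp add: cop_mult_def)

lemma qfunctor_cop_mult: "qfunctor Q (Cop Q (Cop Q X)) (Cop Q X) (cop_mult Q X)"
  unfolding cop_mult_def by (rule qfunctor_cop_inv[OF X qcategory_Cop[OF X] qfunctor_coyo[OF X]])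

text \<open>Both sides at \<open>\<tau>\<close> are the pairing of \<open>\<sigma>\<close> with \<open>\<tau>\<close>.\<close>

lemma lam_dag_cop_unit:
  assumes s: "\<sigma> \<in> presheaves Q X"
  shows "psh_dir Q X (Cop Q X) (coyo Q X) \<sigma> = lam_dag Q X (coyo Q (Psh Q X) \<sigma>)"
proof -
  note PX = qcategory_Psh[OF X] and CX = qcategory_Cop[OF X] and y = qfunctor_coyo[OF X]
  have s': "\<sigma> \<in> carrier (Psh Q X)" using s by simp
  note cs = coyo_in_copresheaves[OF PX s'] and d = psh_dir_in_presheaves[OF X CX y s]
  show ?thesis
  proof (rule presheaf_eqI[OF CX d lam_dag_in_presheaves[OF cs]])
    show "fst (psh_dir Q X (Cop Q X) (coyo Q X) \<sigma>) = fst (lam_dag Q X (coyo Q (Psh Q X) \<sigma>))"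
      using s cs by (simp add: fst_lam_dag)
    fix \<tau> assume t': "\<tau> \<in> carrier (Cop Q X)"
    then have t: "\<tau> \<in> copresheaves Q X" by simp
    have "pv (psh_dir Q X (Cop Q X) (coyo Q X) \<sigma>) \<tau> = pairing X \<sigma> \<tau>"
      by (rule eq_if_same_upper_bounds[of "fst \<tau>" "fst \<sigma>"])
         (use pv_psh_dir_arr[OF X CX y s t'] pairing_arr[OF X s t] pv_psh_dir_leq_iff[OF X CX y s t']
            pairing_leq_iff[OF X s t] t in \<open>auto simp: coyoneda[OF X t]\<close>)
    also have "\<dots> = hm (Cop Q (Psh Q X)) (ycop X \<tau>) (coyo Q (Psh Q X) \<sigma>)"
      by (rule coyoneda[OF PX ycop_in_copresheaves[OF X t] s', symmetric])
    also have "\<dots> = pv (lam_dag Q X (coyo Q (Psh Q X) \<sigma>)) \<tau>"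
      by (rule pv_lam_dag[OF cs t, symmetric])
    finally show "pv (psh_dir Q X (Cop Q X) (coyo Q X) \<sigma>) \<tau> = pv (lam_dag Q X (coyo Q (Psh Q X) \<sigma>)) \<tau>" .
  qed
qed

end

text \<open>The equation \<open>hom(y\<tau>, \<lambda>T) = \<lambda>(T)(\<tau>) = hom(Y\<tau>, T)\<close> says that \<open>\<lambda>\<close> has a left adjoint at each
  representable \<open>y\<tau>\<close>, with value \<open>Y\<tau> = ycop X \<tau>\<close>. Both sides at \<open>\<tau>\<close> are then homs into \<open>T\<close>, from
  \<open>\<Sigma> \<mapsto> \<Sigma> \<cdot> Y\<tau>\<close> and from \<open>\<Sigma> \<mapsto> s\<Sigma> \<cdot> \<tau>\<close>, where \<open>s\<close> is inverse image along the Yoneda embedding.\<close>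

lemma lam_dag_psh_mult:
  assumes X: "qcategory Q X" and T: "T \<in> copresheaves Q (Psh Q (Psh Q X))"
  shows "psh_mult Q (Cop Q X) (psh_dir Q (Cop Q (Psh Q X)) (Psh Q (Cop Q X)) (lam_dag Q X) (lam_dag Q (Psh Q X) T))
    = lam_dag Q X (cop_dir Q (Psh Q (Psh Q X)) (Psh Q X) (psh_mult Q X) T)"
proof -
  note PX = qcategory_Psh[OF X] and CX = qcategory_Cop[OF X]
  note PPX = qcategory_Psh[OF PX] and CPX = qcategory_Cop[OF PX] and PCX = qcategory_Psh[OF CX]
  note L = qfunctor_lam_dag[OF X] and M = qfunctor_psh_mult[OF X]
  note lT = lam_dag_in_presheaves[OF PX T]
  note d = psh_dir_in_presheaves[OF CPX PCX L lT] and c = cop_dir_in_copresheaves[OF PPX PX M T]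
  show ?thesis
  proof (rule presheaf_eqI[OF CX psh_mult_in_presheaves[OF CX d] lam_dag_in_presheaves[OF X c]])
    show "fst (psh_mult Q (Cop Q X) (psh_dir Q (Cop Q (Psh Q X)) (Psh Q (Cop Q X)) (lam_dag Q X) (lam_dag Q (Psh Q X) T)))
      = fst (lam_dag Q X (cop_dir Q (Psh Q (Psh Q X)) (Psh Q X) (psh_mult Q X) T))"
      using d lT T c by (simp add: fst_psh_mult[OF CX] fst_lam_dag[OF X] fst_lam_dag[OF PX])
    fix \<tau> assume t': "\<tau> \<in> carrier (Cop Q X)"
    then have t: "\<tau> \<in> copresheaves Q X" by simp
    note yt = ycop_in_copresheaves[OF X t]
    note yyt = ycop_in_copresheaves[OF PX yt]
    note yo = yo_in_presheaves[OF CX t']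
    have "pv (psh_mult Q (Cop Q X) (psh_dir Q (Cop Q (Psh Q X)) (Psh Q (Cop Q X)) (lam_dag Q X) (lam_dag Q (Psh Q X) T))) \<tau>
      = pv (psh_dir Q (Cop Q (Psh Q X)) (Psh Q (Cop Q X)) (lam_dag Q X) (lam_dag Q (Psh Q X) T)) (yo Q (Cop Q X) \<tau>)"
      by (rule pv_psh_mult[OF CX d t'])
    also have "\<dots> = pv (lam_dag Q (Psh Q X) T) (ycop X \<tau>)"
      by (rule pv_psh_dir_left_adjoint[OF CPX PCX L lT])
         (use t yt yo yoneda[OF CX lam_dag_in_presheaves[OF X] t'] pv_lam_dag[OF X _ t] in auto)
    also have "\<dots> = hm (Cop Q (Psh Q (Psh Q X))) (ycop (Psh Q X) (ycop X \<tau>)) T"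
      by (rule pv_lam_dag[OF PX T yt])
    also have "ycop (Psh Q X) (ycop X \<tau>) = cop_inv Q (Psh Q (Psh Q X)) (Psh Q X) (psh_mult Q X) (ycop X \<tau>)"
      by (rule copresheaf_eqI[OF PPX yyt cop_inv_in_copresheaves[OF PPX PX M yt]])
         (use t yt pairing_cop_dir[OF X PX qfunctor_yo[OF X] _ t] cv_cop_inv[OF PPX PX M yt] in \<open>auto simp: psh_mult_def\<close>)
    also have "hm (Cop Q (Psh Q (Psh Q X))) \<dots> T = pv (lam_dag Q X (cop_dir Q (Psh Q (Psh Q X)) (Psh Q X) (psh_mult Q X) T)) \<tau>"
      by (rule pv_lam_dag_cop_dir[OF X PPX M T t, symmetric])
    finally show "pv (psh_mult Q (Cop Q X) (psh_dir Q (Cop Q (Psh Q X)) (Psh Q (Cop Q X)) (lam_dag Q X) (lam_dag Q (Psh Q X) T))) \<tau>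
      = pv (lam_dag Q X (cop_dir Q (Psh Q (Psh Q X)) (Psh Q X) (psh_mult Q X) T)) \<tau>" .
  qed
qed

text \<open>As the multiplication is right adjoint to the co-Yoneda embedding, the left side at \<open>\<tau>\<close> is a value
  at \<open>y\<^sup>\<dagger>\<tau>\<close>, namely the hom into \<open>T\<close> from \<open>S \<mapsto> \<lambda>(S) \<cdot> y\<^sup>\<dagger>\<tau> = \<lambda>(S)(\<tau>) = hom(Y\<tau>, S)\<close>. This is the
  representable copresheaf of \<open>Y\<tau>\<close>, and the same adjunction over \<open>\<P>X\<close> gives the right side.\<close>

lemma lam_dag_cop_mult:
  assumes X: "qcategory Q X" and T: "T \<in> copresheaves Q (Cop Q (Psh Q X))"
  shows "psh_dir Q (Cop Q (Cop Q X)) (Cop Q X) (cop_mult Q X)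
      (lam_dag Q (Cop Q X) (cop_dir Q (Cop Q (Psh Q X)) (Psh Q (Cop Q X)) (lam_dag Q X) T))
    = lam_dag Q X (cop_mult Q (Psh Q X) T)"
proof -
  note PX = qcategory_Psh[OF X] and CX = qcategory_Cop[OF X]
  note CCX = qcategory_Cop[OF CX] and CPX = qcategory_Cop[OF PX] and PCX = qcategory_Psh[OF CX]
  note L = qfunctor_lam_dag[OF X] and M = qfunctor_cop_mult[OF X]
  note c = cop_dir_in_copresheaves[OF CPX PCX L T]
  note l = lam_dag_in_presheaves[OF CX c]
  note d = psh_dir_in_presheaves[OF CCX CX M l] and m = cop_mult_in_copresheaves[OF PX T]
  show ?thesis
  proof (rule presheaf_eqI[OF CX d lam_dag_in_presheaves[OF X m]])
    show "fst (psh_dir Q (Cop Q (Cop Q X)) (Cop Q X) (cop_mult Q X)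
      (lam_dag Q (Cop Q X) (cop_dir Q (Cop Q (Psh Q X)) (Psh Q (Cop Q X)) (lam_dag Q X) T)))
      = fst (lam_dag Q X (cop_mult Q (Psh Q X) T))"
      using l c m T by (simp add: fst_lam_dag[OF X] fst_lam_dag[OF CX] fst_cop_mult[OF PX])
    fix \<tau> assume t': "\<tau> \<in> carrier (Cop Q X)"
    then have t: "\<tau> \<in> copresheaves Q X" by simp
    note yt = ycop_in_copresheaves[OF X t] and ct = coyo_in_copresheaves[OF CX t']
    have yt': "ycop X \<tau> \<in> carrier (Cop Q (Psh Q X))" using yt by simp
    note cyt = coyo_in_copresheaves[OF CPX yt'] and yct = ycop_in_copresheaves[OF CX ct]
    have "pv (psh_dir Q (Cop Q (Cop Q X)) (Cop Q X) (cop_mult Q X)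
        (lam_dag Q (Cop Q X) (cop_dir Q (Cop Q (Psh Q X)) (Psh Q (Cop Q X)) (lam_dag Q X) T))) \<tau>
      = pv (lam_dag Q (Cop Q X) (cop_dir Q (Cop Q (Psh Q X)) (Psh Q (Cop Q X)) (lam_dag Q X) T)) (coyo Q (Cop Q X) \<tau>)"
      by (rule pv_psh_dir_left_adjoint[OF CCX CX M l])
         (use t ct hm_cop_mult[OF X t] in auto)
    also have "\<dots> = hm (Cop Q (Cop Q (Psh Q X)))
        (cop_inv Q (Cop Q (Psh Q X)) (Psh Q (Cop Q X)) (lam_dag Q X) (ycop (Cop Q X) (coyo Q (Cop Q X) \<tau>))) T"
      by (rule pv_lam_dag_cop_dir[OF CX CPX L T ct])
    also have "cop_inv Q (Cop Q (Psh Q X)) (Psh Q (Cop Q X)) (lam_dag Q X) (ycop (Cop Q X) (coyo Q (Cop Q X) \<tau>))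
        = coyo Q (Cop Q (Psh Q X)) (ycop X \<tau>)"
    proof (rule copresheaf_eqI[OF CPX cop_inv_in_copresheaves[OF CPX PCX L yct] cyt])
      show "fst (cop_inv Q (Cop Q (Psh Q X)) (Psh Q (Cop Q X)) (lam_dag Q X) (ycop (Cop Q X) (coyo Q (Cop Q X) \<tau>)))
        = fst (coyo Q (Cop Q (Psh Q X)) (ycop X \<tau>))"
        using t yt ct yct by simp
      fix S assume S': "S \<in> carrier (Cop Q (Psh Q X))"
      then have S: "S \<in> copresheaves Q (Psh Q X)" by simp
      have "cv (cop_inv Q (Cop Q (Psh Q X)) (Psh Q (Cop Q X)) (lam_dag Q X) (ycop (Cop Q X) (coyo Q (Cop Q X) \<tau>))) S
         = pairing (Cop Q X) (lam_dag Q X S) (coyo Q (Cop Q X) \<tau>)"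
        by (rule cv_cop_inv[OF CPX PCX L yct S'])
      also have "\<dots> = pv (lam_dag Q X S) \<tau>"
        by (rule pairing_coyo[OF CX lam_dag_in_presheaves[OF X S] t'])
      also have "\<dots> = cv (coyo Q (Cop Q (Psh Q X)) (ycop X \<tau>)) S"
        using pv_lam_dag[OF X S t] S' yt' by simp
      finally show "cv (cop_inv Q (Cop Q (Psh Q X)) (Psh Q (Cop Q X)) (lam_dag Q X) (ycop (Cop Q X) (coyo Q (Cop Q X) \<tau>))) S
         = cv (coyo Q (Cop Q (Psh Q X)) (ycop X \<tau>)) S" .
    qed
    also have "hm (Cop Q (Cop Q (Psh Q X))) \<dots> T = hm (Cop Q (Psh Q X)) (ycop X \<tau>) (cop_mult Q (Psh Q X) T)"
      by (rule hm_cop_mult[OF PX yt T, symmetric])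
    also have "\<dots> = pv (lam_dag Q X (cop_mult Q (Psh Q X) T)) \<tau>"
      by (rule pv_lam_dag[OF X m t, symmetric])
    finally show "pv (psh_dir Q (Cop Q (Cop Q X)) (Cop Q X) (cop_mult Q X)
        (lam_dag Q (Cop Q X) (cop_dir Q (Cop Q (Psh Q X)) (Psh Q (Cop Q X)) (lam_dag Q X) T))) \<tau>
      = pv (lam_dag Q X (cop_mult Q (Psh Q X) T)) \<tau>" .
  qed
qed

lemma lam_dag_is_strict_law: "lam_dag_strict_law Q TYPE('a)"
  unfolding lam_dag_strict_law_def fun_eq_def
  by (auto simp: qfunctor_lam_dag lam_dag_natural lam_dag_psh_unit lam_dag_psh_mult lam_dag_cop_unit lam_dag_cop_mult)

section \<open>The underlying order and \<open>\<Q>\<close>-functors\<close>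

lemma obj_le_iff:
  "qcategory Q X \<Longrightarrow> x \<in> carrier X \<Longrightarrow> x' \<in> carrier X \<Longrightarrow>
    obj_le Q X x x' \<longleftrightarrow> tp X x = tp X x' \<and> idm Q (tp X x) \<preceq>\<^bsub>tp X x,tp X x\<^esub> hm X x x'"
  using hm_arr[of X x x'] by (auto simp: obj_le_def leq_def arr_id tp_obs)

lemma obj_le_refl: "qcategory Q X \<Longrightarrow> x \<in> carrier X \<Longrightarrow> obj_le Q X x x"
  by (simp add: obj_le_iff hm_refl)

lemma obj_le_trans:
  assumes X: "qcategory Q X" and x: "x \<in> carrier X" "y \<in> carrier X" "z \<in> carrier X"
    and le: "obj_le Q X x y" "obj_le Q X y z"
  shows "obj_le Q X x z"
proof -
  let ?r = "tp X x"
  have t: "tp X y = ?r" "tp X z = ?r" using le by (auto simp: obj_le_def)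
  have i: "idm Q ?r \<preceq>\<^bsub>?r,?r\<^esub> hm X x y" "idm Q ?r \<preceq>\<^bsub>?r,?r\<^esub> hm X y z"
    using le x t by (auto simp: obj_le_iff[OF X])
  have "idm Q ?r = idm Q ?r \<bullet> idm Q ?r" using comp_id(1)[OF arr_id[OF tp_obs[OF X x(1)]]] by simp
  also have "idm Q ?r \<bullet> idm Q ?r \<preceq>\<^bsub>?r,?r\<^esub> hm X y z \<bullet> hm X x y"
    by (rule comp_mono[OF i])
  also have "\<dots> \<preceq>\<^bsub>?r,?r\<^esub> hm X x z" using hm_trans[OF X x] t by simp
  finally show ?thesis using x t by (simp add: obj_le_iff[OF X])
qed

lemma qfunctor_obj_le:
  assumes X: "qcategory Q X" and Y: "qcategory Q Y" and f: "qfunctor Q X Y f"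
    and x: "x \<in> carrier X" "x' \<in> carrier X" and le: "obj_le Q X x x'"
  shows "obj_le Q Y (f x) (f x')"
  using qfunctor_closed[OF f x(1)] qfunctor_closed[OF f x(2)] x le leq_trans[OF _ qfunctor_hm[OF X Y f x]]
  by (auto simp: obj_le_iff[OF X] obj_le_iff[OF Y] qfunctor_tp[OF f])

lemma obj_le_Psh_iff:
  assumes X: "qcategory Q X" and s: "\<sigma> \<in> presheaves Q X" and s': "\<sigma>' \<in> presheaves Q X"
    and st: "fst \<sigma> = fst \<sigma>'"
  shows "obj_le Q (Psh Q X) \<sigma> \<sigma>' \<longleftrightarrow> (\<forall>x\<in>carrier X. pv \<sigma> x \<preceq>\<^bsub>tp X x,fst \<sigma>\<^esub> pv \<sigma>' x)"
  using leq_hm_Psh_iff[OF X s s', of "idm Q (fst \<sigma>)"] s s' st comp_id(2)[OF presheaf_arr[OF X s]]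
  by (simp add: obj_le_iff[OF qcategory_Psh[OF X]] arr_id presheaf_obs)

lemma qfunctor_id: "qcategory Q X \<Longrightarrow> qfunctor Q X X (\<lambda>x\<in>carrier X. x)"
  by (auto simp: qfunctor_iff leq_refl hm_arr)

lemma qfunctor_compose:
  assumes X: "qcategory Q X" and Y: "qcategory Q Y" and Z: "qcategory Q Z"
    and f: "qfunctor Q X Y f" and g: "qfunctor Q Y Z g"
  shows "qfunctor Q X Z (compose (carrier X) g f)"
proof -
  have "hm X x x' \<preceq>\<^bsub>tp X x,tp X x'\<^esub> hm Z (g (f x)) (g (f x'))" if x: "x \<in> carrier X" "x' \<in> carrier X" for x x'
    using leq_trans[OF qfunctor_hm[OF X Y f x]] qfunctor_hm[OF Y Z g, of "f x" "f x'"] x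
    by (simp add: qfunctor_closed[OF f] qfunctor_tp[OF f])
  then show ?thesis
    using qfunctor_closed[OF f] qfunctor_closed[OF g] qfunctor_tp[OF f] qfunctor_tp[OF g]
    by (auto simp: qfunctor_iff[OF X Z] compose_def)
qed

section \<open>Monads in \<open>\<Q>\<close>-Dist\<close>

lemma dist_monad_iff:
  "dist_monad Q X \<alpha> \<longleftrightarrow> qcategory Q X \<and> distributor Q X X \<alpha> \<and>
    (\<forall>x\<in>carrier X. \<forall>y\<in>carrier X. hm X x y \<preceq>\<^bsub>tp X x,tp X y\<^esub> \<alpha> x y) \<and>
    (\<forall>x\<in>carrier X. \<forall>y\<in>carrier X. \<forall>z\<in>carrier X. \<alpha> y z \<bullet> \<alpha> x y \<preceq>\<^bsub>tp X x,tp X z\<^esub> \<alpha> x z)"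
proof (cases "qcategory Q X \<and> distributor Q X X \<alpha>")
  case True
  then have X: "qcategory Q X" and d: "distributor Q X X \<alpha>" by auto
  have o: "\<forall>x\<in>carrier X. tp X x \<in> obs Q" and a: "\<alpha> \<in> qrel Q X X"
    using X d by (auto simp: tp_obs distributor_def)
  show ?thesis
    using X d rel_le_rel_comp_iff[OF o o o a a a] hm_arr[OF X] distributor_arr[OF X X d]
    by (auto simp: dist_monad_def rel_le_def[of Q X X "hm X"] leq_def)
qed (auto simp: dist_monad_def)

lemma monad_hom_iff:
  assumes X: "qcategory Q X" and Y: "qcategory Q Y"
    and a: "distributor Q X X \<alpha>" and b: "distributor Q Y Y \<beta>"
  shows "monad_hom Q (X, \<alpha>) (Y, \<beta>) f \<longleftrightarrow> qfunctor Q X Y f \<and>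
    (\<forall>x\<in>carrier X. \<forall>x'\<in>carrier X. \<alpha> x x' \<preceq>\<^bsub>tp X x,tp X x'\<^esub> \<beta> (f x) (f x'))"
proof (cases "qfunctor Q X Y f")
  case f: True
  have "obj_le Q (Psh Q Y) (psh_dir Q X Y f (transp X X \<alpha> x')) (transp Y Y \<beta> (f x')) \<longleftrightarrow>
    (\<forall>x\<in>carrier X. \<alpha> x x' \<preceq>\<^bsub>tp X x,tp X x'\<^esub> \<beta> (f x) (f x'))" if x': "x' \<in> carrier X" for x'
  proof -
    note fx' = qfunctor_closed[OF f x'] qfunctor_tp[OF f x']
    note ta = transp_in_presheaves[OF X X a x'] and tb = transp_in_presheaves[OF Y Y b fx'(1)]
    show ?thesis
      using obj_le_Psh_iff[OF Y psh_dir_in_presheaves[OF X Y f ta] tb] psh_dir_leq_iff[OF X Y f ta tb]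
        ta x' fx' qfunctor_closed[OF f] by simp
  qed
  then show ?thesis using f by (auto simp: monad_hom_def fun_le_def)
qed (auto simp: monad_hom_def)

lemma two_category_Mon_Dist:
  "two_category (Mon_Dist Q :: (('a, 'o, 'm) dist_mon, 'a \<Rightarrow> 'a) cat2)"
proof -
  have homD: "qfunctor Q (fst A) (fst B) f"
      "\<And>x x'. x \<in> carrier (fst A) \<Longrightarrow> x' \<in> carrier (fst A) \<Longrightarrow>
        snd A x x' \<preceq>\<^bsub>tp (fst A) x,tp (fst A) x'\<^esub> snd B (f x) (f x')"
    if "A \<in> obj2 (Mon_Dist Q)" "B \<in> obj2 (Mon_Dist Q)" "f \<in> hom2 (Mon_Dist Q) A B" for A B f
    using that monad_hom_iff[of "fst A" "fst B" "snd A" "snd B" f]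
    by (auto simp: Mon_Dist_def dist_monad_iff)
  have homI: "f \<in> hom2 (Mon_Dist Q) A B"
    if "A \<in> obj2 (Mon_Dist Q)" "B \<in> obj2 (Mon_Dist Q)" "qfunctor Q (fst A) (fst B) f"
      "\<And>x x'. x \<in> carrier (fst A) \<Longrightarrow> x' \<in> carrier (fst A) \<Longrightarrow>
        snd A x x' \<preceq>\<^bsub>tp (fst A) x,tp (fst A) x'\<^esub> snd B (f x) (f x')" for A B f
    using that monad_hom_iff[of "fst A" "fst B" "snd A" "snd B" f]
    by (auto simp: Mon_Dist_def dist_monad_iff)
  have cat: "qcategory Q (fst A)"
      and arr: "\<And>x x'. x \<in> carrier (fst A) \<Longrightarrow> x' \<in> carrier (fst A) \<Longrightarrow> arr (tp (fst A) x) (tp (fst A) x') (snd A x x')"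
    if "A \<in> obj2 (Mon_Dist Q)" for A
    using that distributor_arr by (auto simp: Mon_Dist_def dist_monad_iff)
  have fn: "f \<in> carrier (fst A) \<rightarrow>\<^sub>E carrier (fst B)"
    if "A \<in> obj2 (Mon_Dist Q)" "B \<in> obj2 (Mon_Dist Q)" "f \<in> hom2 (Mon_Dist Q) A B" for A B f
    using homD(1)[OF that] by (simp add: qfunctor_def)
  have simps: "id2 (Mon_Dist Q) A = (\<lambda>x\<in>carrier (fst A). x)"
      "cmp2 (Mon_Dist Q) A B C g f = compose (carrier (fst A)) g f"
      "le2 (Mon_Dist Q) A B f g \<longleftrightarrow> fun_le Q (fst A) (fst B) f g"
    for A B C :: "('a, 'o, 'm) dist_mon" and f g by (auto simp: Mon_Dist_def)
  show ?thesis
    unfolding two_category_def simps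
  proof (intro conjI ballI impI)
    fix A :: "('a, 'o, 'm) dist_mon" assume A: "A \<in> obj2 (Mon_Dist Q)"
    show "(\<lambda>x\<in>carrier (fst A). x) \<in> hom2 (Mon_Dist Q) A A"
      by (rule homI[OF A A qfunctor_id[OF cat[OF A]]]) (use arr[OF A] in \<open>auto simp: leq_refl\<close>)
    fix B :: "('a, 'o, 'm) dist_mon" and f assume B: "B \<in> obj2 (Mon_Dist Q)" and f: "f \<in> hom2 (Mon_Dist Q) A B"
    note fh = homD[OF A B f] and fE = fn[OF A B f]
    note fx = qfunctor_closed[OF fh(1)] qfunctor_tp[OF fh(1)]
    show "compose (carrier (fst A)) f (\<lambda>x\<in>carrier (fst A). x) = f"
      using fE by (auto intro!: compose_Id simp: PiE_iff)
    show "compose (carrier (fst A)) (\<lambda>x\<in>carrier (fst B). x) f = f"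
      using fE by (auto intro!: Id_compose simp: PiE_iff)
    show "fun_le Q (fst A) (fst B) f f"
      using fx obj_le_refl[OF cat[OF B]] by (auto simp: fun_le_def)
    {
      fix g h assume g: "g \<in> hom2 (Mon_Dist Q) A B" and h: "h \<in> hom2 (Mon_Dist Q) A B"
        and "fun_le Q (fst A) (fst B) f g \<and> fun_le Q (fst A) (fst B) g h"
      then show "fun_le Q (fst A) (fst B) f h"
        using fx qfunctor_closed[OF homD(1)[OF A B g]] qfunctor_closed[OF homD(1)[OF A B h]]
          obj_le_trans[OF cat[OF B]] unfolding fun_le_def by metis
    }
    fix C :: "('a, 'o, 'm) dist_mon" assume C: "C \<in> obj2 (Mon_Dist Q)"
    {
      fix g assume g: "g \<in> hom2 (Mon_Dist Q) B C"
      note gh = homD[OF B C g]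
      show "compose (carrier (fst A)) g f \<in> hom2 (Mon_Dist Q) A C"
      proof (rule homI[OF A C qfunctor_compose[OF cat[OF A] cat[OF B] cat[OF C] fh(1) gh(1)]])
        fix x x' assume x: "x \<in> carrier (fst A)" "x' \<in> carrier (fst A)"
        show "snd A x x' \<preceq>\<^bsub>tp (fst A) x,tp (fst A) x'\<^esub>
          snd C (compose (carrier (fst A)) g f x) (compose (carrier (fst A)) g f x')"
          using leq_trans[OF fh(2)[OF x]] gh(2)[of "f x" "f x'"] x fx by (simp add: compose_def)
      qed
      fix D :: "('a, 'o, 'm) dist_mon" and h assume "D \<in> obj2 (Mon_Dist Q)" "h \<in> hom2 (Mon_Dist Q) C D"
      show "compose (carrier (fst A)) h (compose (carrier (fst A)) g f)
        = compose (carrier (fst A)) (compose (carrier (fst B)) h g) f"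
        by (rule compose_assoc) (use fE in auto)
    }
    fix f' g g' assume f': "f' \<in> hom2 (Mon_Dist Q) A B" and g: "g \<in> hom2 (Mon_Dist Q) B C"
      and g': "g' \<in> hom2 (Mon_Dist Q) B C"
      and le: "fun_le Q (fst A) (fst B) f f' \<and> fun_le Q (fst B) (fst C) g g'"
    note f'x = qfunctor_closed[OF homD(1)[OF A B f']]
    note gh = homD(1)[OF B C g] and g'h = homD(1)[OF B C g']
    have "obj_le Q (fst C) (g (f x)) (g' (f' x))" if x: "x \<in> carrier (fst A)" for x
    proof (rule obj_le_trans[OF cat[OF C]])
      show "obj_le Q (fst C) (g (f x)) (g (f' x))"
        using le x by (intro qfunctor_obj_le[OF cat[OF B] cat[OF C] gh fx(1) f'x]) (auto simp: fun_le_def)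
      show "obj_le Q (fst C) (g (f' x)) (g' (f' x))"
        using le f'x[OF x] by (auto simp: fun_le_def)
    qed (use x fx f'x qfunctor_closed[OF gh] qfunctor_closed[OF g'h] in auto)
    then show "fun_le Q (fst A) (fst C) (compose (carrier (fst A)) g f) (compose (carrier (fst A)) g' f')"
      by (auto simp: fun_le_def compose_def)
  qed
qed

section \<open>Lax algebras\<close>

lemma cop_dir_coyo:
  assumes X: "qcategory Q X" and Y: "qcategory Q Y" and f: "qfunctor Q X Y f" and x: "x \<in> carrier X"
  shows "cop_dir Q X Y f (coyo Q X x) = coyo Q Y (f x)"
proof -
  note fx = qfunctor_closed[OF f] qfunctor_tp[OF f]
  note c = coyo_in_copresheaves[OF X x] and c' = coyo_in_copresheaves[OF Y fx(1)[OF x]]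
  note d = cop_dir_in_copresheaves[OF X Y f c]
  show ?thesis
  proof (rule copresheaf_eqI[OF Y d c'])
    show "fst (cop_dir Q X Y f (coyo Q X x)) = fst (coyo Q Y (f x))" using c x fx by simp
    fix y assume y: "y \<in> carrier Y"
    have "cv (cop_dir Q X Y f (coyo Q X x)) y = hm Y (f x) y"
    proof (rule leq_antisym[of _ "tp X x" "tp Y y"])
      have "hm Y (f z) y \<bullet> hm X x z \<preceq>\<^bsub>tp X x,tp Y y\<^esub> hm Y (f x) y" if z: "z \<in> carrier X" for z
        using distributor_graph[OF X Y f] x y z by (auto simp: distributor_iff[OF X Y])
      then show "cv (cop_dir Q X Y f (coyo Q X x)) y \<preceq>\<^bsub>tp X x,tp Y y\<^esub> hm Y (f x) y"
        using cv_cop_dir_leq_iff[OF X Y f c y, of "hm Y (f x) y"] x hm_f_arr(1)[OF X Y f x y] by simp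
      show "hm Y (f x) y \<preceq>\<^bsub>tp X x,tp Y y\<^esub> cv (cop_dir Q X Y f (coyo Q X x)) y"
        using leq_trans[OF leq_comp_hm_refl(1)[OF X x hm_f_arr(1)[OF X Y f x y]]]
          cv_cop_dir_upper[OF X Y f c y x] x by simp
    qed
    then show "cv (cop_dir Q X Y f (coyo Q X x)) y = cv (coyo Q Y (f x)) y" using x y fx by simp
  qed
qed

lemma cop_mult_coyo:
  assumes X: "qcategory Q X" and t: "\<tau> \<in> copresheaves Q X"
  shows "cop_mult Q X (coyo Q (Cop Q X) \<tau>) = \<tau>"
proof -
  have t': "\<tau> \<in> carrier (Cop Q X)" using t by simp
  note c = coyo_in_copresheaves[OF qcategory_Cop[OF X] t']
  show ?thesis
    by (rule copresheaf_eqI[OF X cop_mult_in_copresheaves[OF X c] t])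
       (use c t coyo_in_copresheaves[OF X] coyoneda[OF X t]
         in \<open>auto simp: fst_cop_mult[OF X] cv_cop_mult[OF X c]\<close>)
qed

lemma cop_mult_cop_dir_coyo:
  assumes X: "qcategory Q X" and t: "\<tau> \<in> copresheaves Q X"
  shows "cop_mult Q X (cop_dir Q X (Cop Q X) (coyo Q X) \<tau>) = \<tau>"
proof -
  let ?T = "cop_dir Q X (Cop Q X) (coyo Q X) \<tau>"
  note CX = qcategory_Cop[OF X] and cf = qfunctor_coyo[OF X] and c = coyo_in_copresheaves[OF X]
  note T = cop_dir_in_copresheaves[OF X CX cf t]
  show ?thesis
  proof (rule copresheaf_eqI[OF X cop_mult_in_copresheaves[OF X T] t])
    show "fst (cop_mult Q X ?T) = fst \<tau>" using T t by (simp add: fst_cop_mult[OF X])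
    fix z assume z: "z \<in> carrier X"
    have cz: "coyo Q X z \<in> carrier (Cop Q X)" using c[OF z] by simp
    have tz: "tp (Cop Q X) (coyo Q X z) = tp X z" using c[OF z] z by simp
    have hz: "hm (Cop Q X) (coyo Q X y) (coyo Q X z) = hm X y z" if y: "y \<in> carrier X" for y
      using coyoneda[OF X c[OF y] z] y z by simp
    have "cv ?T (coyo Q X z) = cv \<tau> z"
    proof (rule leq_antisym[of _ "fst \<tau>" "tp X z"])
      show "cv ?T (coyo Q X z) \<preceq>\<^bsub>fst \<tau>,tp X z\<^esub> cv \<tau> z"
        using cv_cop_dir_leq_iff[OF X CX cf t cz, of "cv \<tau> z"] tz copresheaf_arr[OF X t z]
          copresheaf_hm[OF X t _ z] by (simp add: hz)
      show "cv \<tau> z \<preceq>\<^bsub>fst \<tau>,tp X z\<^esub> cv ?T (coyo Q X z)"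
        using leq_trans[OF leq_comp_hm_refl(2)[OF X z copresheaf_arr[OF X t z]]]
          cv_cop_dir_upper[OF X CX cf t cz z] tz by (simp add: hz[OF z])
    qed
    then show "cv (cop_mult Q X ?T) z = cv \<tau> z" by (simp add: cv_cop_mult[OF X T z])
  qed
qed

text \<open>The multiplication axiom without suprema. At \<open>x\<close> its left side is the supremum over \<open>\<tau>\<close> of
  \<open>\<Sigma>(\<tau>) \<circ> p(\<tau>)(x)\<close>, where \<open>\<Sigma>\<close> is \<open>\<lambda>\<close> applied to the direct image of \<open>T\<close> along \<open>p\<close>; the arrows \<open>u\<close> are
  those below \<open>\<Sigma>(\<tau>)\<close>.\<close>

lemma lax_algebra_iff:
  assumes X: "qcategory Q X" and p: "qfunctor Q (Cop Q X) (Psh Q X) p"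
  shows "lax_algebra Q X p \<longleftrightarrow>
    (\<forall>x\<in>carrier X. idm Q (tp X x) \<preceq>\<^bsub>tp X x,tp X x\<^esub> pv (p (coyo Q X x)) x) \<and>
    (\<forall>T\<in>copresheaves Q (Cop Q X). \<forall>\<tau>\<in>copresheaves Q X. \<forall>u. arr (fst \<tau>) (fst T) u \<longrightarrow>
      (\<forall>\<rho>\<in>copresheaves Q X. cv T \<rho> \<bullet> u \<preceq>\<^bsub>fst \<tau>,fst \<rho>\<^esub> pairing X (p \<rho>) \<tau>) \<longrightarrow>
      (\<forall>x\<in>carrier X. u \<bullet> pv (p \<tau>) x \<preceq>\<^bsub>tp X x,fst T\<^esub> pv (p (cop_mult Q X T)) x))"
    (is "_ \<longleftrightarrow> ?unit \<and> ?mult")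
proof -
  note PX = qcategory_Psh[OF X] and CX = qcategory_Cop[OF X]
  note CCX = qcategory_Cop[OF CX] and CPX = qcategory_Cop[OF PX]
  have pc: "p \<tau> \<in> presheaves Q X" and fp: "fst (p \<tau>) = fst \<tau>" if "\<tau> \<in> copresheaves Q X" for \<tau>
    using qfunctor_closed[OF p, of \<tau>] qfunctor_tp[OF p, of \<tau>] that by auto
  have "obj_le Q (Psh Q X) (yo Q X x) (p (coyo Q X x)) \<longleftrightarrow>
      idm Q (tp X x) \<preceq>\<^bsub>tp X x,tp X x\<^esub> pv (p (coyo Q X x)) x" if x: "x \<in> carrier X" for x
  proof -
    note y = yo_in_presheaves[OF X x] and c = coyo_in_copresheaves[OF X x]
    show ?thesis using obj_le_iff[OF PX, of "yo Q X x" "p (coyo Q X x)"] y pc[OF c] fp[OF c] x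
      by (simp add: yoneda[OF X pc[OF c] x])
  qed
  then have unit: "fun_le Q X (Psh Q X) (yo Q X) (p \<circ> coyo Q X) \<longleftrightarrow> ?unit"
    by (auto simp: fun_le_def)
  have "obj_le Q (Psh Q X) (psh_mult Q X (psh_dir Q (Cop Q X) (Psh Q X) p (lam_dag Q X (cop_dir Q (Cop Q X) (Psh Q X) p T))))
      (p (cop_mult Q X T)) \<longleftrightarrow>
    (\<forall>\<tau>\<in>copresheaves Q X. \<forall>u. arr (fst \<tau>) (fst T) u \<longrightarrow>
      (\<forall>\<rho>\<in>copresheaves Q X. cv T \<rho> \<bullet> u \<preceq>\<^bsub>fst \<tau>,fst \<rho>\<^esub> pairing X (p \<rho>) \<tau>) \<longrightarrow>
      (\<forall>x\<in>carrier X. u \<bullet> pv (p \<tau>) x \<preceq>\<^bsub>tp X x,fst T\<^esub> pv (p (cop_mult Q X T)) x))"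
    (is "obj_le Q _ ?L ?R \<longleftrightarrow> ?C") if T: "T \<in> copresheaves Q (Cop Q X)" for T
  proof -
    let ?S = "lam_dag Q X (cop_dir Q (Cop Q X) (Psh Q X) p T)"
    note c = cop_dir_in_copresheaves[OF CX PX p T]
    note S = lam_dag_in_presheaves[OF X c]
    note d = psh_dir_in_presheaves[OF CX PX p S]
    note m = cop_mult_in_copresheaves[OF X T]
    have fS: "fst ?S = fst T" using c T by (simp add: fst_lam_dag[OF X])
    \<comment> \<open>the adjunction turns \<open>\<Sigma>(\<tau>)\<close> into the greatest \<open>u\<close> subject to the hypothesis of the axiom\<close>
    have leS: "u \<preceq>\<^bsub>fst \<tau>,fst T\<^esub> pv ?S \<tau> \<longleftrightarrow> arr (fst \<tau>) (fst T) u \<and>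
        (\<forall>\<rho>\<in>copresheaves Q X. cv T \<rho> \<bullet> u \<preceq>\<^bsub>fst \<tau>,fst \<rho>\<^esub> pairing X (p \<rho>) \<tau>)"
      if t: "\<tau> \<in> copresheaves Q X" for \<tau> u
    proof -
      note yt = ycop_in_copresheaves[OF X t]
      show ?thesis
        using leq_hm_cop_dir_iff[OF CX PX p T yt, of u] pv_lam_dag[OF X c t] t by simp
    qed
    have arS: "arr (fst \<tau>) (fst T) (pv ?S \<tau>)" if "\<tau> \<in> copresheaves Q X" for \<tau>
      using presheaf_arr[OF CX S, of \<tau>] that fS by simp
    have R: "?R \<in> presheaves Q X" "fst ?R = fst T"
      using pc[OF m] fp[OF m] fst_cop_mult[OF X T] by auto
    have L: "?L \<in> presheaves Q X" "fst ?L = fst T"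
      using psh_mult_in_presheaves[OF X d] fst_psh_mult[OF X d] S fS by auto
    have "obj_le Q (Psh Q X) ?L ?R \<longleftrightarrow> (\<forall>x\<in>carrier X. pv ?L x \<preceq>\<^bsub>tp X x,fst T\<^esub> pv ?R x)"
      using obj_le_Psh_iff[OF X L(1) R(1)] L R by simp
    also have "\<dots> \<longleftrightarrow> (\<forall>x\<in>carrier X. \<forall>\<tau>\<in>copresheaves Q X. pv ?S \<tau> \<bullet> pv (p \<tau>) x \<preceq>\<^bsub>tp X x,fst T\<^esub> pv ?R x)"
    proof -
      \<comment> \<open>\<open>s\<close> evaluates at the representable \<open>y(x)\<close>, and \<open>hom(y(x), p\<tau>) = p(\<tau>)(x)\<close>\<close>
      have "pv ?L x \<preceq>\<^bsub>tp X x,fst T\<^esub> pv ?R x \<longleftrightarrow>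
          (\<forall>\<tau>\<in>copresheaves Q X. pv ?S \<tau> \<bullet> pv (p \<tau>) x \<preceq>\<^bsub>tp X x,fst T\<^esub> pv ?R x)" if x: "x \<in> carrier X" for x
        using pv_psh_dir_leq_iff[OF CX PX p S, of "yo Q X x" "pv ?R x"] yo_in_presheaves[OF X x] x fS
          presheaf_arr[OF X R(1) x] R(2)
        by (simp add: pv_psh_mult[OF X d x] yoneda[OF X pc x])
      then show ?thesis by blast
    qed
    also have "\<dots> \<longleftrightarrow> ?C"
    proof safe
      fix \<tau> u x assume a: "\<forall>x\<in>carrier X. \<forall>\<tau>\<in>copresheaves Q X. pv ?S \<tau> \<bullet> pv (p \<tau>) x \<preceq>\<^bsub>tp X x,fst T\<^esub> pv ?R x"
        and t: "\<tau> \<in> copresheaves Q X" and u: "arr (fst \<tau>) (fst T) u"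
        and b: "\<forall>\<rho>\<in>copresheaves Q X. cv T \<rho> \<bullet> u \<preceq>\<^bsub>fst \<tau>,fst \<rho>\<^esub> pairing X (p \<rho>) \<tau>"
        and x: "x \<in> carrier X"
      have "u \<preceq>\<^bsub>fst \<tau>,fst T\<^esub> pv ?S \<tau>" using leS[OF t, of u] u b by blast
      from comp_mono_left[OF this] have "u \<bullet> pv (p \<tau>) x \<preceq>\<^bsub>tp X x,fst T\<^esub> pv ?S \<tau> \<bullet> pv (p \<tau>) x"
        using presheaf_arr[OF X pc[OF t] x] fp[OF t] by simp
      then show "u \<bullet> pv (p \<tau>) x \<preceq>\<^bsub>tp X x,fst T\<^esub> pv ?R x" using a t x leq_trans by blast
    next
      fix x \<tau> assume a: ?C and x: "x \<in> carrier X" and t: "\<tau> \<in> copresheaves Q X"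
      show "pv ?S \<tau> \<bullet> pv (p \<tau>) x \<preceq>\<^bsub>tp X x,fst T\<^esub> pv ?R x"
        using a x t leS[OF t, of "pv ?S \<tau>"] leq_refl[OF arS[OF t]] by blast
    qed
    finally show ?thesis .
  qed
  then have "fun_le Q (Cop Q (Cop Q X)) (Psh Q X)
       (psh_mult Q X \<circ> psh_dir Q (Cop Q X) (Psh Q X) p \<circ> lam_dag Q X
         \<circ> cop_dir Q (Cop Q X) (Psh Q X) p)
       (p \<circ> cop_mult Q X) \<longleftrightarrow> ?mult"
    by (simp add: fun_le_def)
  with unit show ?thesis using X p by (simp add: lax_algebra_def)
qed

text \<open>Functoriality of \<open>p\<close> at a point. For \<open>\<tau>' = y\<^sup>\<dagger>x'\<close> the hom on the left is \<open>\<tau>(x')\<close>.\<close>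

lemma qfunctor_Cop_Psh_act:
  assumes X: "qcategory Q X" and p: "qfunctor Q (Cop Q X) (Psh Q X) p"
    and t: "\<tau> \<in> copresheaves Q X" and t': "\<tau>' \<in> copresheaves Q X" and x: "x \<in> carrier X"
  shows "hm (Cop Q X) \<tau> \<tau>' \<bullet> pv (p \<tau>) x \<preceq>\<^bsub>tp X x,fst \<tau>'\<^esub> pv (p \<tau>') x"
proof -
  have p': "p \<rho> \<in> presheaves Q X" "fst (p \<rho>) = fst \<rho>" if "\<rho> \<in> copresheaves Q X" for \<rho>
    using qfunctor_closed[OF p, of \<rho>] qfunctor_tp[OF p, of \<rho>] that by auto
  have "hm (Cop Q X) \<tau> \<tau>' \<preceq>\<^bsub>fst (p \<tau>),fst (p \<tau>')\<^esub> hm (Psh Q X) (p \<tau>) (p \<tau>')"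
    using qfunctor_hm[OF qcategory_Cop[OF X] qcategory_Psh[OF X] p, of \<tau> \<tau>'] t t' p' by simp
  then show ?thesis
    using leq_hm_Psh_iff[OF X p'(1)[OF t] p'(1)[OF t'], of "hm (Cop Q X) \<tau> \<tau>'"] x p'(2)[OF t'] by simp
qed

definition monad_of_algebra :: "('a, 'o, 'm) qcat \<Rightarrow> (('a, 'o, 'm) copresheaf \<Rightarrow> ('a, 'o, 'm) presheaf) \<Rightarrow> 'a \<Rightarrow> 'a \<Rightarrow> 'm"
  where "monad_of_algebra X p = (\<lambda>x\<in>carrier X. \<lambda>x'\<in>carrier X. pv (p (coyo Q X x')) x)"

text \<open>At \<open>\<tau>\<close> and \<open>x\<close> this is the hom of \<open>\<P>\<^sup>\<dagger>X\<close> from \<open>\<alpha>(x, -)\<close> to \<open>\<tau>\<close>. In this form functoriality in \<open>\<tau>\<close>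
  and the presheaf property hold because graphs of functors are distributors.\<close>

definition algebra_of_monad :: "('a, 'o, 'm) qcat \<Rightarrow> ('a \<Rightarrow> 'a \<Rightarrow> 'm) \<Rightarrow> ('a, 'o, 'm) copresheaf \<Rightarrow> ('a, 'o, 'm) presheaf"
  where "algebra_of_monad X \<alpha> = transp X (Cop Q X) (graph X (Cop Q X) (cotransp X X \<alpha>))"

text \<open>The unit axiom reads \<open>1 \<preceq> \<alpha>(x, x)\<close>, and \<open>hom \<preceq> \<alpha>\<close> follows by the action. Transitivity is the
  multiplication axiom for \<open>T = y\<^sup>\<dagger>y\<^sup>\<dagger>z\<close>, \<open>\<tau> = y\<^sup>\<dagger>y\<close> and \<open>u = \<alpha>(y, z)\<close>.\<close>

lemma monad_of_algebra_dist_monad: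
  assumes "lax_algebra Q X p"
  shows "dist_monad Q X (monad_of_algebra X p)"
proof -
  have X: "qcategory Q X" and p: "qfunctor Q (Cop Q X) (Psh Q X) p" using assms by (auto simp: lax_algebra_def)
  note PX = qcategory_Psh[OF X] and CX = qcategory_Cop[OF X]
  note L = lax_algebra_iff[OF X p, THEN iffD1, OF assms]
  have pc: "p \<tau> \<in> presheaves Q X" and fp: "fst (p \<tau>) = fst \<tau>" if "\<tau> \<in> copresheaves Q X" for \<tau>
    using qfunctor_closed[OF p, of \<tau>] qfunctor_tp[OF p, of \<tau>] that by auto
  note c = coyo_in_copresheaves[OF X]
  let ?a = "monad_of_algebra X p"
  have a: "?a x y = pv (p (coyo Q X y)) x" if "x \<in> carrier X" "y \<in> carrier X" for x y
    using that by (simp add: monad_of_algebra_def)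
  have arr_a: "arr (tp X x) (tp X y) (?a x y)" if "x \<in> carrier X" "y \<in> carrier X" for x y
    using that presheaf_arr[OF X pc[OF c[OF that(2)]] that(1)] fp[OF c[OF that(2)]] by (simp add: a)
  note act = qfunctor_Cop_Psh_act[OF X p]
  have d1: "?a x' y \<bullet> hm X x x' \<preceq>\<^bsub>tp X x,tp X y\<^esub> ?a x y"
    if "x \<in> carrier X" "x' \<in> carrier X" "y \<in> carrier X" for x x' y
    using presheaf_hm[OF X pc[OF c[OF that(3)]] that(1,2)] fp[OF c[OF that(3)]] that by (simp add: a)
  have d2: "hm X y y' \<bullet> ?a x y \<preceq>\<^bsub>tp X x,tp X y'\<^esub> ?a x y'"
    if "x \<in> carrier X" "y \<in> carrier X" "y' \<in> carrier X" for x y y'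
    using act[OF c[OF that(2)] c[OF that(3)] that(1)] that coyoneda[OF X c[OF that(2)] that(3)] by (simp add: a)
  have "?a \<in> qrel Q X X"
    using arr_a X by (subst qrel_iff) (auto simp: tp_obs, auto simp: monad_of_algebra_def)
  then have d: "distributor Q X X ?a" using d1 d2 by (simp add: distributor_iff[OF X X])
  have unit: "idm Q (tp X x) \<preceq>\<^bsub>tp X x,tp X x\<^esub> ?a x x" if "x \<in> carrier X" for x
    using L that by (simp add: a)
  have "hm X x y \<preceq>\<^bsub>tp X x,tp X y\<^esub> ?a x y" if xy: "x \<in> carrier X" "y \<in> carrier X" for x y
    using leq_trans[OF comp_mono_left[OF unit[OF xy(2)] hm_arr[OF X xy]] d1[OF xy xy(2)]]
    by (simp add: comp_id(2)[OF hm_arr[OF X xy]])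
  moreover have "?a y z \<bullet> ?a x y \<preceq>\<^bsub>tp X x,tp X z\<^esub> ?a x z"
    if xyz: "x \<in> carrier X" "y \<in> carrier X" "z \<in> carrier X" for x y z
  proof -
    let ?T = "coyo Q (Cop Q X) (coyo Q X z)"
    have cz: "coyo Q X z \<in> carrier (Cop Q X)" using c[OF xyz(3)] by simp
    note T = coyo_in_copresheaves[OF CX cz]
    have fT: "fst ?T = tp X z" using cz c[OF xyz(3)] xyz by simp
    have "cop_mult Q X ?T = coyo Q X z" by (rule cop_mult_coyo[OF X c[OF xyz(3)]])
    moreover have "cv ?T \<rho> \<bullet> ?a y z \<preceq>\<^bsub>tp X y,fst \<rho>\<^esub> pairing X (p \<rho>) (coyo Q X y)"
      if r: "\<rho> \<in> copresheaves Q X" for \<rho>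
      using act[OF c[OF xyz(3)] r xyz(2)] r cz xyz by (simp add: pairing_coyo[OF X pc[OF r] xyz(2)] a)
    ultimately show ?thesis
      using L[THEN conjunct2, rule_format, OF T c[OF xyz(2)], of "?a y z"] fT xyz arr_a by (simp add: a)
  qed
  ultimately show ?thesis using X d by (simp add: dist_monad_iff)
qed

lemma algebra_of_monad_values:
  assumes X: "qcategory Q X" and d: "distributor Q X X \<alpha>" and t: "\<tau> \<in> copresheaves Q X"
  shows "algebra_of_monad X \<alpha> \<tau> \<in> presheaves Q X"
    and "fst (algebra_of_monad X \<alpha> \<tau>) = fst \<tau>"
    and "x \<in> carrier X \<Longrightarrow> u \<preceq>\<^bsub>tp X x,fst \<tau>\<^esub> pv (algebra_of_monad X \<alpha> \<tau>) x \<longleftrightarrow>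
      arr (tp X x) (fst \<tau>) u \<and> (\<forall>x'\<in>carrier X. cv \<tau> x' \<bullet> u \<preceq>\<^bsub>tp X x,tp X x'\<^esub> \<alpha> x x')"
proof -
  note CX = qcategory_Cop[OF X]
  note g = distributor_graph[OF X CX qfunctor_cotransp[OF X X d]]
  show "algebra_of_monad X \<alpha> \<tau> \<in> presheaves Q X" "fst (algebra_of_monad X \<alpha> \<tau>) = fst \<tau>"
    using transp_in_presheaves[OF X CX g, of \<tau>] t by (auto simp: algebra_of_monad_def)
  assume x: "x \<in> carrier X"
  show "u \<preceq>\<^bsub>tp X x,fst \<tau>\<^esub> pv (algebra_of_monad X \<alpha> \<tau>) x \<longleftrightarrow>
      arr (tp X x) (fst \<tau>) u \<and> (\<forall>x'\<in>carrier X. cv \<tau> x' \<bullet> u \<preceq>\<^bsub>tp X x,tp X x'\<^esub> \<alpha> x x')"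
    using leq_hm_Cop_iff[OF X cotransp_in_copresheaves[OF X X d x] t, of u] x t
    by (simp add: algebra_of_monad_def)
qed

lemma qfunctor_algebra_of_monad:
  assumes X: "qcategory Q X" and d: "distributor Q X X \<alpha>"
  shows "qfunctor Q (Cop Q X) (Psh Q X) (algebra_of_monad X \<alpha>)"
  unfolding algebra_of_monad_def
  by (rule qfunctor_transp[OF X qcategory_Cop[OF X] distributor_graph[OF X qcategory_Cop[OF X] qfunctor_cotransp[OF X X d]]])

lemma comp_algebra_of_monad_leq:
  assumes X: "qcategory Q X" and d: "distributor Q X X \<alpha>" and t: "\<tau> \<in> copresheaves Q X"
    and x: "x \<in> carrier X" "x' \<in> carrier X"
  shows "cv \<tau> x' \<bullet> pv (algebra_of_monad X \<alpha> \<tau>) x \<preceq>\<^bsub>tp X x,tp X x'\<^esub> \<alpha> x x'"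
proof -
  note v = algebra_of_monad_values[OF X d t]
  have "arr (tp X x) (fst \<tau>) (pv (algebra_of_monad X \<alpha> \<tau>) x)"
    using presheaf_arr[OF X v(1) x(1)] v(2) by simp
  from v(3)[OF x(1), THEN iffD1, OF leq_refl[OF this]] show ?thesis using x by blast
qed

text \<open>The co-Yoneda lemma for \<open>\<alpha>(x, -)\<close>.\<close>

lemma algebra_of_monad_coyo:
  assumes X: "qcategory Q X" and d: "distributor Q X X \<alpha>" and x: "x \<in> carrier X" "x' \<in> carrier X"
  shows "pv (algebra_of_monad X \<alpha> (coyo Q X x')) x = \<alpha> x x'"
  using x coyo_in_copresheaves[OF X x(2)] coyoneda[OF X cotransp_in_copresheaves[OF X X d x(1)] x(2)]
  by (simp add: algebra_of_monad_def)

text \<open>For the multiplication axiom, bound \<open>T(y\<^sup>\<dagger>x') \<circ> u \<circ> p(\<tau>)(x)\<close> by the hypothesis at \<open>\<rho> = y\<^sup>\<dagger>x'\<close>: it is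
  below the supremum over \<open>z\<close> of \<open>\<alpha>(z, x') \<circ> \<tau>(z) \<circ> p(\<tau>)(x)\<close>, hence of \<open>\<alpha>(z, x') \<circ> \<alpha>(x, z)\<close>.\<close>

lemma algebra_of_monad_lax_algebra:
  assumes "dist_monad Q X \<alpha>"
  shows "lax_algebra Q X (algebra_of_monad X \<alpha>)"
proof -
  have X: "qcategory Q X" and d: "distributor Q X X \<alpha>"
    and le: "\<And>x y. x \<in> carrier X \<Longrightarrow> y \<in> carrier X \<Longrightarrow> hm X x y \<preceq>\<^bsub>tp X x,tp X y\<^esub> \<alpha> x y"
    and tr: "\<And>x y z. x \<in> carrier X \<Longrightarrow> y \<in> carrier X \<Longrightarrow> z \<in> carrier X \<Longrightarrow> \<alpha> y z \<bullet> \<alpha> x y \<preceq>\<^bsub>tp X x,tp X z\<^esub> \<alpha> x z"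
    using assms by (auto simp: dist_monad_iff)
  let ?p = "algebra_of_monad X \<alpha>"
  note CX = qcategory_Cop[OF X]
  note p = qfunctor_algebra_of_monad[OF X d] and v = algebra_of_monad_values[OF X d]
  note c = coyo_in_copresheaves[OF X] and da = distributor_arr[OF X X d]
  show ?thesis
    unfolding lax_algebra_iff[OF X p]
  proof (intro conjI ballI allI impI)
    fix x assume x: "x \<in> carrier X"
    show "idm Q (tp X x) \<preceq>\<^bsub>tp X x,tp X x\<^esub> pv (?p (coyo Q X x)) x"
      using leq_trans[OF hm_refl[OF X x] le[OF x x]] algebra_of_monad_coyo[OF X d x x] by simp
  next
    fix T \<tau> u x assume T: "T \<in> copresheaves Q (Cop Q X)" and t: "\<tau> \<in> copresheaves Q X"
      and u: "arr (fst \<tau>) (fst T) u" and x: "x \<in> carrier X"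
      and a: "\<forall>\<rho>\<in>copresheaves Q X. cv T \<rho> \<bullet> u \<preceq>\<^bsub>fst \<tau>,fst \<rho>\<^esub> pairing X (?p \<rho>) \<tau>"
    note m = cop_mult_in_copresheaves[OF X T]
    have pt: "arr (tp X x) (fst \<tau>) (pv (?p \<tau>) x)"
      using presheaf_arr[OF X v(1)[OF t] x] v(2)[OF t] by simp
    have "cv (cop_mult Q X T) x' \<bullet> u \<bullet> pv (?p \<tau>) x \<preceq>\<^bsub>tp X x,tp X x'\<^esub> \<alpha> x x'" if x': "x' \<in> carrier X" for x'
    proof -
      note pc = v(1)[OF c[OF x']]
      have Tx: "arr (fst T) (tp X x') (cv T (coyo Q X x'))"
        using copresheaf_arr[OF CX T, of "coyo Q X x'"] c[OF x'] x' by simp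
      have "cv T (coyo Q X x') \<bullet> u \<preceq>\<^bsub>fst \<tau>,tp X x'\<^esub> pairing X (?p (coyo Q X x')) \<tau>"
        using a c[OF x'] x' by (metis coyo_simps(1))
      from comp_mono_left[OF this pt]
      have "cv (cop_mult Q X T) x' \<bullet> u \<bullet> pv (?p \<tau>) x \<preceq>\<^bsub>tp X x,tp X x'\<^esub> pairing X (?p (coyo Q X x')) \<tau> \<bullet> pv (?p \<tau>) x"
        using cmp_assoc[OF pt u Tx] by (simp add: cv_cop_mult[OF X T x'])
      also have "\<dots> \<preceq>\<^bsub>tp X x,tp X x'\<^esub> \<alpha> x x'"
      proof -
        have "\<alpha> z x' \<bullet> cv \<tau> z \<bullet> pv (?p \<tau>) x \<preceq>\<^bsub>tp X x,tp X x'\<^esub> \<alpha> x x'" if z: "z \<in> carrier X" for z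
          using leq_trans[OF comp_mono_right[OF comp_algebra_of_monad_leq[OF X d t x z] da[OF z x']] tr[OF x z x']] .
        then show ?thesis
          using pairing_comp_leq_iff[OF X pc t pt] v(2)[OF c[OF x']] x x' da
          by (simp add: algebra_of_monad_coyo[OF X d])
      qed
      finally show ?thesis .
    qed
    then show "u \<bullet> pv (?p \<tau>) x \<preceq>\<^bsub>tp X x,fst T\<^esub> pv (?p (cop_mult Q X T)) x"
      using v(3)[OF m x, of "u \<bullet> pv (?p \<tau>) x"] fst_cop_mult[OF X T] arr_comp[OF pt u] by simp
  qed
qed

lemma monad_of_algebra_of_monad:
  assumes "dist_monad Q X \<alpha>"
  shows "monad_of_algebra X (algebra_of_monad X \<alpha>) = \<alpha>"
proof -
  have X: "qcategory Q X" and d: "distributor Q X X \<alpha>" using assms by (auto simp: dist_monad_iff)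
  have q: "\<alpha> \<in> qrel Q X X" using d by (simp add: distributor_def)
  show ?thesis
  proof (rule extensionalityI[of _ "carrier X"])
    show "\<alpha> \<in> extensional (carrier X)" using q by (auto simp: qrel_def PiE_iff)
    fix x assume x: "x \<in> carrier X"
    show "monad_of_algebra X (algebra_of_monad X \<alpha>) x = \<alpha> x"
      by (rule extensionalityI[of _ "carrier X"])
         (use q x algebra_of_monad_coyo[OF X d] in \<open>auto simp: monad_of_algebra_def qrel_def PiE_iff\<close>)
  qed (simp add: monad_of_algebra_def)
qed

text \<open>Let \<open>u\<close> be the value at \<open>\<tau>\<close> and \<open>x\<close> of the rebuilt algebra. The direct image \<open>T\<close> of \<open>\<tau>\<close> along \<open>y\<^sup>\<dagger>\<close>
  is the copresheaf with \<open>mT = \<tau>\<close> that has the smallest values; the representable of \<open>\<tau>\<close> also satisfies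
  \<open>mT = \<tau>\<close>, but for it the hypothesis of the multiplication axiom at \<open>\<rho> = \<tau>\<close> would already be the
  claim. The axiom gives \<open>u \<circ> p(y\<^sup>\<dagger>x)(x) \<preceq> p(\<tau>)(x)\<close>, and the unit axiom removes the second factor.\<close>

lemma algebra_of_monad_of_algebra:
  assumes "lax_algebra Q X p"
  shows "algebra_of_monad X (monad_of_algebra X p) = p"
proof -
  have X: "qcategory Q X" and p: "qfunctor Q (Cop Q X) (Psh Q X) p" using assms by (auto simp: lax_algebra_def)
  let ?a = "monad_of_algebra X p"
  let ?p = "algebra_of_monad X ?a"
  note PX = qcategory_Psh[OF X] and CX = qcategory_Cop[OF X] and c = coyo_in_copresheaves[OF X]
  have d: "distributor Q X X ?a" using monad_of_algebra_dist_monad[OF assms] by (simp add: dist_monad_iff)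
  note v = algebra_of_monad_values[OF X d]
  note L = lax_algebra_iff[OF X p, THEN iffD1, OF assms]
  have pc: "p \<tau> \<in> presheaves Q X" and fp: "fst (p \<tau>) = fst \<tau>" if "\<tau> \<in> copresheaves Q X" for \<tau>
    using qfunctor_closed[OF p, of \<tau>] qfunctor_tp[OF p, of \<tau>] that by auto
  have a: "?a x y = pv (p (coyo Q X y)) x" if "x \<in> carrier X" "y \<in> carrier X" for x y
    using that by (simp add: monad_of_algebra_def)
  note act = qfunctor_Cop_Psh_act[OF X p]
  have eq: "?p \<tau> = p \<tau>" if t: "\<tau> \<in> copresheaves Q X" for \<tau>
  proof (rule presheaf_eqI[OF X v(1)[OF t] pc[OF t]])
    show "fst (?p \<tau>) = fst (p \<tau>)" using v(2)[OF t] fp[OF t] by simp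
    fix x assume x: "x \<in> carrier X"
    show "pv (?p \<tau>) x = pv (p \<tau>) x"
    proof (rule leq_antisym[of _ "tp X x" "fst \<tau>"])
      have "arr (tp X x) (fst \<tau>) (pv (p \<tau>) x)" using presheaf_arr[OF X pc[OF t] x] fp[OF t] by simp
      moreover have "cv \<tau> x' \<bullet> pv (p \<tau>) x \<preceq>\<^bsub>tp X x,tp X x'\<^esub> ?a x x'" if x': "x' \<in> carrier X" for x'
        using act[OF t c[OF x'] x] x x' by (simp add: a coyoneda[OF X t x'])
      ultimately show "pv (p \<tau>) x \<preceq>\<^bsub>tp X x,fst \<tau>\<^esub> pv (?p \<tau>) x" using v(3)[OF t x] by blast
      let ?u = "pv (?p \<tau>) x"
      let ?T = "cop_dir Q X (Cop Q X) (coyo Q X) \<tau>"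
      note cf = qfunctor_coyo[OF X]
      note T = cop_dir_in_copresheaves[OF X CX cf t]
      have u: "arr (tp X x) (fst \<tau>) ?u" using presheaf_arr[OF X v(1)[OF t] x] v(2)[OF t] by simp
      have mT: "cop_mult Q X ?T = \<tau>" by (rule cop_mult_cop_dir_coyo[OF X t])
      have "cv ?T \<rho> \<bullet> ?u \<preceq>\<^bsub>tp X x,fst \<rho>\<^esub> pairing X (p \<rho>) (coyo Q X x)" if r: "\<rho> \<in> copresheaves Q X" for \<rho>
      proof -
        have P: "arr (tp X x) (fst \<rho>) (pv (p \<rho>) x)" using presheaf_arr[OF X pc[OF r] x] fp[OF r] by simp
        have "hm (Cop Q X) (coyo Q X z) \<rho> \<bullet> cv \<tau> z \<bullet> ?u \<preceq>\<^bsub>tp X x,fst \<rho>\<^esub> pv (p \<rho>) x" if z: "z \<in> carrier X" for z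
        proof -
          have h: "arr (tp X z) (fst \<rho>) (hm (Cop Q X) (coyo Q X z) \<rho>)" using hm_Cop_arr[OF X c[OF z] r] z by simp
          show ?thesis
            using leq_trans[OF comp_mono_right[OF comp_algebra_of_monad_leq[OF X d t x z] h]] act[OF c[OF z] r x] a[OF x z]
            by simp
        qed
        then have "cv ?T \<rho> \<bullet> ?u \<preceq>\<^bsub>tp X x,fst \<rho>\<^esub> pv (p \<rho>) x"
          using cv_cop_dir_comp_leq_iff[OF X CX cf t _ u, of \<rho>] r P by simp
        then show ?thesis by (simp add: pairing_coyo[OF X pc[OF r] x])
      qed
      then have le: "?u \<bullet> pv (p (coyo Q X x)) x \<preceq>\<^bsub>tp X x,fst \<tau>\<^esub> pv (p \<tau>) x"
        using L[THEN conjunct2, rule_format, OF T c[OF x], of ?u] x u t mT by simp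
      have "?u \<preceq>\<^bsub>tp X x,fst \<tau>\<^esub> ?u \<bullet> pv (p (coyo Q X x)) x"
        using comp_mono_right[OF L[THEN conjunct1, rule_format, OF x] u] comp_id(1)[OF u] by simp
      from leq_trans[OF this le] show "?u \<preceq>\<^bsub>tp X x,fst \<tau>\<^esub> pv (p \<tau>) x" .
    qed
  qed
  have "?p \<in> extensional (copresheaves Q X)" "p \<in> extensional (copresheaves Q X)"
    using qfunctor_algebra_of_monad[OF X d] p by (auto simp: qfunctor_def PiE_iff)
  then show ?thesis using eq by (rule extensionalityI)
qed

text \<open>A lax homomorphism is tested on representables, where it becomes the condition on \<open>\<alpha>\<close> and \<open>\<beta>\<close>, as
  direct image preserves representables. The converse composes the latter condition with
  \<open>\<tau>(x') \<circ> p(\<tau>)(x) \<preceq> \<alpha>(x, x')\<close>.\<close>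

lemma lax_hom_algebra_of_monad_iff:
  assumes "dist_monad Q X \<alpha>" and "dist_monad Q Y \<beta>"
  shows "lax_hom Q (X, algebra_of_monad X \<alpha>) (Y, algebra_of_monad Y \<beta>) f \<longleftrightarrow> monad_hom Q (X, \<alpha>) (Y, \<beta>) f"
proof (cases "qfunctor Q X Y f")
  case f: True
  have X: "qcategory Q X" and a: "distributor Q X X \<alpha>" and Y: "qcategory Q Y" and b: "distributor Q Y Y \<beta>"
    using assms by (auto simp: dist_monad_iff)
  let ?p = "algebra_of_monad X \<alpha>" and ?q = "algebra_of_monad Y \<beta>"
  note vp = algebra_of_monad_values[OF X a] and vq = algebra_of_monad_values[OF Y b]
  note fx = qfunctor_closed[OF f] qfunctor_tp[OF f]
  have lax: "obj_le Q (Psh Q Y) (psh_dir Q X Y f (?p \<tau>)) (?q (cop_dir Q X Y f \<tau>)) \<longleftrightarrow>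
      (\<forall>x\<in>carrier X. pv (?p \<tau>) x \<preceq>\<^bsub>tp X x,fst \<tau>\<^esub> pv (?q (cop_dir Q X Y f \<tau>)) (f x))"
    if t: "\<tau> \<in> copresheaves Q X" for \<tau>
  proof -
    note ft = cop_dir_in_copresheaves[OF X Y f t]
    note d = psh_dir_in_presheaves[OF X Y f vp(1)[OF t]]
    show ?thesis
      using obj_le_Psh_iff[OF Y d vq(1)[OF ft]] psh_dir_leq_iff[OF X Y f vp(1)[OF t] vq(1)[OF ft]]
        vp(1,2)[OF t] vq(2)[OF ft] t by simp
  qed
  have "(\<forall>\<tau>\<in>copresheaves Q X. \<forall>x\<in>carrier X. pv (?p \<tau>) x \<preceq>\<^bsub>tp X x,fst \<tau>\<^esub> pv (?q (cop_dir Q X Y f \<tau>)) (f x))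
    \<longleftrightarrow> (\<forall>x\<in>carrier X. \<forall>x'\<in>carrier X. \<alpha> x x' \<preceq>\<^bsub>tp X x,tp X x'\<^esub> \<beta> (f x) (f x'))" (is "?l \<longleftrightarrow> ?r")
  proof
    assume l: ?l
    show ?r
    proof (intro ballI)
      fix x x' assume x: "x \<in> carrier X" "x' \<in> carrier X"
      note c = coyo_in_copresheaves[OF X x(2)]
      have "cop_dir Q X Y f (coyo Q X x') = coyo Q Y (f x')" by (rule cop_dir_coyo[OF X Y f x(2)])
      then show "\<alpha> x x' \<preceq>\<^bsub>tp X x,tp X x'\<^esub> \<beta> (f x) (f x')"
        using l[rule_format, OF c x(1)] x fx
        by (simp add: algebra_of_monad_coyo[OF X a] algebra_of_monad_coyo[OF Y b])
    qed
  next
    assume r: ?r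
    show ?l
    proof (intro ballI)
      fix \<tau> x assume t: "\<tau> \<in> copresheaves Q X" and x: "x \<in> carrier X"
      note ft = cop_dir_in_copresheaves[OF X Y f t]
      let ?u = "pv (?p \<tau>) x"
      have u: "arr (tp X x) (fst \<tau>) ?u" using presheaf_arr[OF X vp(1)[OF t] x] vp(2)[OF t] by simp
      have "hm Y (f z) y \<bullet> cv \<tau> z \<bullet> ?u \<preceq>\<^bsub>tp X x,tp Y y\<^esub> \<beta> (f x) y" if z: "z \<in> carrier X" and y: "y \<in> carrier Y" for z y
      proof -
        have "cv \<tau> z \<bullet> ?u \<preceq>\<^bsub>tp X x,tp X z\<^esub> \<beta> (f x) (f z)"
          using leq_trans[OF comp_algebra_of_monad_leq[OF X a t x z]] r x z by blast
        from comp_mono_right[OF this hm_f_arr(1)[OF X Y f z y]]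
        have "hm Y (f z) y \<bullet> cv \<tau> z \<bullet> ?u \<preceq>\<^bsub>tp X x,tp Y y\<^esub> hm Y (f z) y \<bullet> \<beta> (f x) (f z)" .
        also have "\<dots> \<preceq>\<^bsub>tp X x,tp Y y\<^esub> \<beta> (f x) y"
          using b fx(1)[OF x] fx(1)[OF z] fx(2)[OF x] y by (auto simp: distributor_iff[OF Y Y])
        finally show ?thesis .
      qed
      then have "cv (cop_dir Q X Y f \<tau>) y \<bullet> ?u \<preceq>\<^bsub>tp X x,tp Y y\<^esub> \<beta> (f x) y" if y: "y \<in> carrier Y" for y
        using cv_cop_dir_comp_leq_iff[OF X Y f t y u] y distributor_arr[OF Y Y b fx(1)[OF x] y] fx(2)[OF x] by simp
      then show "?u \<preceq>\<^bsub>tp X x,fst \<tau>\<^esub> pv (?q (cop_dir Q X Y f \<tau>)) (f x)"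
        using vq(3)[OF ft fx(1)[OF x], of ?u] t u fx(2)[OF x] by simp
    qed
  qed
  then show ?thesis
    using f lax monad_hom_iff[OF X Y a b, of f] by (simp add: lax_hom_def fun_le_def)
qed (auto simp: lax_hom_def monad_hom_def)

end

section \<open>The isomorphism of 2-categories\<close>

text \<open>2-categories whose homs, composition and order agree along a bijection of objects are isomorphic,
  and it suffices to verify the axioms in one of them.\<close>

lemma two_iso_relabel:
  assumes D: "two_category \<D>"
    and F: "\<And>A. A \<in> obj2 \<C> \<Longrightarrow> F A \<in> obj2 \<D>" and G: "\<And>B. B \<in> obj2 \<D> \<Longrightarrow> G B \<in> obj2 \<C>"
    and GF: "\<And>A. A \<in> obj2 \<C> \<Longrightarrow> G (F A) = A" and FG: "\<And>B. B \<in> obj2 \<D> \<Longrightarrow> F (G B) = B"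
    and hom: "\<And>A B. A \<in> obj2 \<C> \<Longrightarrow> B \<in> obj2 \<C> \<Longrightarrow> hom2 \<C> A B = hom2 \<D> (F A) (F B)"
    and id: "\<And>A. id2 \<C> A = id2 \<D> (F A)"
    and cmp: "\<And>A B C. cmp2 \<C> A B C = cmp2 \<D> (F A) (F B) (F C)"
    and le: "\<And>A B. le2 \<C> A B = le2 \<D> (F A) (F B)"
  shows "two_iso \<C> \<D>"
proof -
  have C: "two_category \<C>"
    unfolding two_category_def id cmp le
  proof (intro conjI ballI impI)
    have D_id: "\<forall>A\<in>obj2 \<D>. id2 \<D> A \<in> hom2 \<D> A A"
      and D_cmp: "\<forall>A\<in>obj2 \<D>. \<forall>B\<in>obj2 \<D>. \<forall>C\<in>obj2 \<D>. \<forall>f\<in>hom2 \<D> A B. \<forall>g\<in>hom2 \<D> B C.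
        cmp2 \<D> A B C g f \<in> hom2 \<D> A C"
      and D_unit: "\<forall>A\<in>obj2 \<D>. \<forall>B\<in>obj2 \<D>. \<forall>f\<in>hom2 \<D> A B.
        cmp2 \<D> A A B f (id2 \<D> A) = f \<and> cmp2 \<D> A B B (id2 \<D> B) f = f"
      and D_assoc: "\<forall>A\<in>obj2 \<D>. \<forall>B\<in>obj2 \<D>. \<forall>C\<in>obj2 \<D>. \<forall>E\<in>obj2 \<D>.
        \<forall>f\<in>hom2 \<D> A B. \<forall>g\<in>hom2 \<D> B C. \<forall>h\<in>hom2 \<D> C E.
        cmp2 \<D> A C E h (cmp2 \<D> A B C g f) = cmp2 \<D> A B E (cmp2 \<D> B C E h g) f"
      and D_refl: "\<forall>A\<in>obj2 \<D>. \<forall>B\<in>obj2 \<D>. \<forall>f\<in>hom2 \<D> A B. le2 \<D> A B f f"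
      and D_trans: "\<forall>A\<in>obj2 \<D>. \<forall>B\<in>obj2 \<D>. \<forall>f\<in>hom2 \<D> A B. \<forall>g\<in>hom2 \<D> A B. \<forall>h\<in>hom2 \<D> A B.
        le2 \<D> A B f g \<and> le2 \<D> A B g h \<longrightarrow> le2 \<D> A B f h"
      and D_mono: "\<forall>A\<in>obj2 \<D>. \<forall>B\<in>obj2 \<D>. \<forall>C\<in>obj2 \<D>.
        \<forall>f\<in>hom2 \<D> A B. \<forall>f'\<in>hom2 \<D> A B. \<forall>g\<in>hom2 \<D> B C. \<forall>g'\<in>hom2 \<D> B C.
        le2 \<D> A B f f' \<and> le2 \<D> B C g g'
          \<longrightarrow> le2 \<D> A C (cmp2 \<D> A B C g f) (cmp2 \<D> A B C g' f')"
      using D unfolding two_category_def by - (elim conjE, assumption)+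
    fix A assume A: "A \<in> obj2 \<C>"
    show "id2 \<D> (F A) \<in> hom2 \<C> A A"
      using bspec[OF D_id F[OF A]] hom[OF A A] by simp
    fix B f assume B: "B \<in> obj2 \<C>" and "f \<in> hom2 \<C> A B"
    then have f: "f \<in> hom2 \<D> (F A) (F B)" using hom[OF A B] by simp
    note unit = D_unit[rule_format, OF F[OF A] F[OF B] f]
    show "cmp2 \<D> (F A) (F A) (F B) f (id2 \<D> (F A)) = f" by (rule unit[THEN conjunct1])
    show "cmp2 \<D> (F A) (F B) (F B) (id2 \<D> (F B)) f = f" by (rule unit[THEN conjunct2])
    show "le2 \<D> (F A) (F B) f f" by (rule D_refl[rule_format, OF F[OF A] F[OF B] f])
    {
      fix g h assume "g \<in> hom2 \<C> A B" "h \<in> hom2 \<C> A B"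
        and le: "le2 \<D> (F A) (F B) f g \<and> le2 \<D> (F A) (F B) g h"
      then have "g \<in> hom2 \<D> (F A) (F B)" "h \<in> hom2 \<D> (F A) (F B)" using hom[OF A B] by simp_all
      then show "le2 \<D> (F A) (F B) f h"
        using D_trans[rule_format, OF F[OF A] F[OF B] f] le by blast
    }
    fix C assume C: "C \<in> obj2 \<C>"
    {
      fix g assume "g \<in> hom2 \<C> B C"
      then have g: "g \<in> hom2 \<D> (F B) (F C)" using hom[OF B C] by simp
      show "cmp2 \<D> (F A) (F B) (F C) g f \<in> hom2 \<C> A C"
        using D_cmp[rule_format, OF F[OF A] F[OF B] F[OF C] f g] hom[OF A C] by simp
      fix E h assume E: "E \<in> obj2 \<C>" and "h \<in> hom2 \<C> C E"
      then have h: "h \<in> hom2 \<D> (F C) (F E)" using hom[OF C E] by simp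
      show "cmp2 \<D> (F A) (F C) (F E) h (cmp2 \<D> (F A) (F B) (F C) g f)
        = cmp2 \<D> (F A) (F B) (F E) (cmp2 \<D> (F B) (F C) (F E) h g) f"
        by (rule D_assoc[rule_format, OF F[OF A] F[OF B] F[OF C] F[OF E] f g h])
    }
    fix f2 g g2 assume "f2 \<in> hom2 \<C> A B" "g \<in> hom2 \<C> B C" "g2 \<in> hom2 \<C> B C"
      and le: "le2 \<D> (F A) (F B) f f2 \<and> le2 \<D> (F B) (F C) g g2"
    then have f2: "f2 \<in> hom2 \<D> (F A) (F B)" and g: "g \<in> hom2 \<D> (F B) (F C)" "g2 \<in> hom2 \<D> (F B) (F C)"
      using hom[OF A B] hom[OF B C] by simp_all
    show "le2 \<D> (F A) (F C) (cmp2 \<D> (F A) (F B) (F C) g f) (cmp2 \<D> (F A) (F B) (F C) g2 f2)"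
      by (rule D_mono[rule_format, OF F[OF A] F[OF B] F[OF C] f f2 g le])
  qed
  have hom': "hom2 \<C> (G A) (G B) = hom2 \<D> A B" if "A \<in> obj2 \<D>" "B \<in> obj2 \<D>" for A B
    using that by (simp add: hom G FG)
  have "two_functor \<C> \<D> F (\<lambda>_ _ f. f)"
    using F by (simp add: two_functor_def hom id cmp le)
  moreover have "two_functor \<D> \<C> G (\<lambda>_ _ f. f)"
    using G by (simp add: two_functor_def hom' id cmp le FG)
  ultimately show ?thesis
    using C D GF FG unfolding two_iso_def by blast
qed

lemma (in quantaloid) two_iso_Lax_Alg_Mon_Dist:
  "two_iso (Lax_Alg Q :: (('a, 'o, 'm) lax_alg, 'a \<Rightarrow> 'a) cat2)
    (Mon_Dist Q :: (('a, 'o, 'm) dist_mon, 'a \<Rightarrow> 'a) cat2)"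
proof (rule two_iso_relabel[OF two_category_Mon_Dist, where F = "\<lambda>A :: ('a, 'o, 'm) lax_alg. (fst A, monad_of_algebra (fst A) (snd A))"
      and G = "\<lambda>B :: ('a, 'o, 'm) dist_mon. (fst B, algebra_of_monad (fst B) (snd B))"])
  fix A B :: "('a, 'o, 'm) lax_alg"
  assume "A \<in> obj2 (Lax_Alg Q)" "B \<in> obj2 (Lax_Alg Q)"
  then obtain X p Y q where A: "A = (X, p)" "lax_algebra Q X p" and B: "B = (Y, q)" "lax_algebra Q Y q"
    by (auto simp: Lax_Alg_def)
  show "hom2 (Lax_Alg Q) A B = hom2 (Mon_Dist Q) (fst A, monad_of_algebra (fst A) (snd A))
      (fst B, monad_of_algebra (fst B) (snd B))"
    using lax_hom_algebra_of_monad_iff[OF monad_of_algebra_dist_monad[OF A(2)] monad_of_algebra_dist_monad[OF B(2)]]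
      A B by (simp add: Lax_Alg_def Mon_Dist_def algebra_of_monad_of_algebra set_eq_iff)
qed (auto simp: Lax_Alg_def Mon_Dist_def monad_of_algebra_dist_monad
    algebra_of_monad_lax_algebra monad_of_algebra_of_monad algebra_of_monad_of_algebra)

theorem theorem5p6:
  fixes Q :: "('o, 'm) quantaloid_data"
  assumes "quantaloid Q"
  shows "lam_dag_strict_law Q TYPE('a) \<and>
    (\<forall>X :: ('a, 'o, 'm) qcat. qcategory Q X \<longrightarrow>
       fun_eq (Cop Q (Psh Q X)) (lam_dag Q X) (lam_dag_composite Q X)) \<and>
    two_iso (Lax_Alg Q :: (('a, 'o, 'm) lax_alg, 'a \<Rightarrow> 'a) cat2)
      (Mon_Dist Q :: (('a, 'o, 'm) dist_mon, 'a \<Rightarrow> 'a) cat2)"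
proof -
  interpret quantaloid Q by (rule assms)
  show ?thesis
    using lam_dag_is_strict_law lam_dag_composite_eq two_iso_Lax_Alg_Mon_Dist by (auto simp: fun_eq_def)
qed

end
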